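(* Let $F$ be a field of characteristic zero and $A$ a superalgebra over $F$ with a superinvolution or graded involution $\#$, with $\langle n\rangle$-th $\#$-cocharacters $\chi_{\langle n\rangle}(A)=\sum_{\langle\lambda\rangle\vdash\langle n\rangle}m_{\langle\lambda\rangle}\chi_{\langle\lambda\rangle}$. Suppose $A$ is a PI-algebra and let $\langle d,l\rangle=(d_1,l_1;d_2,l_2;d_3,l_3;d_4,l_4)$ with $d_i,l_i\ge0$. Then $A$ satisfies the Amitsur $\#$-superidentity $E_{\langle d,l\rangle}$ of rank $\langle d,l\rangle$ if and only if $m_{\langle\lambda\rangle}=0$ for every $\langle n\rangle$ and every $\langle\lambda\rangle\vdash\langle n\rangle$ with $\langle\lambda\rangle\notin\mathcal H_{\langle d,l\rangle}$.
   Context: A superalgebra is $A=A_0\oplus A_1$; a superinvolution is an $F$-linear $\#$ with $A_i^\#\subseteq A_i$, $(c^\#)^\#=c$, $(ab)^\#=(-1)^{\deg a\deg b}b^\#a^\#$; a graded involution is $F$-linear $\#$ with $A_i^\#\subseteq A_i$, $(c^\#)^\#=c$, $(ab)^\#=b^\#a^\#$. $A_i^\pm=\{a\in A_i:a^\#=\pm a\}$. PI-algebra: satisfies a nontrivial ordinary polynomial identity. $\mathcal F$ is the free non-unital associative algebra on $y_{i,j}$ (symmetric), $z_{i,j}$ (skew), $i\in\{0,1\}$, $j\ge1$, graded by the first index, with induced $\#$. $f\equiv0$ in $A$ ($\#$-superidentity) means $f$ vanishes under all substitutions $y_{0,j}\mapsto A_0^+$, $z_{0,j}\mapsto A_0^-$,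 $y_{1,j}\mapsto A_1^+$, $z_{1,j}\mapsto A_1^-$; $Id_2^\#(A)$ is their set. For $\langle n\rangle=(n_1,\dots,n_4)$, $P_{\langle n\rangle}$ is the span of monomials multilinear in $y_{0,1..n_1},z_{0,1..n_2},y_{1,1..n_3},z_{1,1..n_4}$, with $S_{n_1}\times\cdots\times S_{n_4}$ permuting second indices of each type; $\chi_{\langle n\rangle}(A)$ is the character of $P_{\langle n\rangle}/(P_{\langle n\rangle}\cap Id_2^\#(A))$, decomposed over $\chi_{\langle\lambda\rangle}=\chi_{\lambda(1)}\otimes\cdots\otimes\chi_{\lambda(4)}$, $\lambda(i)\vdash n_i$. $\mathcal H(d,l)$ is the set of partitions with $\lambda_{d+1}\le l$, and $\langle\lambda\rangle\in\mathcal H_{\langle d,l\rangle}$ means $\lambda(i)\in\mathcal H(d_i,l_i)$ for all $i$. Amitsur polynomials: for $i=1,\dots,4$ let $k_i=(l_i+1)(d_i+1)$, let $\hat\lambda(i)\vdash k_i$ be the rectangular partition with $d_i+1$ parts all equal to $l_i+1$, and $\widehat k=\max_i k_i$. Define $E_{1}=\sum_{\sigma\in S_{k_1}}\chi_{\hat\lambda(1)}(\sigma)x_1y_{0,\sigma(1)}x_2\cdots x_{k_1}y_{0,\sigma(k_1)}x_{k_1+1}$, and $E_2,E_3,E_4$ likewise with special variables $z_{0,1},\dots,z_{0,k_2}$ (character $\chi_{\hat\lambda(2)}$, $k_2$), $y_{1,1},\dots,y_{1,k_3}$ (character $\chi_{\hat\lambda(3)}$, $k_3$), $z_{1,1},\dots,z_{1,k_4}$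 (character $\chi_{\hat\lambda(4)}$, $k_4$) in place of $y_{0,\cdot}$, where each $x_j$ ($j=1,\dots,\widehat k+1$) is any element of $\{y_{0,k_1+j},z_{0,k_2+j},y_{1,k_3+j},z_{1,k_4+j},1\}$ (choosing $x_j=1$ means $x_j$ is omitted). $A$ satisfies $E_{\langle d,l\rangle}$ if $E_i\equiv0$ in $A$ for $i=1,2,3,4$ and for all such choices of the $x_j$. *)

theory Defs
  imports Main HOL.Modules "HOL-Library.Poly_Mapping" "HOL-Library.FuncSet" "HOL-Combinatorics.Permutations"
begin

definition is_partition :: "nat list \<Rightarrow> nat \<Rightarrow> bool" where
  "is_partition lam k \<longleftrightarrow> sorted_wrt (\<ge>) lam \<and> (\<forall>x\<in>set lam. 0 < x) \<and> sum_list lam = k"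

text \<open>Permutation character of the Young subgroup with composition alpha (value of the
  character of h_alpha_1 ... h_alpha_m): number of maps f:{1..k}->{0..<m} with fibre
  sizes alpha that are constant on sigma-orbits; zero if some alpha_i is negative.\<close>
definition young_perm_char :: "nat \<Rightarrow> nat \<Rightarrow> (nat \<Rightarrow> int) \<Rightarrow> (nat \<Rightarrow> nat) \<Rightarrow> int" where
  "young_perm_char k m alpha sigma =
     (if \<forall>i<m. 0 \<le> alpha i then
        int (card {f \<in> {1..k} \<rightarrow>\<^sub>E {0..<m}.
                 (\<forall>x\<in>{1..k}. f (sigma x) = f x) \<and>
                 (\<forall>i<m. int (card {x\<in>{1..k}. f x = i}) = alpha i)})
      else 0)"

text \<open>Irreducible character chi_lam of S_k (k = |lam|) evaluated at a permutation sigma of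
  {1..k}, via the Jacobi--Trudi / Frobenius determinantal formula.\<close>
definition irr_char :: "nat list \<Rightarrow> (nat \<Rightarrow> nat) \<Rightarrow> int" where
  "irr_char lam sigma =
     (let m = length lam in
      \<Sum>p | p permutes {0..<m}.
         sign p * young_perm_char (sum_list lam) m
                    (\<lambda>i. int (lam ! i) - int i + int (p i)) sigma)"

text \<open>Membership of a partition in the hook H(d,l): lam_{d+1} \<le> l (1-based).\<close>
definition in_hook :: "nat \<Rightarrow> nat \<Rightarrow> nat list \<Rightarrow> bool" where
  "in_hook d l lam \<longleftrightarrow> (d < length lam \<longrightarrow> lam ! d \<le> l)"

text \<open>Kinds of variables: Y0 = y_{0,j} (even symmetric), Z0 = z_{0,j} (even skew),
  Y1 = y_{1,j} (odd symmetric), Z1 = z_{1,j} (odd skew).\<close>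
datatype kind = Y0 | Z0 | Y1 | Z1

lemma UNIV_kind: "(UNIV :: kind set) = {Y0, Z0, Y1, Z1}"
  using kind.exhaust by auto

instance kind :: finite
  by standard (simp add: UNIV_kind)

type_synonym var = "kind \<times> nat"

text \<open>Non-unital non-commutative polynomials: finitely supported coefficient functions on
  words (the empty word is never used by polynomials we consider, and is evaluated to 0).\<close>
type_synonym 'f ncpoly = "var list \<Rightarrow>\<^sub>0 'f"

fun wprod :: "'a::ring list \<Rightarrow> 'a" where
  "wprod [] = 0"
| "wprod [a] = a"
| "wprod (a # b # w) = a * wprod (b # w)"

definition eval_poly :: "('f \<Rightarrow> 'a::ring \<Rightarrow> 'a) \<Rightarrow> ('v \<Rightarrow> 'a) \<Rightarrow> ('v list \<Rightarrow>\<^sub>0 'f::zero) \<Rightarrow> 'a" where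
  "eval_poly scale phi p = (\<Sum>w\<in>Poly_Mapping.keys p. scale (Poly_Mapping.lookup p w) (wprod (map phi w)))"

definition is_superalgebra ::
  "('f::field \<Rightarrow> 'a::ring \<Rightarrow> 'a) \<Rightarrow> 'a set \<Rightarrow> 'a set \<Rightarrow> bool" where
  "is_superalgebra scale A0 A1 \<longleftrightarrow>
     module scale \<and>
     (\<forall>c a b. scale c (a * b) = scale c a * b \<and> scale c (a * b) = a * scale c b) \<and>
     module.subspace scale A0 \<and> module.subspace scale A1 \<and>
     A0 \<inter> A1 = {0} \<and> (\<forall>a. \<exists>a0\<in>A0. \<exists>a1\<in>A1. a = a0 + a1) \<and>
     (\<forall>a\<in>A0. \<forall>b\<in>A0. a * b \<in> A0) \<and> (\<forall>a\<in>A0. \<forall>b\<in>A1. a * b \<in> A1) \<and>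
     (\<forall>a\<in>A1. \<forall>b\<in>A0. a * b \<in> A1) \<and> (\<forall>a\<in>A1. \<forall>b\<in>A1. a * b \<in> A0)"

definition graded_linear_involutive ::
  "('f::field \<Rightarrow> 'a::ring \<Rightarrow> 'a) \<Rightarrow> 'a set \<Rightarrow> 'a set \<Rightarrow> ('a \<Rightarrow> 'a) \<Rightarrow> bool" where
  "graded_linear_involutive scale A0 A1 sharp \<longleftrightarrow>
     (\<forall>a b. sharp (a + b) = sharp a + sharp b) \<and> (\<forall>c a. sharp (scale c a) = scale c (sharp a)) \<and>
     sharp ` A0 \<subseteq> A0 \<and> sharp ` A1 \<subseteq> A1 \<and> (\<forall>a. sharp (sharp a) = a)"

definition is_superinvolution ::
  "('f::field \<Rightarrow> 'a::ring \<Rightarrow> 'a) \<Rightarrow> 'a set \<Rightarrow> 'a set \<Rightarrow> ('a \<Rightarrow> 'a) \<Rightarrow> bool" where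
  "is_superinvolution scale A0 A1 sharp \<longleftrightarrow>
     graded_linear_involutive scale A0 A1 sharp \<and>
     (\<forall>a\<in>A0. \<forall>b\<in>A0. sharp (a * b) = sharp b * sharp a) \<and>
     (\<forall>a\<in>A0. \<forall>b\<in>A1. sharp (a * b) = sharp b * sharp a) \<and>
     (\<forall>a\<in>A1. \<forall>b\<in>A0. sharp (a * b) = sharp b * sharp a) \<and>
     (\<forall>a\<in>A1. \<forall>b\<in>A1. sharp (a * b) = - (sharp b * sharp a))"

definition is_graded_involution ::
  "('f::field \<Rightarrow> 'a::ring \<Rightarrow> 'a) \<Rightarrow> 'a set \<Rightarrow> 'a set \<Rightarrow> ('a \<Rightarrow> 'a) \<Rightarrow> bool" where
  "is_graded_involution scale A0 A1 sharp \<longleftrightarrow>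
     graded_linear_involutive scale A0 A1 sharp \<and> (\<forall>a b. sharp (a * b) = sharp b * sharp a)"

definition kind_space :: "'a set \<Rightarrow> 'a set \<Rightarrow> ('a \<Rightarrow> 'a::ring) \<Rightarrow> kind \<Rightarrow> 'a set" where
  "kind_space A0 A1 sharp k = (case k of
      Y0 \<Rightarrow> {a\<in>A0. sharp a = a} | Z0 \<Rightarrow> {a\<in>A0. sharp a = - a}
    | Y1 \<Rightarrow> {a\<in>A1. sharp a = a} | Z1 \<Rightarrow> {a\<in>A1. sharp a = - a})"

definition is_sid ::
  "('f::field \<Rightarrow> 'a::ring \<Rightarrow> 'a) \<Rightarrow> 'a set \<Rightarrow> 'a set \<Rightarrow> ('a \<Rightarrow> 'a) \<Rightarrow> 'f ncpoly \<Rightarrow> bool" where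
  "is_sid scale A0 A1 sharp f \<longleftrightarrow>
     (\<forall>phi. (\<forall>k j. phi (k, j) \<in> kind_space A0 A1 sharp k) \<longrightarrow> eval_poly scale phi f = 0)"

text \<open>A satisfies a nontrivial ordinary polynomial identity (free non-unital algebra on x_j).\<close>
definition is_PI :: "('f::field \<Rightarrow> 'a::ring \<Rightarrow> 'a) \<Rightarrow> bool" where
  "is_PI scale \<longleftrightarrow>
     (\<exists>p :: nat list \<Rightarrow>\<^sub>0 'f. p \<noteq> 0 \<and> [] \<notin> Poly_Mapping.keys p \<and> (\<forall>phi. eval_poly scale phi p = 0))"

definition poly_scale :: "'f::field \<Rightarrow> 'f ncpoly \<Rightarrow> 'f ncpoly" where
  "poly_scale c p = Poly_Mapping.map ((*) c) p"

text \<open>Trace of the map induced by T on the quotient V/W (W \<subseteq> V finite-dimensional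
  subspaces): take a basis bw of W extended by bv to a basis of V, and sum the diagonal
  coordinates of T along bv.\<close>
definition quot_trace ::
  "('f::field \<Rightarrow> 'b::ab_group_add \<Rightarrow> 'b) \<Rightarrow> 'b set \<Rightarrow> 'b set \<Rightarrow> ('b \<Rightarrow> 'b) \<Rightarrow> 'f" where
  "quot_trace scale V W T =
     (SOME t. \<exists>bw bv. distinct (bw @ bv) \<and>
        \<not> module.dependent scale (set (bw @ bv)) \<and>
        module.span scale (set bw) = W \<and> module.span scale (set (bw @ bv)) = V \<and>
        t = (\<Sum>b\<leftarrow>bv. module.representation scale (set (bw @ bv)) (T b) b))"

definition ml_words :: "(kind \<Rightarrow> nat) \<Rightarrow> var list set" where
  "ml_words n = {w. distinct w \<and> set w = {(k, j). 1 \<le> j \<and> j \<le> n k}}"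

definition P_space :: "(kind \<Rightarrow> nat) \<Rightarrow> 'f::field ncpoly set" where
  "P_space n = {p. Poly_Mapping.keys p \<subseteq> ml_words n}"

definition group_G :: "(kind \<Rightarrow> nat) \<Rightarrow> (kind \<Rightarrow> nat \<Rightarrow> nat) set" where
  "group_G n = {g. \<forall>k. g k permutes {1..n k}}"

definition act_poly :: "(kind \<Rightarrow> nat \<Rightarrow> nat) \<Rightarrow> 'f::field ncpoly \<Rightarrow> 'f ncpoly" where
  "act_poly g p = (\<Sum>w\<in>Poly_Mapping.keys p. Poly_Mapping.single (map (\<lambda>(k, j). (k, g k j)) w) (Poly_Mapping.lookup p w))"

definition cochar ::
  "('f::field \<Rightarrow> 'a::ring \<Rightarrow> 'a) \<Rightarrow> 'a set \<Rightarrow> 'a set \<Rightarrow> ('a \<Rightarrow> 'a) \<Rightarrow>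
   (kind \<Rightarrow> nat) \<Rightarrow> (kind \<Rightarrow> nat \<Rightarrow> nat) \<Rightarrow> 'f" where
  "cochar scale A0 A1 sharp n g =
     quot_trace poly_scale (P_space n) {p\<in>P_space n. is_sid scale A0 A1 sharp p} (act_poly g)"

definition multipartitions :: "(kind \<Rightarrow> nat) \<Rightarrow> (kind \<Rightarrow> nat list) set" where
  "multipartitions n = {lam. \<forall>k. is_partition (lam k) (n k)}"

definition cochar_decomp ::
  "('f::field_char_0 \<Rightarrow> 'a::ring \<Rightarrow> 'a) \<Rightarrow> 'a set \<Rightarrow> 'a set \<Rightarrow> ('a \<Rightarrow> 'a) \<Rightarrow>
   ((kind \<Rightarrow> nat list) \<Rightarrow> nat) \<Rightarrow> bool" where
  "cochar_decomp scale A0 A1 sharp m \<longleftrightarrow>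
     (\<forall>n. \<forall>g\<in>group_G n. cochar scale A0 A1 sharp n g =
        (\<Sum>lam\<in>multipartitions n. of_nat (m lam) * of_int (\<Prod>k\<in>UNIV. irr_char (lam k) (g k))))"

definition in_H :: "(kind \<Rightarrow> nat) \<Rightarrow> (kind \<Rightarrow> nat) \<Rightarrow> (kind \<Rightarrow> nat list) \<Rightarrow> bool" where
  "in_H d l lam \<longleftrightarrow> (\<forall>k. in_hook (d k) (l k) (lam k))"

definition kk :: "(kind \<Rightarrow> nat) \<Rightarrow> (kind \<Rightarrow> nat) \<Rightarrow> kind \<Rightarrow> nat" where
  "kk d l k = (l k + 1) * (d k + 1)"

text \<open>x_j according to the choice c j (None means x_j = 1, i.e. omitted).\<close>
definition xvar :: "(kind \<Rightarrow> nat) \<Rightarrow> (kind \<Rightarrow> nat) \<Rightarrow> (nat \<Rightarrow> kind option) \<Rightarrow> nat \<Rightarrow> var list" where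
  "xvar d l c j = (case c j of None \<Rightarrow> [] | Some k' \<Rightarrow> [(k', kk d l k' + j)])"

definition amitsur_word ::
  "(kind \<Rightarrow> nat) \<Rightarrow> (kind \<Rightarrow> nat) \<Rightarrow> kind \<Rightarrow> (nat \<Rightarrow> kind option) \<Rightarrow> (nat \<Rightarrow> nat) \<Rightarrow> var list" where
  "amitsur_word d l k c sigma =
     concat (map (\<lambda>j. xvar d l c j @ [(k, sigma j)]) [1..<kk d l k + 1]) @ xvar d l c (kk d l k + 1)"

definition amitsur_poly ::
  "(kind \<Rightarrow> nat) \<Rightarrow> (kind \<Rightarrow> nat) \<Rightarrow> kind \<Rightarrow> (nat \<Rightarrow> kind option) \<Rightarrow> 'f::field ncpoly" where
  "amitsur_poly d l k c =
     (\<Sum>sigma | sigma permutes {1..kk d l k}.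
        Poly_Mapping.single (amitsur_word d l k c sigma)
          (of_int (irr_char (replicate (d k + 1) (l k + 1)) sigma)))"

definition satisfies_amitsur ::
  "('f::field \<Rightarrow> 'a::ring \<Rightarrow> 'a) \<Rightarrow> 'a set \<Rightarrow> 'a set \<Rightarrow> ('a \<Rightarrow> 'a) \<Rightarrow>
   (kind \<Rightarrow> nat) \<Rightarrow> (kind \<Rightarrow> nat) \<Rightarrow> bool" where
  "satisfies_amitsur scale A0 A1 sharp d l \<longleftrightarrow>
     (\<forall>k c. is_sid scale A0 A1 sharp (amitsur_poly d l k c :: 'f ncpoly))"

end

theory Submission
  imports Defs HOL.Vector_Spaces
begin

text \<open>Fix a kind \<open>k\<close> and let \<open>e\<close> be the element \<open>sum chi(s) s\<close> of the group algebra of the symmetric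
  group on \<open>K = (d k + 1) (l k + 1)\<close> letters, where \<open>chi\<close> is the character of the rectangle. An Amitsur
  polynomial is \<open>e\<close> applied to a word. Splitting a multilinear word at its first \<open>K\<close> variables of
  kind \<open>k\<close>, and decomposing the remaining blocks into graded symmetric and skew parts, shows that
  the Amitsur identities hold iff \<open>e\<close> kills every cocharacter module. The trace of \<open>e\<close> on such a module is
  a combination of the multiplicities whose coefficients, by branching and orthogonality, are
  nonnegative and vanish exactly inside the hook. This settles one direction; for the other, trace
  zero must imply action zero. This holds for the Young symmetrizer of the rectangle, which is
  quasi-idempotent, and \<open>e\<close> is up to a nonzero factor the sum of its conjugates.

  Since the irreducible characters are given by the Jacobi--Trudi formula only, orthogonality is
  derived from counting nonnegative integer matrices with given margins.\<close>

section \<open>Orthogonality of Young permutation characters\<close>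

text \<open>For \<open>e\<close> itself, trace zero does not visibly force action zero: the
  Jacobi--Trudi formula presents \<open>chi\<close> only as an integer combination of permutation
  characters, from which no formula for the square of \<open>e\<close> can be read off. The Young
  symmetrizer \<open>c\<close> does have an elementary square, \<open>c c = kappa c\<close>, by von
  Neumann's lemma. The two are linked inside the class functions: with the inner product normalized
  by the group order, the sum \<open>psi\<close> of the conjugates of \<open>c\<close> satisfies
  \<open><psi, psi> = kappa^2\<close> and \<open><psi, chi> = kappa\<close>, while
  \<open><chi, chi> = 1\<close>. Hence \<open>psi - kappa chi\<close> has norm zero, and
  \<open>kappa\<close> is nonzero because \<open>psi\<close> takes the value \<open>K!\<close> at
  the identity. On the character side only pairings with a rectangle are computed. The hook enters
  because a partition lies outside \<open>H(d, l)\<close> exactly when it contains the rectangle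
  with \<open>d + 1\<close> rows and \<open>l + 1\<close> columns.\<close>

lemma card_fibre_comp_permutes:
  assumes "s permutes S"
  shows "card {x\<in>S. f (s x) = i} = card {x\<in>S. f x = i}"
proof -
  have "bij_betw s {x\<in>S. f (s x) = i} {x\<in>S. f x = i}"
    using assms permutes_in_image[OF assms] permutes_inverses[OF assms]
    by (intro bij_betwI[where g = "inv s"]) (auto simp: permutes_in_image[OF permutes_inv[OF assms]])
  then show ?thesis by (rule bij_betw_same_card)
qed

lemma permutes_transports_coloring:
  fixes f g :: "'a \<Rightarrow> 'b"
  assumes fin: "finite S" and fI: "\<And>x. x \<in> S \<Longrightarrow> f x \<in> I" "\<And>x. x \<in> S \<Longrightarrow> g x \<in> I"
    and eq: "\<And>i. i \<in> I \<Longrightarrow> card {x\<in>S. f x = i} = card {x\<in>S. g x = i}"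
  obtains s where "s permutes S" "\<And>x. x \<in> S \<Longrightarrow> f x = g (s x)"
proof -
  have "image_mset f (mset_set S) = image_mset g (mset_set S)"
  proof (rule multiset_eqI)
    fix i
    have *: "count (image_mset h (mset_set S)) i = card {x\<in>S. h x = i}" for h :: "'a \<Rightarrow> 'b"
      using fin by (subst count_image_mset') (simp add: eq_commute flip: sum.inter_filter )
    show "count (image_mset f (mset_set S)) i = count (image_mset g (mset_set S)) i"
    proof (cases "i \<in> I")
      case True then show ?thesis using eq * by simp
    next
      case False
      then have e: "{x\<in>S. f x = i} = {}" "{x\<in>S. g x = i} = {}" using fI by auto
      show ?thesis unfolding * e by (rule refl)
    qed
  qed
  from fin this obtain s where "s permutes S" "\<forall>x\<in>S. f x = g (s x)"
    by (rule image_mset_eq_implies_permutes)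
  then show ?thesis using that[of s] by simp
qed

lemma sum_card_fibres:
  assumes "finite S" "finite I" "\<And>x. x \<in> S \<Longrightarrow> F x \<in> I"
  shows "(\<Sum>i\<in>I. card {x\<in>S. F x = i}) = card S"
  using sum.group[OF assms(1,2), of F "\<lambda>_. 1::nat"] assms(3) by (auto simp: image_subset_iff)

lemma sum_card_refined_fibres:
  fixes g :: "'a \<Rightarrow> nat"
  assumes "finite S" "\<And>x. x \<in> S \<Longrightarrow> g x < m"
  shows "(\<Sum>j<m. card {x\<in>S. f x = i \<and> g x = j}) = card {x\<in>S. f x = i}"
  using sum_card_fibres[of "{x\<in>S. f x = i}" "{..<m}" g] assms by (simp add: conj_assoc)

lemma exists_coloring:
  assumes "finite I" "finite S" "(\<Sum>i\<in>I. A i) = card S"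
  shows "\<exists>F. F \<in> S \<rightarrow>\<^sub>E I \<and> (\<forall>i\<in>I. card {x\<in>S. F x = i} = A i)"
  using assms
proof (induction I arbitrary: S rule: finite_induct)
  case empty
  then show ?case by auto
next
  case (insert a I)
  then have le: "A a \<le> card S" by simp
  obtain B where B: "B \<subseteq> S" "card B = A a" using obtain_subset_with_card_n[OF le] by metis
  have finB: "finite B" using B insert finite_subset by blast
  have "sum A I = card (S - B)"
    using insert B finB by (simp add: card_Diff_subset)
  then obtain F where F: "F \<in> (S - B) \<rightarrow>\<^sub>E I" "\<forall>i\<in>I. card {x\<in>S-B. F x = i} = A i"
    using insert by (metis finite_Diff)
  define G where "G = (\<lambda>x. if x \<in> B then a else F x)"
  have "G \<in> S \<rightarrow>\<^sub>E insert a I" using F B by (auto simp: G_def PiE_iff extensional_def)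
  moreover have "{x\<in>S. G x = a} = B" using B F insert by (auto simp: G_def PiE_iff)
  moreover have "{x\<in>S. G x = i} = {x\<in>S-B. F x = i}" if "i \<in> I" for i
    using that insert by (auto simp: G_def)
  ultimately show ?case using B F by (intro exI[of _ G]) auto
qed

text \<open>Orbit-stabilizer: the colourings with fibre sizes \<open>A\<close> form a single orbit,
  and the permutations that carry a fixed \<open>F0\<close> to \<open>F\<close> form a coset of the
  stabilizer of \<open>F\<close>. Summing over \<open>F\<close> counts every permutation
  once.\<close>

lemma sum_card_stabilizers:
  assumes fin: "finite S" "finite I" and A: "(\<Sum>i\<in>I. A i) = card S"
  shows "(\<Sum>F | F \<in> S \<rightarrow>\<^sub>E I \<and> (\<forall>i\<in>I. card {x\<in>S. F x = i} = A i).
           card {s. s permutes S \<and> (\<forall>x\<in>S. F (s x) = F x)}) = fact (card S)"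
proof -
  define Y where "Y = {F \<in> S \<rightarrow>\<^sub>E I. \<forall>i\<in>I. card {x\<in>S. F x = i} = A i}"
  obtain F0 where F0: "F0 \<in> Y" using exists_coloring[OF fin(2,1) A] by (auto simp: Y_def)
  have finY: "finite Y" unfolding Y_def using fin by (simp add: finite_PiE)
  let ?P = "{s. s permutes S}"
  have maps: "(\<lambda>s. restrict (F0 \<circ> s) S) ` ?P \<subseteq> Y"
  proof safe
    fix s assume s: "s permutes S"
    have "{x\<in>S. restrict (F0 \<circ> s) S x = i} = {x\<in>S. F0 (s x) = i}" for i by auto
    then show "restrict (F0 \<circ> s) S \<in> Y"
      using F0 card_fibre_comp_permutes[OF s, of F0] permutes_in_image[OF s] by (auto simp: Y_def)
  qed
  have fibre: "card {s\<in>?P. restrict (F0 \<circ> s) S = F} = card {s. s permutes S \<and> (\<forall>x\<in>S. F (s x) = F x)}"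
    if F: "F \<in> Y" for F
  proof -
    obtain t where t: "t permutes S" "\<And>x. x \<in> S \<Longrightarrow> F x = F0 (t x)"
      using permutes_transports_coloring[OF fin(1), of F I F0] F F0 unfolding Y_def by (auto simp: PiE_iff)
    have "bij_betw ((\<circ>) t) {s. s permutes S \<and> (\<forall>x\<in>S. F (s x) = F x)} {s\<in>?P. restrict (F0 \<circ> s) S = F}"
    proof (rule bij_betwI[where g = "(\<circ>) (inv t)"])
      show "(\<circ>) t \<in> {s. s permutes S \<and> (\<forall>x\<in>S. F (s x) = F x)} \<rightarrow> {s\<in>?P. restrict (F0 \<circ> s) S = F}"
        using t F permutes_in_image by (fastforce simp: Y_def permutes_compose fun_eq_iff PiE_iff extensional_def)
      show "(\<circ>) (inv t) \<in> {s\<in>?P. restrict (F0 \<circ> s) S = F} \<rightarrow> {s. s permutes S \<and> (\<forall>x\<in>S. F (s x) = F x)}"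
      proof safe
        fix s assume s: "s permutes S" and Feq: "F = restrict (F0 \<circ> s) S"
        show "inv t \<circ> s permutes S" using s t by (simp add: permutes_compose permutes_inv)
        fix x assume x: "x \<in> S"
        have "inv t (s x) \<in> S" using x s t by (simp add: permutes_in_image permutes_inv)
        then have "F (inv t (s x)) = F0 (s x)" using t by (metis permutes_inverses(1))
        then show "restrict (F0 \<circ> s) S ((inv t \<circ> s) x) = restrict (F0 \<circ> s) S x"
          using x by (simp flip: Feq) (simp add: Feq)
      qed
    qed (use permutes_inv_o[OF t(1)] in \<open>auto simp: comp_assoc[symmetric]\<close>)
    then show ?thesis by (rule bij_betw_same_card[symmetric])
  qed
  have "fact (card S) = card ?P" by (simp add: card_permutations[OF refl fin(1)])
  also have "\<dots> = (\<Sum>F\<in>Y. card {s\<in>?P. restrict (F0 \<circ> s) S = F})"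
    using sum_card_fibres[of ?P Y "\<lambda>s. restrict (F0 \<circ> s) S"] fin finY maps
    by (auto simp: finite_permutations image_subset_iff)
  also have "\<dots> = (\<Sum>F\<in>Y. card {s. s permutes S \<and> (\<forall>x\<in>S. F (s x) = F x)})"
    by (rule sum.cong[OF refl fibre])
  finally show ?thesis unfolding Y_def by simp
qed

section \<open>Nonnegative integer matrices with given margins\<close>

definition comps :: "nat \<Rightarrow> int \<Rightarrow> (nat \<Rightarrow> int) set" where
  "comps m a = {c \<in> {0..<m} \<rightarrow>\<^sub>E {0..a}. (\<Sum>i<m. c i) = a}"

text \<open>Counts nonnegative integer matrices with \<open>r\<close> rows, row sums
  \<open>al\<close> and column sums \<open>be\<close> (see \<open>cmat_eq_card\<close>). The last
  row is peeled off as a weak composition of \<open>al r\<close>, because the Pieri rule treats one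
  row at a time. The upper bound on the entries in \<open>comps\<close> is automatic and provides
  finiteness.\<close>

primrec cmat :: "nat \<Rightarrow> (nat \<Rightarrow> int) \<Rightarrow> nat \<Rightarrow> (nat \<Rightarrow> int) \<Rightarrow> int" where
  "cmat 0 al m be = (if \<forall>i<m. be i = 0 then 1 else 0)"
| "cmat (Suc r) al m be = (\<Sum>c\<in>comps m (al r). cmat r al m (\<lambda>i. be i - c i))"

lemma finite_comps [simp]: "finite (comps m a)"
  unfolding comps_def by (simp add: finite_PiE)

definition cmats :: "nat \<Rightarrow> (nat \<Rightarrow> int) \<Rightarrow> nat \<Rightarrow> (nat \<Rightarrow> int) \<Rightarrow> (nat \<Rightarrow> nat \<Rightarrow> int) set" where
  "cmats r al m be = {A \<in> PiE {0..<r} (\<lambda>i. comps m (al i)). \<forall>j<m. (\<Sum>i<r. A i j) = be j}"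

lemma cmat_eq_card: "cmat r al m be = int (card (cmats r al m be))"
proof (induction r arbitrary: be)
  case 0
  have "cmats 0 al m be = (if \<forall>i<m. be i = 0 then {\<lambda>_. undefined} else {})"
    by (auto simp: cmats_def)
  then show ?case by simp
next
  case (Suc r)
  let ?f = "\<lambda>(c, A). A(r := c)"
  have fin: "finite (cmats r al m b)" for b
    unfolding cmats_def by (simp add: finite_PiE)
  have im: "cmats (Suc r) al m be = ?f ` (SIGMA c:comps m (al r). cmats r al m (\<lambda>i. be i - c i))"
  proof (intro equalityI subsetI)
    fix A assume A: "A \<in> cmats (Suc r) al m be"
    let ?B = "restrict A {0..<r}"
    have "A = ?B(r := A r)" using A by (auto simp: cmats_def PiE_iff extensional_def fun_eq_iff)
    moreover have "A r \<in> comps m (al r)" using A by (auto simp: cmats_def PiE_iff)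
    moreover have "?B \<in> cmats r al m (\<lambda>i. be i - A r i)"
      using A by (auto simp: cmats_def PiE_iff algebra_simps)
    ultimately show "A \<in> ?f ` (SIGMA c:comps m (al r). cmats r al m (\<lambda>i. be i - c i))"
      by (intro image_eqI[of _ _ "(A r, ?B)"]) auto
  next
    fix A assume "A \<in> ?f ` (SIGMA c:comps m (al r). cmats r al m (\<lambda>i. be i - c i))"
    then obtain c B where A: "A = B(r := c)" "c \<in> comps m (al r)" "B \<in> cmats r al m (\<lambda>i. be i - c i)" by auto
    then show "A \<in> cmats (Suc r) al m be"
      by (auto simp: cmats_def PiE_iff extensional_def)
  qed
  have inj: "inj_on ?f (SIGMA c:comps m (al r). cmats r al m (\<lambda>i. be i - c i))"
  proof (rule inj_onI, clarify)
    fix c B c' B'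
    assume *: "B \<in> cmats r al m (\<lambda>i. be i - c i)" "B' \<in> cmats r al m (\<lambda>i. be i - c' i)"
      and e: "B(r := c) = B'(r := c')"
    have "B r = undefined" "B' r = undefined" using * by (auto simp: cmats_def PiE_iff extensional_def)
    then show "c = c' \<and> B = B'" using e by (metis fun_upd_eqD fun_upd_triv fun_upd_upd)
  qed
  have "card (cmats (Suc r) al m be) = (\<Sum>c\<in>comps m (al r). card (cmats r al m (\<lambda>i. be i - c i)))"
    unfolding im card_image[OF inj] by (simp add: fin)
  then show ?case by (simp add: Suc)
qed

text \<open>The prescribed sizes are integers: a negative size leaves no colouring at all, which
  absorbs the case distinction of \<open>young_perm_char\<close>.\<close>

definition colorings :: "nat \<Rightarrow> nat \<Rightarrow> (nat \<Rightarrow> int) \<Rightarrow> (nat \<Rightarrow> nat) set" where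
  "colorings k m al = {f \<in> {1..k} \<rightarrow>\<^sub>E {0..<m}. \<forall>i<m. int (card {x\<in>{1..k}. f x = i}) = al i}"

lemma finite_colorings [simp]: "finite (colorings k m al)"
  unfolding colorings_def by (simp add: finite_PiE)

lemma young_perm_char_eq:
  "young_perm_char k m al s = int (card {f \<in> colorings k m al. \<forall>x\<in>{1..k}. f (s x) = f x})"
proof (cases "\<forall>i<m. 0 \<le> al i")
  case True
  then show ?thesis
    unfolding young_perm_char_def colorings_def by (auto intro!: arg_cong[where f = card])
next
  case False
  then have "colorings k m al = {}" unfolding colorings_def by fastforce
  with False show ?thesis by (simp add: young_perm_char_def del: not_all)
qed

lemma young_perm_char_eq_sum:
  "young_perm_char k m al s = (\<Sum>f\<in>colorings k m al. of_bool (\<forall>x\<in>{1..k}. f (s x) = f x))"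
proof -
  have "(\<Sum>f\<in>colorings k m al. of_bool (Q f)) = int (card {f\<in>colorings k m al. Q f})" for Q
    by (simp add: Int_def)
  then show ?thesis unfolding young_perm_char_eq by simp
qed

lemma young_perm_char_neg: "i < m \<Longrightarrow> al i < 0 \<Longrightarrow> young_perm_char k m al s = 0"
  unfolding young_perm_char_def by (rule if_not_P) (meson not_le)

text \<open>Both characters count fixed colourings, so the sum counts pairs of colourings weighted
  by the order of their common stabilizer. Sorting the pairs by the matrix of joint fibre sizes
  yields one orbit for each matrix, and each orbit contributes \<open>k!\<close>.\<close>

lemma sum_young_perm_char_prod:
  assumes sal: "(\<Sum>i<r. al i) = int k"
  shows "(\<Sum>s | s permutes {1..k}. young_perm_char k r al s * young_perm_char k m be s)
     = fact k * cmat r al m be"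
proof -
  let ?S = "{1..k}" and ?P = "{s. s permutes {1..k}}"
  let ?C = "colorings k r al \<times> colorings k m be"
  let ?st = "\<lambda>f s. \<forall>x\<in>{1..k}. (f (s x) :: nat) = f x"
  define mat :: "(nat \<Rightarrow> nat) \<times> (nat \<Rightarrow> nat) \<Rightarrow> nat \<Rightarrow> nat \<Rightarrow> int"
    where "mat = (\<lambda>(f, g). \<lambda>i\<in>{0..<r}. \<lambda>j\<in>{0..<m}. int (card {x\<in>?S. f x = i \<and> g x = j}))"
  have finP: "finite ?P" by (simp add: finite_permutations)
  have matin: "mat fg \<in> cmats r al m be" if "fg \<in> ?C" for fg
  proof -
    obtain f g where fg: "fg = (f, g)" "f \<in> colorings k r al" "g \<in> colorings k m be" using \<open>fg \<in> ?C\<close> by auto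
    have lt: "f x < r" "g x < m" if "x \<in> ?S" for x using fg that by (auto simp: colorings_def PiE_iff)
    have row: "(\<Sum>j<m. card {x\<in>?S. f x = i \<and> g x = j}) = card {x\<in>?S. f x = i}" for i
      by (rule sum_card_refined_fibres) (simp_all add: lt)
    have col: "(\<Sum>i<r. card {x\<in>?S. f x = i \<and> g x = j}) = card {x\<in>?S. g x = j}" for j
      unfolding conj_commute[of "f _ = _"] by (rule sum_card_refined_fibres) (simp_all add: lt)
    have irow: "(\<Sum>j<m. int (card {x\<in>?S. f x = i \<and> g x = j})) = al i" if "i < r" for i
      using row[of i] that fg unfolding colorings_def of_nat_sum[symmetric] by simp
    have icol: "(\<Sum>i<r. int (card {x\<in>?S. f x = i \<and> g x = j})) = be j" if "j < m" for j
      using col[of j] that fg unfolding colorings_def of_nat_sum[symmetric] by simp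
    have le: "int (card {x\<in>?S. f x = i \<and> g x = j}) \<le> al i" if "i < r" "j < m" for i j
    proof -
      have "card {x\<in>?S. f x = i \<and> g x = j} \<le> card {x\<in>?S. f x = i}" by (rule card_mono) auto
      moreover have "int (card {x\<in>?S. f x = i}) = al i" using fg(2) that by (simp add: colorings_def)
      ultimately show ?thesis by linarith
    qed
    show ?thesis using irow icol le by (auto simp: mat_def fg cmats_def comps_def)
  qed
  \<comment> \<open>A pair with joint matrix \<open>A\<close> is one colouring by the index pairs
    \<open>(i, j)\<close> with fibre sizes \<open>A i j\<close>. The entries of \<open>A\<close> add
    up to \<open>k\<close> by \<open>sal\<close>, so the orbit-stabilizer count applies.\<close>
  have orb: "(\<Sum>fg | fg \<in> ?C \<and> mat fg = A. card {s\<in>?P. ?st (fst fg) s \<and> ?st (snd fg) s}) = fact k"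
    if A: "A \<in> cmats r al m be" for A
  proof -
    let ?I = "{0..<r} \<times> {0..<m}"
    define a where "a = (\<lambda>(i, j). nat (A i j))"
    have Anonneg: "A i j \<ge> 0" if "i < r" "j < m" for i j
      using A that by (force simp: cmats_def comps_def PiE_iff)
    have Arow: "(\<Sum>j<m. A i j) = al i" if "i < r" for i
      using A that by (force simp: cmats_def comps_def PiE_iff)
    have Acol: "(\<Sum>i<r. A i j) = be j" if "j < m" for j
      using A that by (force simp: cmats_def)
    have "int (\<Sum>p\<in>?I. a p) = (\<Sum>i<r. \<Sum>j<m. A i j)"
      using Anonneg by (simp add: sum.cartesian_product[symmetric] a_def lessThan_atLeast0)
    also have "\<dots> = int k" using Arow sal by simp
    finally have suma: "(\<Sum>p\<in>?I. a p) = card ?S" by (simp del: of_nat_sum)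
    let ?Y = "{F \<in> ?S \<rightarrow>\<^sub>E ?I. \<forall>p\<in>?I. card {x\<in>?S. F x = p} = a p}"
    let ?split = "\<lambda>F. (restrict (fst \<circ> F) ?S, restrict (snd \<circ> F) ?S)"
    let ?join = "\<lambda>(f, g). restrict (\<lambda>x. (f x, g x)) ?S"
    have "(\<Sum>fg | fg \<in> ?C \<and> mat fg = A. card {s\<in>?P. ?st (fst fg) s \<and> ?st (snd fg) s})
        = (\<Sum>F\<in>?Y. card {s. s permutes ?S \<and> (\<forall>x\<in>?S. F (s x) = F x)})"
    proof (rule sum.reindex_bij_witness[where i = ?split and j = ?join])
      fix fg assume fg': "fg \<in> {fg. fg \<in> ?C \<and> mat fg = A}"
      obtain f g where fg: "fg = (f, g)" by (cases fg)
      have f: "f \<in> ?S \<rightarrow>\<^sub>E {0..<r}" "g \<in> ?S \<rightarrow>\<^sub>E {0..<m}" using fg' fg by (auto simp: colorings_def)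
      have "restrict (fst \<circ> ?join fg) ?S = f" "restrict (snd \<circ> ?join fg) ?S = g"
        using f by (auto simp: fg PiE_iff extensional_def intro!: ext)
      then show "?split (?join fg) = fg" by (simp add: fg)
      have "card {x\<in>?S. ?join fg x = (i, j)} = a (i, j)" if "i < r" "j < m" for i j
      proof -
        have "int (card {x\<in>?S. f x = i \<and> g x = j}) = A i j"
          using fg' that unfolding fg mat_def by auto
        moreover have "{x\<in>?S. ?join fg x = (i, j)} = {x\<in>?S. f x = i \<and> g x = j}" by (auto simp: fg)
        ultimately show ?thesis by (simp add: a_def flip: \<open>int _ = A i j\<close>)
      qed
      then show "?join fg \<in> ?Y" using f by (auto simp: fg PiE_iff)
      have "(\<forall>x\<in>?S. ?join fg (s x) = ?join fg x) \<longleftrightarrow> ?st f s \<and> ?st g s" if "s permutes ?S" for s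
        using permutes_in_image[OF that] by (auto simp: fg)
      then have "{s. s permutes ?S \<and> (\<forall>x\<in>?S. ?join fg (s x) = ?join fg x)}
           = {s\<in>?P. ?st f s \<and> ?st g s}" by blast
      then show "card {s. s permutes ?S \<and> (\<forall>x\<in>?S. ?join fg (s x) = ?join fg x)}
           = card {s\<in>?P. ?st (fst fg) s \<and> ?st (snd fg) s}"
        by (simp only: fg fst_conv snd_conv)
    next
      fix F assume F: "F \<in> ?Y"
      have FI: "F \<in> ?S \<rightarrow>\<^sub>E ?I" using F by (rule CollectE) (erule conjunct1)
      show "?join (?split F) = F" using FI by (auto simp: PiE_iff extensional_def intro!: ext)
      have fib: "card {x\<in>?S. F x = (i, j)} = nat (A i j)" if "i < r" "j < m" for i j
        using F that by (auto simp: a_def)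
      have FiI: "fst (F x) < r" "snd (F x) < m" if "x \<in> ?S" for x using FI that by (auto simp: PiE_iff dest!: bspec)
      have eF: "{x\<in>?S. fst (F x) = i \<and> snd (F x) = j} = {x\<in>?S. F x = (i, j)}" for i j
        by (auto simp: prod_eq_iff)
      have c1: "int (card {x\<in>?S. fst (F x) = i}) = al i" if "i < r" for i
      proof -
        have "card {x\<in>?S. fst (F x) = i} = (\<Sum>j<m. nat (A i j))"
          using sum_card_refined_fibres[of ?S "\<lambda>x. snd (F x)" m "\<lambda>x. fst (F x)" i] FiI fib that
          unfolding eF by simp
        then show ?thesis using Arow[OF that] Anonneg that by simp
      qed
      have c2: "int (card {x\<in>?S. snd (F x) = j}) = be j" if "j < m" for j
      proof -
        have "card {x\<in>?S. snd (F x) = j} = (\<Sum>i<r. nat (A i j))"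
          using sum_card_refined_fibres[of ?S "\<lambda>x. fst (F x)" r "\<lambda>x. snd (F x)" j] FiI fib that
          unfolding conj_commute[of "snd _ = _"] eF by simp
        then show ?thesis using Acol[OF that] Anonneg that by simp
      qed
      have "?split F \<in> ?C" using c1 c2 FiI
        by (auto simp: colorings_def PiE_iff cong: conj_cong)
      moreover have "mat (?split F) = A"
      proof (intro ext)
        fix i j
        show "mat (?split F) i j = A i j"
        proof (cases "i < r")
          case False
          then have "A i = undefined" using A by (auto simp: cmats_def PiE_iff extensional_def)
          then show ?thesis using False by (simp add: mat_def)
        next
          case i: True
          show ?thesis
          proof (cases "j < m")
            case False
            have "A i \<in> comps m (al i)" using A i by (auto simp: cmats_def PiE_iff)
            then have "A i j = undefined" using False by (auto simp: comps_def PiE_iff extensional_def)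
            then show ?thesis using i False by (simp add: mat_def)
          next
            case True
            have "{x\<in>?S. restrict (fst \<circ> F) ?S x = i \<and> restrict (snd \<circ> F) ?S x = j} = {x\<in>?S. F x = (i, j)}"
              by (auto simp: prod_eq_iff)
            then show ?thesis using fib[OF i True] Anonneg[OF i True] i True by (simp add: mat_def)
          qed
        qed
      qed
      ultimately show "?split F \<in> {fg. fg \<in> ?C \<and> mat fg = A}" by simp
    qed
    also have "\<dots> = fact k" using sum_card_stabilizers[of ?S ?I a] suma by simp
    finally show ?thesis .
  qed
  have "(\<Sum>s\<in>?P. young_perm_char k r al s * young_perm_char k m be s)
     = (\<Sum>s\<in>?P. \<Sum>fg\<in>?C. of_bool (?st (fst fg) s \<and> ?st (snd fg) s))"
    unfolding young_perm_char_eq_sum sum_product sum.cartesian_product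
    by (intro sum.cong refl) (auto simp: of_bool_conj)
  also have "\<dots> = (\<Sum>fg\<in>?C. \<Sum>s\<in>?P. of_bool (?st (fst fg) s \<and> ?st (snd fg) s))"
    by (rule sum.swap)
  also have "\<dots> = (\<Sum>fg\<in>?C. int (card {s\<in>?P. ?st (fst fg) s \<and> ?st (snd fg) s}))"
    using finP by (intro sum.cong refl) (simp add: Int_def)
  also have "\<dots> = (\<Sum>A\<in>cmats r al m be. \<Sum>fg | fg \<in> ?C \<and> mat fg = A. int (card {s\<in>?P. ?st (fst fg) s \<and> ?st (snd fg) s}))"
  proof (rule sum.group[symmetric])
    show "finite (cmats r al m be)" unfolding cmats_def by (simp add: finite_PiE)
    show "mat ` ?C \<subseteq> cmats r al m be" using matin by auto
  qed simp
  also have "\<dots> = (\<Sum>A\<in>cmats r al m be. fact k)"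
    using orb by (intro sum.cong refl) (simp flip: of_nat_sum)
  finally show ?thesis by (simp add: cmat_eq_card)
qed

section \<open>Alternating sums of matrix counts and the Pieri rule\<close>

lemma cmat_cong:
  "(\<And>i. i < m \<Longrightarrow> be i = be' i) \<Longrightarrow> cmat r al m be = cmat r al m be'"
proof (induction r arbitrary: be be')
  case (Suc r)
  have "cmat r al m (\<lambda>i. be i - c i) = cmat r al m (\<lambda>i. be' i - c i)" for c
    by (rule Suc.IH) (simp add: Suc.prems)
  then show ?case by simp
qed simp

lemma cmat_neg: "i < m \<Longrightarrow> be i < 0 \<Longrightarrow> cmat r al m be = 0"
proof (induction r arbitrary: be)
  case (Suc r)
  have "cmat r al m (\<lambda>i. be i - c i) = 0" if "c \<in> comps m (al r)" for c
    using that Suc.prems by (intro Suc.IH) (force simp: comps_def PiE_iff)+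
  then show ?case by simp
qed auto

lemma comps_permute:
  assumes "p permutes {0..<m}"
  shows "c \<in> comps m a \<Longrightarrow> restrict (c \<circ> p) {0..<m} \<in> comps m a"
proof -
  assume c: "c \<in> comps m a"
  have "(\<Sum>i<m. restrict (c \<circ> p) {0..<m} i) = (\<Sum>i\<in>{0..<m}. c (p i))"
    by (simp add: lessThan_atLeast0)
  also have "\<dots> = (\<Sum>i\<in>{0..<m}. c i)" using sum.permute[OF assms, of c] by simp
  finally show ?thesis using c permutes_in_image[OF assms]
    by (force simp: comps_def PiE_iff lessThan_atLeast0)
qed

lemma cmat_permute:
  assumes p: "p permutes {0..<m}"
  shows "cmat r al m (be \<circ> p) = cmat r al m be"
proof (induction r arbitrary: be)
  case 0
  have "(\<forall>i<m. be (p i) = 0) \<longleftrightarrow> (\<forall>i<m. be i = 0)"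
    using p by (metis atLeastLessThan_iff bot_nat_0.extremum permutes_in_image permutes_inverses(1))
  then show ?case by simp
next
  case (Suc r)
  let ?q = "inv p"
  have q: "?q permutes {0..<m}" using p by (rule permutes_inv)
  have "cmat (Suc r) al m (be \<circ> p) = (\<Sum>c\<in>comps m (al r). cmat r al m (\<lambda>i. be i - c i))"
    unfolding cmat.simps
  proof (rule sum.reindex_bij_witness[where i = "\<lambda>c. restrict (c \<circ> p) {0..<m}" and j = "\<lambda>c. restrict (c \<circ> ?q) {0..<m}"])
    fix c assume c: "c \<in> comps m (al r)"
    show "restrict (c \<circ> ?q) {0..<m} \<in> comps m (al r)" "restrict (c \<circ> p) {0..<m} \<in> comps m (al r)"
      using comps_permute p q c by auto
    have ext: "c i = undefined" if "\<not> i < m" for i using c that by (auto simp: comps_def PiE_iff extensional_def)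
    have pi: "p i < m \<longleftrightarrow> i < m" "?q i < m \<longleftrightarrow> i < m" for i
      using permutes_in_image[OF p] permutes_in_image[OF q] by auto
    show "restrict (restrict (c \<circ> ?q) {0..<m} \<circ> p) {0..<m} = c"
      "restrict (restrict (c \<circ> p) {0..<m} \<circ> ?q) {0..<m} = c"
      using ext pi permutes_inverses[OF p] by (auto simp: restrict_def fun_eq_iff)
    have "cmat r al m (\<lambda>i. be i - restrict (c \<circ> ?q) {0..<m} i)
       = cmat r al m ((\<lambda>i. be i - restrict (c \<circ> ?q) {0..<m} i) \<circ> p)"
      by (rule Suc[symmetric])
    also have "\<dots> = cmat r al m (\<lambda>i. (be \<circ> p) i - c i)"
      using pi permutes_inverses[OF p] by (intro cmat_cong) auto
    finally show "cmat r al m (\<lambda>i. be i - restrict (c \<circ> ?q) {0..<m} i) = cmat r al m (\<lambda>i. (be \<circ> p) i - c i)" .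
  qed
  then show ?case by simp
qed

text \<open>For \<open>v i = lam i - i\<close> this expands the Jacobi--Trudi determinant with
  entries \<open>h_(v i + j)\<close>. The shift by \<open>i\<close> is kept inside \<open>v\<close>,
  so that a symmetric \<open>H\<close> gives a function antisymmetric in \<open>v\<close>.\<close>

definition altsum :: "nat \<Rightarrow> ((nat \<Rightarrow> int) \<Rightarrow> int) \<Rightarrow> (nat \<Rightarrow> int) \<Rightarrow> int" where
  "altsum m H v = (\<Sum>p | p permutes {0..<m}. sign p * H (\<lambda>i. v i + int (p i)))"

lemma altsum_swap:
  assumes H: "\<And>be p. p permutes {0..<m} \<Longrightarrow> H (be \<circ> p) = H be"
    and ij: "i < m" "j < m" "i \<noteq> j"
  shows "altsum m H (v \<circ> transpose i j) = - altsum m H v"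
proof -
  let ?t = "transpose i j"
  have t: "?t permutes {0..<m}" using ij by (intro permutes_swap_id) auto
  have "altsum m H (v \<circ> ?t) = (\<Sum>p | p permutes {0..<m}. sign (p \<circ> ?t) * H ((\<lambda>i. v i + int (p i)) \<circ> ?t))"
    unfolding altsum_def
  proof (rule sum.reindex_bij_witness[where i = "\<lambda>p. p \<circ> ?t" and j = "\<lambda>p. p \<circ> ?t"])
    fix p assume "p \<in> {p. p permutes {0..<m}}"
    then show "p \<circ> ?t \<in> {p. p permutes {0..<m}}" "p \<circ> ?t \<in> {p. p permutes {0..<m}}"
      using t by (auto intro: permutes_compose)
    have "p \<circ> ?t \<circ> ?t = p" by (simp add: comp_assoc)
    moreover have "(\<lambda>i. v i + int ((p \<circ> ?t) i)) \<circ> ?t = (\<lambda>i. (v \<circ> ?t) i + int (p i))" by (simp add: comp_def)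
    ultimately show "sign (p \<circ> ?t \<circ> ?t) * H ((\<lambda>i. v i + int ((p \<circ> ?t) i)) \<circ> ?t) = sign p * H (\<lambda>i. (v \<circ> ?t) i + int (p i))"
      by simp
  qed (simp_all add: comp_assoc)
  also have "\<dots> = (\<Sum>p | p permutes {0..<m}. - (sign p * H (\<lambda>i. v i + int (p i))))"
  proof (rule sum.cong[OF refl])
    fix p assume "p \<in> {p. p permutes {0..<m}}"
    then have p: "permutation p" using permutation_permutes by blast
    have "sign (p \<circ> ?t) = - sign p"
      using ij p by (simp add: sign_compose permutation_swap_id sign_swap_id)
    then show "sign (p \<circ> ?t) * H ((\<lambda>i. v i + int (p i)) \<circ> ?t) = - (sign p * H (\<lambda>i. v i + int (p i)))"
      using H[OF t] by simp
  qed
  also have "\<dots> = - altsum m H v" by (simp add: altsum_def sum_negf)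
  finally show ?thesis .
qed

text \<open>Under the shift \<open>v i = lam i - i\<close>, a weakly decreasing \<open>lam\<close>
  becomes a strictly decreasing \<open>v\<close>.\<close>

abbreviation strict_dec :: "nat \<Rightarrow> (nat \<Rightarrow> int) \<Rightarrow> bool" where
  "strict_dec m v \<equiv> \<forall>i. Suc i < m \<longrightarrow> v (Suc i) < v i"

lemma strict_dec_mono:
  assumes "strict_dec m v" "i \<le> j" "j < m"
  shows "v j + int j \<le> v i + int i"
  using assms(2,3)
proof (induction j rule: dec_induct)
  case (step n)
  then show ?case using assms(1)[rule_format, of n] by auto
qed simp

text \<open>A sign-reversing involution cancels every \<open>c\<close> for which
  \<open>v - c\<close> fails to interlace with \<open>v\<close>. For a shifted partition the
  surviving \<open>c\<close> are the removals of horizontal strips.\<close>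

lemma pieri:
  fixes G :: "(nat \<Rightarrow> int) \<Rightarrow> int"
  assumes cong: "\<And>v v'. (\<And>i. i < m \<Longrightarrow> v i = v' i) \<Longrightarrow> G v = G v'"
    and swap: "\<And>v i. Suc i < m \<Longrightarrow> G (v \<circ> transpose i (Suc i)) = - G v"
    and dec: "strict_dec m v"
  shows "(\<Sum>c\<in>comps m s. G (\<lambda>i. v i - c i)) =
    (\<Sum>c | c \<in> comps m s \<and> (\<forall>i. Suc i < m \<longrightarrow> v (Suc i) < v i - c i). G (\<lambda>i. v i - c i))"
proof -
  let ?bad = "\<lambda>c i. Suc i < m \<and> v i - c i \<le> v (Suc i)"
  define B where "B = {c \<in> comps m s. \<exists>i. ?bad c i}"
  define L where "L = (\<lambda>c. LEAST i. ?bad c i)"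
  \<comment> \<open>At the first violation \<open>i\<close>, the entries \<open>i\<close> and
    \<open>Suc i\<close> of \<open>v - c\<close> are exchanged, which changes the sign of
    \<open>G\<close>. Whether an index \<open>j\<close> is bad depends on \<open>c j\<close> alone,
    so the exchange keeps the indices below \<open>i\<close> good and \<open>J\<close> is an
    involution. The new entries are nonnegative because \<open>v\<close> decreases and because
    \<open>i\<close> is bad.\<close>
  define J where "J = (\<lambda>c. let i = L c in c(i := v i - v (Suc i) + c (Suc i), Suc i := v (Suc i) - v i + c i))"
  have J: "J c \<in> B \<and> L (J c) = L c \<and> J (J c) = c \<and> G (\<lambda>i. v i - J c i) = - G (\<lambda>i. v i - c i)" if c: "c \<in> B" for c
  proof -
    define i where "i = L c"
    have "\<exists>i. ?bad c i" using c by (simp add: B_def)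
    from LeastI_ex[OF this] have bad: "?bad c i" by (simp add: i_def L_def)
    have least: "\<not> ?bad c j" if "j < i" for j using that unfolding i_def L_def by (rule not_less_Least)
    have Jc: "J c = c(i := v i - v (Suc i) + c (Suc i), Suc i := v (Suc i) - v i + c i)"
      by (simp add: J_def i_def Let_def)
    have cc: "c \<in> {0..<m} \<rightarrow>\<^sub>E {0..s}" and sum: "(\<Sum>j<m. c j) = s" using c by (auto simp: B_def comps_def)
    have nn: "0 \<le> J c j" if "j < m" for j
    proof -
      have "0 \<le> c j" "0 \<le> c (Suc i)" using cc that bad by (auto simp: PiE_iff)
      then show ?thesis using bad dec by (auto simp: Jc)
    qed
    have split: "sum f {..<m} = f i + f (Suc i) + sum f ({..<m} - {i, Suc i})" for f :: "nat \<Rightarrow> int"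
    proof -
      have "sum f {..<m} = sum f ({..<m} - {i, Suc i}) + sum f {i, Suc i}"
        using bad by (intro sum.subset_diff) auto
      then show ?thesis by simp
    qed
    have "(\<Sum>j<m. J c j) = (\<Sum>j<m. c j)"
      unfolding split[of c] split[of "J c"] by (simp add: Jc)
    then have sumJ: "(\<Sum>j<m. J c j) = s" using sum by simp
    have "J c j \<le> s" if "j < m" for j
      using member_le_sum[of j "{..<m}" "J c"] nn that sumJ by auto
    then have Jin: "J c \<in> comps m s"
      using nn cc sumJ bad by (auto simp: comps_def PiE_iff extensional_def Jc)
    have badJ: "?bad (J c) i" using bad cc by (auto simp: Jc PiE_iff)
    have JB: "J c \<in> B" using Jin badJ by (auto simp: B_def)
    have LJ: "L (J c) = i" unfolding L_def
    proof (rule Least_equality)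
      show "?bad (J c) i" by (rule badJ)
    next
      fix j assume j: "?bad (J c) j"
      show "i \<le> j"
      proof (rule ccontr)
        assume "\<not> i \<le> j"
        then show False using least[of j] j by (auto simp: Jc)
      qed
    qed
    have "J (J c) = (J c)(i := v i - v (Suc i) + J c (Suc i), Suc i := v (Suc i) - v i + J c i)"
      using fun_cong[OF J_def, of "J c"] by (simp add: LJ Let_def)
    then have JJ: "J (J c) = c" by (simp add: Jc fun_eq_iff)
    have "G (\<lambda>j. v j - J c j) = G ((\<lambda>j. v j - c j) \<circ> transpose i (Suc i))"
      by (intro cong) (auto simp: Jc transpose_def)
    also have "\<dots> = - G (\<lambda>j. v j - c j)" using swap bad by simp
    finally show ?thesis using JB LJ JJ i_def by simp
  qed
  have "(\<Sum>c\<in>B. G (\<lambda>i. v i - c i)) = (\<Sum>c\<in>B. - G (\<lambda>i. v i - c i))"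
    by (rule sum.reindex_bij_witness[where i = J and j = J]) (use J in auto)
  then have zero: "(\<Sum>c\<in>B. G (\<lambda>i. v i - c i)) = 0" by (simp add: sum_negf)
  have "(\<Sum>c\<in>comps m s. G (\<lambda>i. v i - c i)) = (\<Sum>c\<in>comps m s - B. G (\<lambda>i. v i - c i)) + (\<Sum>c\<in>B. G (\<lambda>i. v i - c i))"
    by (rule sum.subset_diff) (auto simp: B_def)
  also have "comps m s - B = {c. c \<in> comps m s \<and> (\<forall>i. Suc i < m \<longrightarrow> v (Suc i) < v i - c i)}"
    by (auto simp: B_def not_le)
  finally show ?thesis using zero by simp
qed

text \<open>For a shifted partition \<open>v\<close> this is a Kostka number: the pairing of the
  homogeneous product \<open>h_al\<close> with a Jacobi--Trudi determinant, which counts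
  semistandard tableaux of that shape with content \<open>al 0, ..., al (r - 1)\<close>.\<close>

abbreviation Phi :: "nat \<Rightarrow> (nat \<Rightarrow> int) \<Rightarrow> nat \<Rightarrow> (nat \<Rightarrow> int) \<Rightarrow> int" where
  "Phi r al m \<equiv> altsum m (cmat r al m)"

lemma Phi_cong: "(\<And>i. i < m \<Longrightarrow> v i = v' i) \<Longrightarrow> Phi r al m v = Phi r al m v'"
  unfolding altsum_def by (intro sum.cong refl arg_cong2[where f = "(*)"] cmat_cong) auto

lemma Phi_swap: "Suc i < m \<Longrightarrow> Phi r al m (v \<circ> transpose i (Suc i)) = - Phi r al m v"
  by (intro altsum_swap cmat_permute) auto

lemma Phi_Suc: "Phi (Suc r) al m v = (\<Sum>c\<in>comps m (al r). Phi r al m (\<lambda>i. v i - c i))"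
proof -
  have "Phi (Suc r) al m v = (\<Sum>p | p permutes {0..<m}. \<Sum>c\<in>comps m (al r). sign p * cmat r al m (\<lambda>i. (v i - c i) + int (p i)))"
    unfolding altsum_def cmat.simps sum_distrib_left by (intro sum.cong refl) (simp add: algebra_simps)
  then show ?thesis unfolding altsum_def by (subst (asm) sum.swap) simp
qed

text \<open>The horizontal strips of size \<open>s\<close> that can be removed from
  \<open>v\<close>. The last entry is unconstrained and may become negative as a part; such terms
  are dealt with by \<open>Phi_neg\<close>.\<close>

definition interlacing :: "nat \<Rightarrow> (nat \<Rightarrow> int) \<Rightarrow> int \<Rightarrow> (nat \<Rightarrow> int) set" where
  "interlacing m v s = {c. c \<in> comps m s \<and> (\<forall>i. Suc i < m \<longrightarrow> v (Suc i) < v i - c i)}"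

lemma Phi_pieri:
  "strict_dec m v \<Longrightarrow> Phi (Suc r) al m v = (\<Sum>c\<in>interlacing m v (al r). Phi r al m (\<lambda>i. v i - c i))"
  unfolding Phi_Suc interlacing_def by (intro pieri Phi_cong Phi_swap) auto

lemma interlacing_nonneg: "c \<in> interlacing m v s \<Longrightarrow> i < m \<Longrightarrow> 0 \<le> c i"
  by (auto simp: interlacing_def comps_def PiE_iff)

lemma interlacing_strict_dec: "c \<in> interlacing m v s \<Longrightarrow> strict_dec m (\<lambda>i. v i - c i)"
  using interlacing_nonneg[of c m v s] by (force simp: interlacing_def)

section \<open>Vanishing of Kostka numbers and the rectangular case\<close>

lemma altsum_neg:
  assumes H: "\<And>be i. i < m \<Longrightarrow> be i < 0 \<Longrightarrow> H be = 0"
    and i: "i < m" "v i < - int (m - 1)"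
  shows "altsum m H v = 0"
  unfolding altsum_def
proof (rule sum.neutral, rule ballI)
  fix p assume "p \<in> {p. p permutes {0..<m}}"
  then have "p i \<in> {0..<m}" using i permutes_in_image by fastforce
  then have "p i < m" by simp
  then have "v i + int (p i) < 0" using i by linarith
  then show "sign p * H (\<lambda>i. v i + int (p i)) = 0" using H[of i "\<lambda>i. v i + int (p i)"] i by simp
qed

lemma Phi_neg: "i < m \<Longrightarrow> v i < - int (m - 1) \<Longrightarrow> Phi r al m v = 0"
  by (rule altsum_neg[OF cmat_neg])

text \<open>The hypothesis on \<open>v j\<close> says that row \<open>j\<close> is nonempty, so the
  shape has more than \<open>r\<close> rows. Removing a horizontal strip shortens the first column
  by at most one cell, hence \<open>r\<close> letters cannot exhaust it.\<close>

lemma Phi_too_long: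
  assumes "strict_dec m v" "r \<le> j" "j < m" "v j > - int j"
  shows "Phi r al m v = 0"
  using assms
proof (induction r arbitrary: v j)
  case 0
  have "cmat 0 al m (\<lambda>i. v i + int (p i)) = 0" for p
  proof -
    have "v 0 + int (p 0) > 0" using strict_dec_mono[OF 0(1), of 0 j] 0 by auto
    then show ?thesis using 0 by (auto intro!: exI[of _ 0])
  qed
  then show ?case unfolding altsum_def by simp
next
  case (Suc r)
  have "Phi r al m (\<lambda>i. v i - c i) = 0" if c: "c \<in> interlacing m v (al r)" for c
  proof (rule Suc.IH[of _ "j - 1"])
    show "strict_dec m (\<lambda>i. v i - c i)" by (rule interlacing_strict_dec[OF c])
    obtain j' where j': "j = Suc j'" using Suc by (cases j) auto
    have "v j < v j' - c j'" using c j' Suc by (auto simp: interlacing_def)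
    then show "v (j - 1) - c (j - 1) > - int (j - 1)" using j' Suc by simp
  qed (use Suc in auto)
  then show ?case by (simp add: Phi_pieri[OF Suc.prems(1)] del: cmat.simps)
qed

lemma sum_telescope_int: "(\<Sum>i<n. v i - v (Suc i) - 1) = v 0 - v n - int n" for v :: "nat \<Rightarrow> int"
  by (induction n) auto

text \<open>A horizontal strip has at most one cell per column: summing
  \<open>c i \<le> v i - v (Suc i) - 1\<close> telescopes. In the equality case each of these gaps
  is used up, so every row is cut down to the length of the next one.\<close>

lemma interlacing_sum_bound:
  assumes c: "c \<in> interlacing (Suc m) v s"
  shows "s + (v m - c m) + int m \<le> v 0"
    and "s + (v m - c m) + int m = v 0 \<Longrightarrow> i < m \<Longrightarrow> v i - c i = v (Suc i) + 1"
proof -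
  have le: "c i \<le> v i - v (Suc i) - 1" if "i \<in> {..<m}" for i
    using c that by (force simp: interlacing_def)
  have s: "s = (\<Sum>i<m. c i) + c m" using c by (auto simp: interlacing_def comps_def)
  have t: "(\<Sum>i<m. v i - v (Suc i) - 1) = v 0 - v m - int m" by (rule sum_telescope_int)
  show "s + (v m - c m) + int m \<le> v 0"
    using sum_mono[of "{..<m}" c "\<lambda>i. v i - v (Suc i) - 1", OF le] s t by simp
  assume e: "s + (v m - c m) + int m = v 0" and i: "i < m"
  have "(\<Sum>i<m. v i - v (Suc i) - 1 - c i) = 0"
    using s t e by (simp add: sum_subtractf)
  then have "\<forall>i\<in>{..<m}. v i - v (Suc i) - 1 - c i = 0"
    by (subst (asm) sum_nonneg_eq_0_iff) (use le in force)+
  then show "v i - c i = v (Suc i) + 1" using i by (simp add: algebra_simps)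
qed

text \<open>The cells holding one letter form a horizontal strip, so there are at most
  \<open>v 0\<close> of them. A composition of larger sum pushes the last entry below
  \<open>-(m - 1)\<close>, where \<open>Phi\<close> vanishes; removing other strips only shortens
  the first row.\<close>

lemma Phi_too_wide:
  assumes "strict_dec m v" "0 < m" "i < r" "al i > v 0"
  shows "Phi r al m v = 0"
  using assms
proof (induction r arbitrary: v)
  case (Suc r)
  have "Phi r al m (\<lambda>i. v i - c i) = 0" if c: "c \<in> interlacing m v (al r)" for c
  proof (cases "i = r")
    case True
    obtain m' where m': "m = Suc m'" using Suc by (cases m) auto
    have "al r + (v m' - c m') + int m' \<le> v 0" using interlacing_sum_bound(1) c m' by simp
    then show ?thesis using Suc True m' by (intro Phi_neg[of m']) auto
  next
    case False
    then show ?thesis using Suc.prems interlacing_nonneg[OF c, of 0]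
      by (intro Suc.IH interlacing_strict_dec[OF c]) auto
  qed
  then show ?case by (simp add: Phi_pieri[OF Suc.prems(1)] del: cmat.simps)
qed simp

lemma permutes_le_imp_id:
  fixes p :: "nat \<Rightarrow> nat"
  assumes "p permutes {0..<m}" "\<And>i. i < m \<Longrightarrow> p i \<le> i"
  shows "p = id"
proof -
  have "p i = i" for i :: nat
  proof (cases "i < m")
    case True
    then show ?thesis
    proof (induction i rule: less_induct)
      case (less i)
      show ?case
      proof (rule ccontr)
        assume "p i \<noteq> i"
        then have "p i < i" using assms(2)[of i] less by auto
        then have "p (p i) = p i" using less by simp
        then show False using \<open>p i < i\<close> injD[OF permutes_inj[OF assms(1)], of "p i" i] by simp
      qed
    qed
  next
    case False
    then show ?thesis using permutes_not_in[OF assms(1)] by simp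
  qed
  then show ?thesis by auto
qed

text \<open>A rectangle with \<open>r\<close> rows of length \<open>a\<close> has a single
  semistandard filling in which each of \<open>r\<close> letters occurs \<open>a\<close> times: row
  \<open>i\<close> holds letter \<open>i\<close>.\<close>

lemma Phi_rectangle:
  assumes "0 \<le> a" "r \<le> m" "\<And>i. i < r \<Longrightarrow> al i = a"
    "\<And>i. i < m \<Longrightarrow> v i = (if i < r then a else 0) - int i"
  shows "Phi r al m v = 1"
  using assms
proof (induction r arbitrary: v)
  case 0
  have "sign p * cmat 0 al m (\<lambda>i. v i + int (p i)) = (if p = id then 1 else 0)" if p: "p permutes {0..<m}" for p
  proof (cases "p = id")
    case False
    then obtain i where "i < m" "p i > i" using permutes_le_imp_id[OF p] by (meson not_le)
    then show ?thesis using False 0 by auto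
  qed (use 0 in auto)
  then show ?case unfolding altsum_def by (simp add: finite_permutations permutes_id)
next
  case (Suc r)
  obtain m' where m': "m = Suc m'" using Suc by (cases m) auto
  have dec: "strict_dec m v" using Suc.prems by auto
  define w where "w = (\<lambda>i. (if i < r then a else 0) - int i)"
  \<comment> \<open>The strip that removes row \<open>r\<close>, the lowest nonempty row,
    entirely.\<close>
  define c0 where "c0 = (\<lambda>i\<in>{0..<m}. v i - w i)"
  have IH: "Phi r al m w = 1" using Suc.prems by (intro Suc.IH) (auto simp: w_def)
  have c0i: "c0 i = (if i = r then a else 0)" if "i < m" for i
    using that Suc.prems(4)[of i] by (auto simp: c0_def w_def)
  have "(\<Sum>i<m. c0 i) = (\<Sum>i<m. if i = r then a else 0)" by (intro sum.cong refl c0i) auto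
  also have "\<dots> = a" using Suc.prems by simp
  finally have c0: "c0 \<in> interlacing m v (al r)"
    using c0i Suc.prems by (auto simp: interlacing_def comps_def PiE_iff c0_def w_def)
  \<comment> \<open>Nonvanishing of \<open>Phi\<close> bounds the last entry of \<open>v - c\<close>
    from below and the strip bound does so from above. The resulting equality case determines
    \<open>c\<close>.\<close>
  have uniq: "c = c0" if c: "c \<in> interlacing m v (al r)" and nz: "Phi r al m (\<lambda>i. v i - c i) \<noteq> 0" for c
  proof -
    have ge: "v m' - c m' \<ge> - int m'" using nz Phi_neg[of m' m "\<lambda>i. v i - c i" r al] m' by fastforce
    have b: "al r + (v m' - c m') + int m' \<le> v 0" using interlacing_sum_bound(1) c m' by simp
    have v0: "v 0 = a" "al r = a" using Suc.prems by auto
    have lastw: "v m' - c m' = - int m'" using ge b v0 by linarith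
    have oth: "v i - c i = v (Suc i) + 1" if "i < m'" for i
      using interlacing_sum_bound(2)[of c m' v "al r" i] c m' lastw v0 that by simp
    have "v i - c i = w i" if "i < m" for i
    proof (cases "i = m'")
      case True
      then show ?thesis using lastw Suc.prems m' by (simp add: w_def)
    next
      case False
      then show ?thesis using oth[of i] Suc.prems that m' by (simp add: w_def)
    qed
    then have "c i = c0 i" if "i < m" for i using that by (force simp: c0_def)
    moreover have "c i = undefined" "c0 i = undefined" if "\<not> i < m" for i
      using c that by (auto simp: interlacing_def comps_def PiE_iff extensional_def c0_def)
    ultimately show "c = c0" by (metis ext)
  qed
  have "Phi (Suc r) al m v = (\<Sum>c\<in>{c0}. Phi r al m (\<lambda>i. v i - c i))"
    unfolding Phi_pieri[OF dec]
    using c0 uniq by (intro sum.mono_neutral_right) (auto simp: interlacing_def)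
  also have "\<dots> = Phi r al m w" by (simp, rule Phi_cong) (auto simp: c0_def)
  finally show ?case using IH by (simp del: cmat.simps)
qed

section \<open>Orthogonality and branching for Jacobi--Trudi characters\<close>

text \<open>The degree \<open>k\<close> is separate from \<open>v\<close>, and \<open>v\<close> is
  arbitrary, because branching lowers single entries and thereby leaves the shifted
  partitions.\<close>

abbreviation schur :: "nat \<Rightarrow> nat \<Rightarrow> (nat \<Rightarrow> int) \<Rightarrow> (nat \<Rightarrow> nat) \<Rightarrow> int" where
  "schur k m v s \<equiv> altsum m (\<lambda>al. young_perm_char k m al s) v"

lemma irr_char_eq_schur:
  "irr_char lam s = schur (sum_list lam) (length lam) (\<lambda>i. int (lam ! i) - int i) s"
  by (simp add: irr_char_def altsum_def Let_def)

lemma altsum_cong: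
  "(\<And>p. p permutes {0..<m} \<Longrightarrow> H (\<lambda>i. v i + int (p i)) = H' (\<lambda>i. v' i + int (p i))) \<Longrightarrow> altsum m H v = altsum m H' v'"
  unfolding altsum_def by (intro sum.cong refl arg_cong2[where f = "(*)"]) auto

lemma young_perm_char_cong:
  assumes "\<And>i. i < m \<Longrightarrow> al i = al' i"
  shows "young_perm_char k m al s = young_perm_char k m al' s"
proof -
  have "colorings k m al = colorings k m al'" unfolding colorings_def using assms by auto
  then show ?thesis by (simp add: young_perm_char_eq)
qed

lemma young_perm_char_permute:
  assumes p: "p permutes {0..<m}" and s: "s permutes {1..k}"
  shows "young_perm_char k m (al \<circ> p) s = young_perm_char k m al s"
proof -
  have *: "(\<lambda>f. \<lambda>x\<in>{1..k}. q (f x)) \<in> {f \<in> colorings k m (be \<circ> q). \<forall>x\<in>{1..k}. f (s x) = f x}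
       \<rightarrow> {f \<in> colorings k m be. \<forall>x\<in>{1..k}. f (s x) = f x}"
    if q: "q permutes {0..<m}" for q and be :: "nat \<Rightarrow> int"
  proof
    fix f assume f: "f \<in> {f \<in> colorings k m (be \<circ> q). \<forall>x\<in>{1..k}. f (s x) = f x}"
    have qm: "q i < m \<longleftrightarrow> i < m" for i using permutes_in_image[OF q, of i] by simp
    have "int (card {x\<in>{1..k}. q (f x) = i}) = be i" if "i < m" for i
    proof -
      have "inv q i < m" using permutes_in_image[OF permutes_inv[OF q], of i] that by simp
      then have "int (card {x\<in>{1..k}. f x = inv q i}) = be (q (inv q i))" using f by (simp add: colorings_def)
      moreover have "f x = inv q i \<longleftrightarrow> q (f x) = i" for x using permutes_inverses[OF q] by metis
      ultimately show ?thesis using permutes_inverses[OF q] by simp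
    qed
    then have "int (card {x\<in>{1..k}. (\<lambda>x\<in>{1..k}. q (f x)) x = i}) = be i" if "i < m" for i
      using that by (simp cong: conj_cong)
    moreover have "(\<lambda>x\<in>{1..k}. q (f x)) \<in> {1..k} \<rightarrow>\<^sub>E {0..<m}"
      using f qm by (auto simp: colorings_def PiE_iff)
    moreover have "s x \<in> {1..k} \<longleftrightarrow> x \<in> {1..k}" for x using permutes_in_image[OF s] .
    ultimately show "(\<lambda>x\<in>{1..k}. q (f x)) \<in> {f \<in> colorings k m be. \<forall>x\<in>{1..k}. f (s x) = f x}"
      using f by (simp add: colorings_def)
  qed
  let ?q = "inv p"
  have q: "?q permutes {0..<m}" by (rule permutes_inv[OF p])
  have 1: "be \<circ> p \<circ> ?q = be" for be :: "nat \<Rightarrow> int" using permutes_inv_o(1)[OF p] by (simp add: comp_assoc)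
  have "bij_betw (\<lambda>f. \<lambda>x\<in>{1..k}. p (f x)) {f \<in> colorings k m (al \<circ> p). \<forall>x\<in>{1..k}. f (s x) = f x}
       {f \<in> colorings k m al. \<forall>x\<in>{1..k}. f (s x) = f x}"
  proof (rule bij_betwI[where g = "\<lambda>f. \<lambda>x\<in>{1..k}. ?q (f x)"])
    show "(\<lambda>f. \<lambda>x\<in>{1..k}. ?q (f x)) \<in> {f \<in> colorings k m al. \<forall>x\<in>{1..k}. f (s x) = f x}
       \<rightarrow> {f \<in> colorings k m (al \<circ> p). \<forall>x\<in>{1..k}. f (s x) = f x}"
      using *[OF q, of "al \<circ> p"] unfolding 1 .
  qed (use *[OF p, of al] permutes_inverses[OF p] in
      \<open>auto simp: colorings_def PiE_iff extensional_def intro!: ext\<close>)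
  then show ?thesis unfolding young_perm_char_eq by (simp add: bij_betw_same_card)
qed

lemma schur_cong: "(\<And>i. i < m \<Longrightarrow> v i = v' i) \<Longrightarrow> schur k m v s = schur k m v' s"
  by (intro altsum_cong young_perm_char_cong) simp

lemma schur_equal_entries:
  assumes s: "s permutes {1..k}" and i: "Suc i < m" "v i = v (Suc i)"
  shows "schur k m v s = 0"
proof -
  have "v \<circ> transpose i (Suc i) = v" using i by (auto simp: fun_eq_iff transpose_def)
  then have "schur k m v s = - schur k m v s"
    using altsum_swap[of m "\<lambda>al. young_perm_char k m al s" i "Suc i" v] i
      young_perm_char_permute[OF _ s] by simp
  then show ?thesis by simp
qed

lemma schur_neg: "i < m \<Longrightarrow> v i < - int (m - 1) \<Longrightarrow> schur k m v s = 0"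
  by (rule altsum_neg[OF young_perm_char_neg])

lemma sum_permuted_shift:
  assumes "p permutes {0..<m}"
  shows "(\<Sum>i<m. v i + int (p i)) = (\<Sum>i<m. v i + int i)"
proof -
  have "(\<Sum>i<m. int (p i)) = (\<Sum>i<m. int i)"
    using sum.permute[OF assms, of int] by (simp add: lessThan_atLeast0 comp_def)
  then show ?thesis by (simp add: sum.distrib)
qed

lemma sum_young_perm_char_schur:
  assumes "(\<Sum>i<r. al i) = int k"
  shows "(\<Sum>s | s permutes {1..k}. young_perm_char k r al s * schur k m v s) = fact k * Phi r al m v"
proof -
  have "(\<Sum>s | s permutes {1..k}. young_perm_char k r al s * schur k m v s)
    = (\<Sum>p | p permutes {0..<m}. sign p *
        (\<Sum>s | s permutes {1..k}. young_perm_char k r al s * young_perm_char k m (\<lambda>i. v i + int (p i)) s))"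
    unfolding altsum_def sum_distrib_left by (subst sum.swap) (simp add: mult_ac)
  then show ?thesis
    unfolding sum_young_perm_char_prod[OF assms] by (simp add: altsum_def sum_distrib_left mult_ac)
qed

lemma sum_schur_schur:
  assumes "(\<Sum>i<r. u i + int i) = int k"
  shows "(\<Sum>s | s permutes {1..k}. schur k r u s * schur k m v s)
    = fact k * (\<Sum>p | p permutes {0..<r}. sign p * Phi r (\<lambda>i. u i + int (p i)) m v)"
proof -
  have "(\<Sum>s | s permutes {1..k}. schur k r u s * schur k m v s)
    = (\<Sum>p | p permutes {0..<r}. \<Sum>s | s permutes {1..k}. sign p * young_perm_char k r (\<lambda>i. u i + int (p i)) s * schur k m v s)"
    unfolding altsum_def[of r] sum_distrib_right by (rule sum.swap)
  also have "\<dots> = (\<Sum>p | p permutes {0..<r}. sign p *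
        (\<Sum>s | s permutes {1..k}. young_perm_char k r (\<lambda>i. u i + int (p i)) s * schur k m v s))"
    by (simp add: sum_distrib_left mult_ac)
  also have "\<dots> = (\<Sum>p | p permutes {0..<r}. sign p * (fact k * Phi r (\<lambda>i. u i + int (p i)) m v))"
    using sum_permuted_shift assms
    by (intro sum.cong refl arg_cong2[where f = "(*)"] sum_young_perm_char_schur) auto
  finally show ?thesis by (simp add: sum_distrib_left mult_ac)
qed

lemma sum_initial_segment:
  "(\<Sum>i<m. if i < r then c else 0) = int (min r m) * (c::int)"
proof -
  have "{..<m} \<inter> {i. i < r} = {..<min r m}" by auto
  then show ?thesis by (simp add: sum.If_cases)
qed

lemma strict_dec_shift_bound:
  "strict_dec m v \<Longrightarrow> i < m \<Longrightarrow> v (m - 1) + int (m - 1) \<le> v i + int i"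
  by (rule strict_dec_mono) auto

text \<open>A shape of size \<open>r * a\<close> other than the rectangle is too long or too wide
  for it; otherwise it would fit inside the rectangle and fill it for reasons of size. Vectors with
  a negative last part give zero from the start.\<close>

lemma rectangle_orthogonality:
  fixes r a m :: nat
  defines "rect \<equiv> \<lambda>i. int a - int i"
  assumes r: "0 < r" "0 < a" and dec: "strict_dec m v" and sum: "(\<Sum>i<m. v i + int i) = int (r * a)"
  shows "(\<Sum>s | s permutes {1..r * a}. schur (r * a) r rect s * schur (r * a) m v s)
    = (if r \<le> m \<and> (\<forall>i<m. v i + int i = (if i < r then int a else 0)) then fact (r * a) else 0)"
    (is "?S = (if ?shape then _ else _)")
proof -
  let ?k = "r * a"
  have rsum: "(\<Sum>i<r. rect i + int i) = int ?k" by (simp add: rect_def)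
  have m: "0 < m" using sum r by (cases m) auto
  \<comment> \<open>The sum is symmetric and may be expanded on either side. Expanding the
    determinant of the rectangle leaves tableaux of shape \<open>v\<close> with \<open>r\<close>
    letters, which excludes long \<open>v\<close>; expanding that of \<open>v\<close> leaves
    tableaux of rectangular shape, which excludes wide \<open>v\<close>.\<close>
  have S: "?S = fact ?k * (\<Sum>p | p permutes {0..<r}. sign p * Phi r (\<lambda>i. rect i + int (p i)) m v)"
    by (rule sum_schur_schur[OF rsum])
  have S': "?S = fact ?k * (\<Sum>p | p permutes {0..<m}. sign p * Phi m (\<lambda>i. v i + int (p i)) r rect)"
    using sum_schur_schur[OF sum, of r rect] by (simp add: mult.commute)
  have rdec: "strict_dec r rect" by (simp add: rect_def)
  show ?thesis
  proof (cases "?shape")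
    case True
    then have shape: "r \<le> m" "\<And>i. i < m \<Longrightarrow> v i = (if i < r then int a else 0) - int i" by force+
    have "sign p * Phi r (\<lambda>i. rect i + int (p i)) m v = (if p = id then 1 else 0)" if p: "p permutes {0..<r}" for p
    proof (cases "p = id")
      case True
      have "Phi r (\<lambda>i. rect i + int (p i)) m v = 1"
        using shape True by (intro Phi_rectangle[where a = "int a"]) (auto simp: rect_def)
      then show ?thesis using True by simp
    next
      case False
      then obtain i where i: "i < r" "p i > i" using permutes_le_imp_id[OF p] by (meson not_le)
      have "Phi r (\<lambda>i. rect i + int (p i)) m v = 0"
        using i shape r m by (intro Phi_too_wide[OF dec m i(1)]) (simp add: rect_def)
      then show ?thesis using False by simp
    qed
    then have "(\<Sum>p | p permutes {0..<r}. sign p * Phi r (\<lambda>i. rect i + int (p i)) m v) = 1"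
      by (simp add: finite_permutations permutes_id)
    then show ?thesis using S True by simp
  next
    case False
    consider (neg) "v (m - 1) + int (m - 1) < 0" | (long) j where "r \<le> j" "j < m" "v j + int j > 0"
      | (wide) "v 0 > int a" | (inside) "v (m - 1) + int (m - 1) \<ge> 0" "\<forall>j. r \<le> j \<and> j < m \<longrightarrow> v j + int j \<le> 0" "v 0 \<le> int a"
      by (meson not_le)
    then have "?S = 0"
    proof cases
      case neg
      then show ?thesis using schur_neg[of "m - 1" m v] m by simp
    next
      case long
      then have "Phi r al m v = 0" for al by (intro Phi_too_long[OF dec, of r j]) auto
      then show ?thesis using S by simp
    next
      case wide
      have "Phi m (\<lambda>i. v i + int (p i)) r rect = 0" for p
        using wide m by (intro Phi_too_wide[OF rdec r(1), of 0]) (auto simp: rect_def)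
      then show ?thesis using S' by simp
    next
      case inside
      define w where "w = (\<lambda>i. v i + int i)"
      have ge: "w i \<ge> 0" if "i < m" for i using strict_dec_shift_bound[OF dec that] inside by (simp add: w_def)
      have le: "w i \<le> int a" if "i < m" for i using strict_dec_mono[OF dec _ that, of 0] inside by (simp add: w_def)
      have z: "w i = 0" if "r \<le> i" "i < m" for i using ge[of i] that inside by (force simp: w_def)
      have t: "(\<Sum>i<m. if i < r then int a else 0) = int (min r m) * int a"
        by (rule sum_initial_segment)
      have wle: "w i \<le> (if i < r then int a else 0)" if "i \<in> {..<m}" for i using z le that by auto
      have sw: "(\<Sum>i<m. w i) = int r * int a" using sum by (simp add: w_def)
      have "int r * int a \<le> int (min r m) * int a"
        using sum_mono[of "{..<m}" w "\<lambda>i. if i < r then int a else 0", OF wle] t sw by simp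
      then have rm: "r \<le> m" using r by (simp add: min_def split: if_splits)
      then have "(\<Sum>i<m. (if i < r then int a else 0) - w i) = 0"
        using sw t by (simp add: sum_subtractf)
      then have "\<forall>i\<in>{..<m}. (if i < r then int a else 0) - w i = 0"
        by (subst (asm) sum_nonneg_eq_0_iff) (use wle in force)+
      then show ?thesis using False rm by (force simp: w_def)
    qed
    then show ?thesis unfolding if_not_P[OF False] .
  qed
qed

section \<open>Branching and restriction to smaller symmetric groups\<close>

lemma young_perm_char_branch:
  assumes s: "s permutes {1..n}"
  shows "young_perm_char (Suc n) m al s = (\<Sum>i<m. young_perm_char n m (al(i := al i - 1)) s)"
proof -
  let ?X = "\<lambda>n al. {f \<in> colorings n m al. \<forall>x\<in>{1..n}. f (s x) = f x}"
  have sn: "s (Suc n) = Suc n" using permutes_not_in[OF s] by simp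
  have cs: "card {x\<in>{1..Suc n}. f x = j} = card {x\<in>{1..n}. f x = j} + (if f (Suc n) = j then 1 else 0)"
    for f :: "nat \<Rightarrow> nat" and j
  proof (cases "f (Suc n) = j")
    case True
    then have "{x\<in>{1..Suc n}. f x = j} = insert (Suc n) {x\<in>{1..n}. f x = j}" by (auto simp: le_Suc_eq)
    then show ?thesis using True by simp
  next
    case False
    then have "{x\<in>{1..Suc n}. f x = j} = {x\<in>{1..n}. f x = j}" by (auto simp: le_Suc_eq)
    then show ?thesis using False by simp
  qed
  \<comment> \<open>The point \<open>Suc n\<close> is fixed by \<open>s\<close>. Deleting it from a
    colouring where it has colour \<open>i\<close> lowers the size of that fibre by one and leaves
    the invariance of the rest untouched.\<close>
  have *: "card {f\<in>?X (Suc n) al. f (Suc n) = i} = card (?X n (al(i := al i - 1)))" if i: "i < m" for i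
  proof (rule bij_betw_same_card, rule bij_betwI[where g = "\<lambda>f. f(Suc n := i)"])
    show "(\<lambda>f. restrict f {1..n}) \<in> {f\<in>?X (Suc n) al. f (Suc n) = i} \<rightarrow> ?X n (al(i := al i - 1))"
    proof
      fix f assume f: "f \<in> {f\<in>?X (Suc n) al. f (Suc n) = i}"
      have "card {x\<in>{1..n}. restrict f {1..n} x = j} = card {x\<in>{1..n}. f x = j}" for j
        by (rule arg_cong[where f = card]) auto
      moreover have "int (card {x\<in>{1..n}. f x = j}) = (al(i := al i - 1)) j" if "j < m" for j
      proof -
        have "int (card {x\<in>{1..Suc n}. f x = j}) = al j" using f that by (simp add: colorings_def)
        then show ?thesis using cs[of f j] f by (auto split: if_splits)
      qed
      moreover have "restrict f {1..n} \<in> {1..n} \<rightarrow>\<^sub>E {0..<m}"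
        using f by (auto simp: colorings_def PiE_iff)
      moreover have "s x \<in> {1..n} \<longleftrightarrow> x \<in> {1..n}" for x using permutes_in_image[OF s] .
      ultimately show "restrict f {1..n} \<in> ?X n (al(i := al i - 1))"
        using f by (simp add: colorings_def)
    qed
    show "(\<lambda>f. f(Suc n := i)) \<in> ?X n (al(i := al i - 1)) \<rightarrow> {f\<in>?X (Suc n) al. f (Suc n) = i}"
    proof
      fix f assume f: "f \<in> ?X n (al(i := al i - 1))"
      let ?g = "f(Suc n := i)"
      have "card {x\<in>{1..n}. ?g x = j} = card {x\<in>{1..n}. f x = j}" for j
        by (rule arg_cong[where f = card]) auto
      then have "int (card {x\<in>{1..Suc n}. ?g x = j}) = al j" if "j < m" for j
        using f that unfolding cs[of ?g] by (auto simp: colorings_def)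
      moreover have "?g \<in> {1..Suc n} \<rightarrow>\<^sub>E {0..<m}"
        using f i by (auto simp: colorings_def PiE_iff extensional_def)
      moreover have "?g (s x) = ?g x" if x: "x \<in> {1..Suc n}" for x
      proof (cases "x = Suc n")
        case True
        then show ?thesis using sn by simp
      next
        case False
        then have x: "x \<in> {1..n}" using x by auto
        then have "s x \<in> {1..n}" using permutes_in_image[OF s] by blast
        then have "s x \<noteq> Suc n" by auto
        then show ?thesis using f x False by simp
      qed
      ultimately show "?g \<in> {f\<in>?X (Suc n) al. f (Suc n) = i}" by (simp add: colorings_def)
    qed
    show "(restrict f {1..n})(Suc n := i) = f" if "f \<in> {f\<in>?X (Suc n) al. f (Suc n) = i}" for f
      using that by (auto simp: colorings_def PiE_iff extensional_def fun_eq_iff le_Suc_eq)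
    show "restrict (f(Suc n := i)) {1..n} = f" if "f \<in> ?X n (al(i := al i - 1))" for f
      using that by (auto simp: colorings_def PiE_iff extensional_def intro!: ext)
  qed
  have "card (?X (Suc n) al) = (\<Sum>i\<in>{0..<m}. card {f\<in>?X (Suc n) al. f (Suc n) = i})"
    by (rule sum_card_fibres[symmetric], simp, simp) (auto simp: colorings_def PiE_iff)
  also have "\<dots> = (\<Sum>i<m. card (?X n (al(i := al i - 1))))"
    using * by (simp add: lessThan_atLeast0)
  finally show ?thesis unfolding young_perm_char_eq by simp
qed

text \<open>Lowering one entry of \<open>v\<close> removes one box. If the result has two equal
  neighbouring entries, its determinant vanishes by \<open>schur_equal_entries\<close>.\<close>

lemma schur_branch:
  assumes "s permutes {1..n}"
  shows "schur (Suc n) m v s = (\<Sum>i<m. schur n m (v(i := v i - 1)) s)"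
proof -
  have "(\<lambda>j. v j + int (p j))(i := v i + int (p i) - 1) = (\<lambda>j. (v(i := v i - 1)) j + int (p j))" for i p
    by (auto simp: fun_eq_iff)
  then show ?thesis
    unfolding altsum_def young_perm_char_branch[OF assms] sum_distrib_left by (subst sum.swap) simp
qed

text \<open>Up to the factor \<open>(r * a)!\<close>, the multiplicity of the rectangle in the
  restriction of \<open>v\<close> to the symmetric group on \<open>r * a\<close> letters. Branching
  removes boxes one at a time; the multiplicity is positive when the boxes outside the rectangle can
  all be removed. Since branching also produces vectors with a negative last part, only the
  positivity claim asks that this part be nonnegative.\<close>

lemma rectangle_restriction:
  fixes r a m n :: nat
  defines "c \<equiv> \<lambda>n v. \<Sum>s | s permutes {1..r * a}. schur (r * a) r (\<lambda>i. int a - int i) s * schur n m v s"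
  assumes r: "0 < r" "0 < a" and kn: "r * a \<le> n" and dec: "strict_dec m v" and sum: "(\<Sum>i<m. v i + int i) = int n"
  shows "c n v \<ge> 0"
    and "r \<le> m \<and> v (r - 1) + int (r - 1) \<ge> int a \<and> v (m - 1) + int (m - 1) \<ge> 0 \<Longrightarrow> c n v > 0"
    and "\<not> (r \<le> m \<and> v (r - 1) + int (r - 1) \<ge> int a) \<Longrightarrow> c n v = 0"
proof -
  let ?in = "\<lambda>v. r \<le> m \<and> v (r - 1) + int (r - 1) \<ge> int a"
  let ?ok = "\<lambda>v. v (m - 1) + int (m - 1) \<ge> (0::int)"
  have "c n v \<ge> 0 \<and> (?in v \<and> ?ok v \<longrightarrow> c n v > 0) \<and> (\<not> ?in v \<longrightarrow> c n v = 0)"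
    using kn dec sum
  proof (induction n arbitrary: v rule: dec_induct)
    case base
    let ?shape = "r \<le> m \<and> (\<forall>i<m. v i + int i = (if i < r then int a else 0))"
    have c: "c (r * a) v = (if ?shape then fact (r * a) else 0)"
      unfolding c_def by (rule rectangle_orthogonality[OF r base])
    have gen: "0 \<le> x \<and> (P \<and> Q \<longrightarrow> 0 < x) \<and> (\<not> P \<longrightarrow> x = 0)"
      if "x = (if S then fact (r * a) else 0)" "P \<Longrightarrow> Q \<Longrightarrow> S" "S \<Longrightarrow> P" for x :: int and P Q S
      using that by auto
    have 1: "?shape" if inn: "?in v" and ok: "?ok v"
    proof -
      have le: "(if i < r then int a else 0) \<le> v i + int i" if i: "i \<in> {..<m}" for i
      proof (cases "i < r")
        case True
        have "v (r - 1) + int (r - 1) \<le> v i + int i"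
          using True inn by (intro strict_dec_mono[OF base(1)]) auto
        then show ?thesis using inn True by simp
      next
        case False
        then show ?thesis using strict_dec_shift_bound[OF base(1), of i] i ok by simp
      qed
      have t: "(\<Sum>i<m. if i < r then int a else 0) = int (r * a)"
        using inn by (simp add: sum_initial_segment)
      have "(\<Sum>i<m. (v i + int i) - (if i < r then int a else 0)) = 0"
        unfolding sum_subtractf t base(2) by simp
      then have "\<forall>i\<in>{..<m}. (v i + int i) - (if i < r then int a else 0) = 0"
        by (subst (asm) sum_nonneg_eq_0_iff) (use le in force)+
      then show ?thesis using inn by force
    qed
    have 2: "?in v" if sh: "?shape"
    proof -
      have "v (r - 1) + int (r - 1) = (if r - 1 < r then int a else 0)"
        using sh r by (intro sh[THEN conjunct2, rule_format]) linarith
      then show ?thesis using sh r by simp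
    qed
    show ?case by (rule gen[OF c 1 2])
  next
    case (step n)
    have m: "0 < m" using step by (cases m) auto
    have c: "c (Suc n) v = (\<Sum>i<m. c n (v(i := v i - 1)))"
    proof -
      have "schur (Suc n) m v s = (\<Sum>i<m. schur n m (v(i := v i - 1)) s)" if "s permutes {1..r * a}" for s
        using step by (intro schur_branch permutes_subset[OF that]) auto
      then have "c (Suc n) v = (\<Sum>s | s permutes {1..r * a}. \<Sum>i<m. schur (r * a) r (\<lambda>i. int a - int i) s * schur n m (v(i := v i - 1)) s)"
        unfolding c_def by (simp add: sum_distrib_left)
      then show ?thesis unfolding c_def by (subst (asm) sum.swap)
    qed
    have sm: "(\<Sum>j<m. (v(i := v i - 1)) j + int j) = int n" if "i < m" for i
    proof -
      have "(\<Sum>j<m. (v(i := v i - 1)) j + int j) = (\<Sum>j<m. (v j + int j) - (if j = i then 1 else 0))"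
        by (intro sum.cong) auto
      also have "\<dots> = int n" unfolding sum_subtractf using step.prems that by simp
      finally show ?thesis .
    qed
    have nonstrict: "c n (v(i := v i - 1)) = 0" if i: "i < m" and nd: "\<not> strict_dec m (v(i := v i - 1))" for i
    proof -
      obtain j where j: "Suc j < m" "\<not> (v(i := v i - 1)) (Suc j) < (v(i := v i - 1)) j" using nd by blast
      have "v (Suc j) < v j" using step.prems j by blast
      with j have "(v(i := v i - 1)) j = (v(i := v i - 1)) (Suc j)" by (auto split: if_splits)
      then have "schur n m (v(i := v i - 1)) s = 0" if "s permutes {1..r * a}" for s
        using step j by (intro schur_equal_entries[of s n j] permutes_subset[OF that]) auto
      then show ?thesis unfolding c_def by simp
    qed
    have nonneg: "c n (v(i := v i - 1)) \<ge> 0" if "i < m" for i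
      using nonstrict[OF that] step.IH[of "v(i := v i - 1)"] sm[OF that] by fastforce
    have zero: "c n (v(i := v i - 1)) = 0" if "i < m" "\<not> ?in v" for i
    proof (cases "strict_dec m (v(i := v i - 1))")
      case True
      have "\<not> ?in (v(i := v i - 1))" using that by auto
      then show ?thesis using step.IH[OF True sm[OF that(1)]] by blast
    qed (use nonstrict that in blast)
    have pos: "\<exists>i<m. c n (v(i := v i - 1)) > 0" if inn: "?in v" and ok: "?ok v"
    proof -
      \<comment> \<open>Row lengths of the rectangle, padded by zeros. Since \<open>Suc n\<close>
        exceeds \<open>r * a\<close>, some row of \<open>v\<close> is longer than this.\<close>
      define lh where "lh = (\<lambda>i. if i < r then int a else 0)"
      have le: "lh i \<le> v i + int i" if i: "i < m" for i
      proof (cases "i < r")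
        case True
        have "v (r - 1) + int (r - 1) \<le> v i + int i"
          using True inn by (intro strict_dec_mono[OF step.prems(1)]) auto
        then show ?thesis using inn True by (simp add: lh_def)
      next
        case False
        then show ?thesis using strict_dec_shift_bound[OF step.prems(1), of i] i ok by (simp add: lh_def)
      qed
      have t: "(\<Sum>i<m. lh i) = int (r * a)"
        using inn by (simp add: lh_def sum_initial_segment)
      have "\<exists>i<m. lh i < v i + int i"
      proof (rule ccontr)
        assume "\<not> ?thesis"
        then have "v i + int i = lh i" if "i < m" for i using le[OF that] that by force
        then have "(\<Sum>i<m. v i + int i) = int (r * a)" using t by simp
        then have "int (Suc n) = int (r * a)" using step.prems(2) by (simp only:)
        then have "Suc n = r * a" by (simp only: of_nat_eq_iff)
        then show False using step.hyps(1) by linarith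
      qed
      then obtain i0 where i0: "i0 < m" "lh i0 < v i0 + int i0" by blast
      \<comment> \<open>The lowest row that sticks out of the rectangle. The row below it has a
        length at most \<open>lh (Suc i)\<close>, hence at most \<open>lh i\<close>, so one box can
        be removed from row \<open>i\<close> and the shape is kept.\<close>
      define i where "i = (GREATEST i. i < m \<and> lh i < v i + int i)"
      have i: "i < m" "lh i < v i + int i"
        unfolding i_def using GreatestI_nat[of "\<lambda>i. i < m \<and> lh i < v i + int i" i0 m] i0 by auto
      have last: "\<not> lh j < v j + int j" if "i < j" "j < m" for j
        using Greatest_le_nat[of "\<lambda>i. i < m \<and> lh i < v i + int i" j m] that unfolding i_def by fastforce
      let ?w = "v(i := v i - 1)"
      have "strict_dec m ?w"
      proof (intro allI impI)
        fix j assume j: "Suc j < m"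
        have vj: "v (Suc j) < v j" using step.prems j by blast
        show "?w (Suc j) < ?w j"
        proof (cases "j = i")
          case True
          then have "\<not> lh (Suc i) < v (Suc i) + int (Suc i)" using last[of "Suc i"] j by simp
          moreover have "lh (Suc i) \<le> lh i" by (simp add: lh_def)
          ultimately show ?thesis using i True by simp
        qed (use vj in auto)
      qed
      moreover have "?in ?w \<and> ?ok ?w"
        using inn ok i r by (auto simp: lh_def split: if_splits)
      ultimately have "c n ?w > 0" using step.IH[OF _ sm[OF i(1)]] by blast
      then show ?thesis using i by blast
    qed
    have "c (Suc n) v \<ge> 0" unfolding c using nonneg by (intro sum_nonneg) auto
    moreover have "c (Suc n) v > 0" if io: "?in v" "?ok v"
    proof -
      obtain i where "i < m" "c n (v(i := v i - 1)) > 0" using pos[OF io] by blast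
      then show ?thesis unfolding c using nonneg by (intro sum_pos2[of "{..<m}" i]) auto
    qed
    moreover have "c (Suc n) v = 0" if "\<not> ?in v" unfolding c using zero that by simp
    ultimately show ?case by blast
  qed
  then show "c n v \<ge> 0"
    "r \<le> m \<and> v (r - 1) + int (r - 1) \<ge> int a \<and> v (m - 1) + int (m - 1) \<ge> 0 \<Longrightarrow> c n v > 0"
    "\<not> (r \<le> m \<and> v (r - 1) + int (r - 1) \<ge> int a) \<Longrightarrow> c n v = 0" by blast+
qed

lemma irr_char_replicate:
  "irr_char (replicate r a) s = schur (r * a) r (\<lambda>i. int a - int i) s"
  unfolding irr_char_eq_schur by (simp add: sum_list_replicate, rule schur_cong) simp

lemma partition_shifted:
  assumes "is_partition lam n"
  shows "strict_dec (length lam) (\<lambda>i. int (lam ! i) - int i)"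
    and "(\<Sum>i<length lam. (int (lam ! i) - int i) + int i) = int n"
    and "sum_list lam = n"
proof -
  show sl: "sum_list lam = n" using assms by (simp add: is_partition_def)
  have "lam ! Suc i \<le> lam ! i" if "Suc i < length lam" for i
    using assms that by (auto simp: is_partition_def sorted_wrt_iff_nth_less)
  then show "strict_dec (length lam) (\<lambda>i. int (lam ! i) - int i)" by force
  show "(\<Sum>i<length lam. (int (lam ! i) - int i) + int i) = int n"
    using sl by (simp add: sum_list_sum_nth lessThan_atLeast0 flip: of_nat_sum)
qed

text \<open>Being outside the hook means that row \<open>d\<close>, counted from zero, has length at
  least \<open>l + 1\<close>, so the partition contains the rectangle with \<open>r\<close> rows and
  \<open>a\<close> columns. The last part of a partition is nonnegative, which makes the positivity
  clause applicable.\<close>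

lemma irr_char_rectangle_restriction:
  fixes d l n :: nat
  defines "r \<equiv> d + 1" and "a \<equiv> l + 1"
  defines "c \<equiv> \<lambda>lam. \<Sum>s | s permutes {1..r * a}. irr_char (replicate r a) s * irr_char lam s"
  assumes lam: "is_partition lam n"
  shows "r * a \<le> n \<Longrightarrow> 0 \<le> c lam"
    and "r * a \<le> n \<Longrightarrow> \<not> in_hook d l lam \<Longrightarrow> 0 < c lam"
    and "r * a \<le> n \<Longrightarrow> in_hook d l lam \<Longrightarrow> c lam = 0"
    and "\<not> in_hook d l lam \<Longrightarrow> r * a \<le> n"
proof -
  let ?m = "length lam" and ?v = "\<lambda>i. int (lam ! i) - int i"
  have r: "0 < r" "0 < a" by (auto simp: r_def a_def)
  have c: "c lam = (\<Sum>s | s permutes {1..r * a}. schur (r * a) r (\<lambda>i. int a - int i) s * schur n ?m ?v s)"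
    unfolding c_def irr_char_replicate by (simp add: irr_char_eq_schur partition_shifted(3)[OF lam])
  note R = rectangle_restriction[OF r _ partition_shifted(1,2)[OF lam], folded c]
  have last: "?v (?m - 1) + int (?m - 1) \<ge> 0" by simp
  have hook: "\<not> in_hook d l lam \<longleftrightarrow> r \<le> ?m \<and> ?v (r - 1) + int (r - 1) \<ge> int a"
    by (auto simp: in_hook_def r_def a_def)
  show "r * a \<le> n \<Longrightarrow> 0 \<le> c lam" by (rule R(1))
  show "r * a \<le> n \<Longrightarrow> \<not> in_hook d l lam \<Longrightarrow> 0 < c lam" using R(2) last hook by blast
  show "r * a \<le> n \<Longrightarrow> in_hook d l lam \<Longrightarrow> c lam = 0" using R(3) hook by blast
  assume h: "\<not> in_hook d l lam"
  have "a \<le> lam ! i" if "i < r" for i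
  proof -
    have "r - 1 < ?m" using h hook r by linarith
    then have "lam ! (r - 1) \<le> lam ! i"
      using lam that by (cases "i = r - 1") (auto simp: is_partition_def sorted_wrt_iff_nth_less)
    then show ?thesis using h hook by simp
  qed
  then have "(\<Sum>i<r. a) \<le> (\<Sum>i<r. lam ! i)" by (intro sum_mono) auto
  also have "\<dots> \<le> (\<Sum>i<?m. lam ! i)" using h hook by (intro sum_mono2) auto
  also have "\<dots> = n" using partition_shifted(3)[OF lam] by (simp add: sum_list_sum_nth lessThan_atLeast0)
  finally show "r * a \<le> n" by simp
qed

lemma young_perm_char_0: "young_perm_char 0 m al s = (if \<forall>i<m. al i = 0 then 1 else 0)"
proof -
  have "colorings 0 m al = (if \<forall>i<m. al i = 0 then {\<lambda>_. undefined} else {})"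
    by (auto simp: colorings_def)
  then show ?thesis by (simp add: young_perm_char_eq)
qed

text \<open>A nonempty partition contains the rectangle with a single box, and pairing with that
  rectangle over the trivial group on one letter is evaluation at the identity.\<close>

lemma irr_char_id_pos:
  assumes "is_partition lam n"
  shows "0 < irr_char lam id"
proof (cases lam)
  case Nil
  then show ?thesis by (simp add: irr_char_def young_perm_char_0)
next
  case (Cons x xs)
  have p1: "{s. s permutes {1..1::nat}} = {id}" "{s. s permutes {0..<1::nat}} = {id}"
    by (auto simp: permutes_sing)
  have "young_perm_char (Suc 0) 1 al id = (if al 0 = 1 then 1 else 0)" for al
    using young_perm_char_branch[of id 0 1 al] by (simp add: young_perm_char_0)
  then have one: "irr_char [1] id = 1"
    unfolding irr_char_def Let_def using p1(2) by simp
  have "\<not> in_hook 0 0 lam" using assms Cons by (auto simp: in_hook_def is_partition_def)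
  then have "0 < (\<Sum>s | s permutes {1..1}. irr_char (replicate 1 1) s * irr_char lam s)"
    using irr_char_rectangle_restriction(2,4)[OF assms, of 0 0] by simp
  then show ?thesis unfolding p1 using one by simp
qed

section \<open>The Young symmetrizer of a rectangle\<close>

lemma young_perm_char_conj:
  assumes s: "s permutes {1..k}" and t: "t permutes {1..k}"
  shows "young_perm_char k m al (t \<circ> s \<circ> inv t) = young_perm_char k m al s"
proof -
  let ?S = "{1..k}"
  let ?X = "\<lambda>s. {f \<in> colorings k m al. \<forall>x\<in>?S. f (s x) = f x}"
  have *: "(\<lambda>f. restrict (f \<circ> u) ?S) \<in> ?X (u \<circ> s \<circ> inv u) \<rightarrow> ?X s"
    if u: "u permutes ?S" and s: "s permutes ?S" for u s
  proof
    fix f assume f: "f \<in> ?X (u \<circ> s \<circ> inv u)"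
    have uS: "u x \<in> ?S \<longleftrightarrow> x \<in> ?S" "s x \<in> ?S \<longleftrightarrow> x \<in> ?S" for x
      using permutes_in_image[OF u] permutes_in_image[OF s] by blast+
    have "{x\<in>?S. restrict (f \<circ> u) ?S x = i} = {x\<in>?S. f (u x) = i}" for i by auto
    then have "restrict (f \<circ> u) ?S \<in> colorings k m al"
      using f uS card_fibre_comp_permutes[OF u, of f] by (auto simp: colorings_def PiE_iff)
    moreover have "f (u (s x)) = f (u x)" if "x \<in> ?S" for x
    proof -
      have "f ((u \<circ> s \<circ> inv u) (u x)) = f (u x)" using f uS that by blast
      then show ?thesis using permutes_inverses[OF u] by simp
    qed
    ultimately show "restrict (f \<circ> u) ?S \<in> ?X s" using uS by (simp add: restrict_def)
  qed
  have ti: "inv t permutes ?S" "t \<circ> s \<circ> inv t permutes ?S"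
    using s t by (auto intro!: permutes_compose permutes_inv)
  have inv_conj: "inv t \<circ> (t \<circ> s \<circ> inv t) \<circ> inv (inv t) = s"
    using permutes_inverses[OF t] permutes_inv_inv[OF t] by (simp add: fun_eq_iff)
  have "bij_betw (\<lambda>f. restrict (f \<circ> t) ?S) (?X (t \<circ> s \<circ> inv t)) (?X s)"
  proof (rule bij_betwI[where g = "\<lambda>f. restrict (f \<circ> inv t) ?S"])
    show "(\<lambda>f. restrict (f \<circ> inv t) ?S) \<in> ?X s \<rightarrow> ?X (t \<circ> s \<circ> inv t)"
      using *[OF ti] unfolding inv_conj .
    have tS: "t x \<in> ?S \<longleftrightarrow> x \<in> ?S" "inv t x \<in> ?S \<longleftrightarrow> x \<in> ?S" for x
      using permutes_in_image[OF t] permutes_in_image[OF ti(1)] by blast+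
    have "restrict (restrict (f \<circ> t) ?S \<circ> inv t) ?S = f" "restrict (restrict (f \<circ> inv t) ?S \<circ> t) ?S = f"
      if "f \<in> colorings k m al" for f
      using that tS permutes_inverses[OF t]
      by (simp_all add: colorings_def PiE_iff extensional_def restrict_def fun_eq_iff)
    then show "\<And>f. f \<in> ?X (t \<circ> s \<circ> inv t) \<Longrightarrow> restrict (restrict (f \<circ> t) ?S \<circ> inv t) ?S = f"
      "\<And>f. f \<in> ?X s \<Longrightarrow> restrict (restrict (f \<circ> inv t) ?S \<circ> t) ?S = f" by blast+
  qed (rule *[OF t s])
  then show ?thesis unfolding young_perm_char_eq by (simp add: bij_betw_same_card)
qed

lemma irr_char_conj:
  assumes "s permutes {1..sum_list lam}" "t permutes {1..sum_list lam}"
  shows "irr_char lam (t \<circ> s \<circ> inv t) = irr_char lam s"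
  unfolding irr_char_eq_schur by (simp add: young_perm_char_conj[OF assms])

section \<open>Reindexing of sums over permutation groups\<close>

definition permgroup :: "'a set \<Rightarrow> ('a \<Rightarrow> 'a) set \<Rightarrow> bool" where
  "permgroup S H \<longleftrightarrow> H \<subseteq> {s. s permutes S} \<and> id \<in> H \<and> (\<forall>s\<in>H. \<forall>t\<in>H. s \<circ> t \<in> H) \<and> (\<forall>s\<in>H. inv s \<in> H)"

lemma permgroup_all: "permgroup S {s. s permutes S}"
  by (auto simp: permgroup_def permutes_id permutes_compose permutes_inv)

lemma permgroupD:
  assumes "permgroup S H" "s \<in> H"
  shows "s permutes S" "inv s \<in> H" "s \<circ> inv s = id" "inv s \<circ> s = id" "inv (inv s) = s"
proof -
  show s: "s permutes S" and "inv s \<in> H" using assms by (auto simp: permgroup_def)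
  show "s \<circ> inv s = id" "inv s \<circ> s = id" using permutes_inv_o[OF s] by auto
  show "inv (inv s) = s" by (rule permutes_inv_inv[OF s])
qed

lemma permgroup_comp: "permgroup S H \<Longrightarrow> s \<in> H \<Longrightarrow> t \<in> H \<Longrightarrow> s \<circ> t \<in> H"
  by (auto simp: permgroup_def)

lemma sum_permgroup_left:
  assumes "permgroup S H" "t \<in> H"
  shows "(\<Sum>s\<in>H. f (t \<circ> s)) = (\<Sum>s\<in>H. f s)"
  using assms permgroupD[OF assms]
  by (intro sum.reindex_bij_witness[where i = "\<lambda>s. inv t \<circ> s" and j = "\<lambda>s. t \<circ> s"])
    (auto simp: comp_assoc[symmetric] intro: permgroup_comp)

lemma sum_permgroup_right:
  assumes "permgroup S H" "t \<in> H"
  shows "(\<Sum>s\<in>H. f (s \<circ> t)) = (\<Sum>s\<in>H. f s)"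
  using assms permgroupD[OF assms]
  by (intro sum.reindex_bij_witness[where i = "\<lambda>s. s \<circ> inv t" and j = "\<lambda>s. s \<circ> t"])
    (auto simp: comp_assoc intro: permgroup_comp)

lemma sum_permgroup_inv:
  assumes "permgroup S H"
  shows "(\<Sum>s\<in>H. f (inv s)) = (\<Sum>s\<in>H. f s)"
  using permgroupD[OF assms]
  by (intro sum.reindex_bij_witness[where i = inv and j = inv]) auto

lemma sum_permgroup_conj:
  assumes "permgroup S H" "t \<in> H"
  shows "(\<Sum>s\<in>H. f (t \<circ> s \<circ> inv t)) = (\<Sum>s\<in>H. f s)"
proof -
  have "(\<Sum>s\<in>H. f (t \<circ> s \<circ> inv t)) = (\<Sum>s\<in>H. f (s \<circ> inv t))"
    by (rule sum_permgroup_left[OF assms])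
  also have "\<dots> = (\<Sum>s\<in>H. f s)"
    by (rule sum_permgroup_right[OF assms(1) permgroupD(2)[OF assms]])
  finally show ?thesis .
qed

locale rectangle =
  fixes r a :: nat
  assumes pos: "0 < r" "0 < a"
begin

abbreviation "cells \<equiv> {1..r * a}"
text \<open>The cells are numbered from 1 row by row, hence the subtraction. Points outside
  \<open>cells\<close> also receive a row and a column, but the permutations considered fix them, so
  \<open>Row\<close> and \<open>Col\<close> may quantify over all points.\<close>

definition row :: "nat \<Rightarrow> nat" where "row x = (x - 1) div a"
definition col :: "nat \<Rightarrow> nat" where "col x = (x - 1) mod a"

abbreviation "Per \<equiv> {s. s permutes cells}"
definition "Row = {s \<in> Per. \<forall>x. row (s x) = row x}"
definition "Col = {s \<in> Per. \<forall>x. col (s x) = col x}"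

lemma permgroup_Row: "permgroup cells Row" and permgroup_Col: "permgroup cells Col"
  unfolding permgroup_def Row_def Col_def
  by (auto simp: permutes_id permutes_compose permutes_inv) (metis permutes_inverses(1))+

lemma finite_Per [simp]: "finite Per" by (simp add: finite_permutations)
lemma finite_Row [simp]: "finite Row" by (rule finite_subset[OF _ finite_Per]) (auto simp: Row_def)
lemma finite_Col [simp]: "finite Col" by (rule finite_subset[OF _ finite_Per]) (auto simp: Col_def)

lemma card_Per: "card Per = fact (r * a)" using card_permutations[of cells "r * a"] by simp

lemma Row_Per: "p \<in> Row \<Longrightarrow> p \<in> Per" and Col_Per: "q \<in> Col \<Longrightarrow> q \<in> Per"
  by (auto simp: Row_def Col_def)

lemma cell_eqI: "x \<in> cells \<Longrightarrow> y \<in> cells \<Longrightarrow> row x = row y \<Longrightarrow> col x = col y \<Longrightarrow> x = y"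
  unfolding row_def col_def by (metis One_nat_def Suc_pred atLeastAtMost_iff div_mult_mod_eq less_eq_Suc_le)

lemma cell:
  assumes "i < r" "j < a"
  shows "1 + i * a + j \<in> cells" "row (1 + i * a + j) = i" "col (1 + i * a + j) = j"
proof -
  have "i * a + j < r * a"
    using assms mult_le_mono1[of "Suc i" r a] by simp
  then show "1 + i * a + j \<in> cells" by auto
qed (use assms in \<open>auto simp: row_def col_def\<close>)

lemma row_less: "x \<in> cells \<Longrightarrow> row x < r" and col_less: "col x < a"
  using pos by (auto simp: row_def col_def less_mult_imp_div_less)

lemma Row_Int_Col: "s \<in> Row \<Longrightarrow> s \<in> Col \<Longrightarrow> s = id"
proof (rule ext)
  fix x assume s: "s \<in> Row" "s \<in> Col"
  then have "s permutes cells" by (simp add: Row_def)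
  then show "s x = id x"
    using s cell_eqI[of "s x" x] permutes_in_image[of s cells x] permutes_not_in[of s cells x]
    by (cases "x \<in> cells") (auto simp: Row_def Col_def)
qed

lemma Col_sign: "q \<in> Col \<Longrightarrow> q' \<in> Col \<Longrightarrow> sign (q \<circ> q') = sign q * sign q'"
  by (auto simp: Col_def intro!: sign_compose intro: permutes_imp_permutation)

text \<open>Elements of the group algebra are represented by the functionals they induce on
  functions: \<open>ysum f\<close> is the linear extension of \<open>f\<close> evaluated at the
  Young symmetrizer \<open>c = sum sign(q) p q\<close>. The values may lie in any commutative ring,
  so that integer characters and coefficients from the field are covered alike.\<close>

definition ysum :: "((nat \<Rightarrow> nat) \<Rightarrow> 'b) \<Rightarrow> 'b::comm_ring_1" where
  "ysum f = (\<Sum>p\<in>Row. \<Sum>q\<in>Col. of_int (sign q) * f (p \<circ> q))"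

definition ycoeff :: "(nat \<Rightarrow> nat) \<Rightarrow> int" where
  "ycoeff y = ysum (\<lambda>s. of_bool (s = y))"

lemma ysum_cong: "(\<And>s. s \<in> Per \<Longrightarrow> f s = g s) \<Longrightarrow> ysum f = ysum g"
  unfolding ysum_def using Row_Per Col_Per by (intro sum.cong refl arg_cong2[where f = "(*)"]) (auto intro: permutes_compose)

lemma ysum_eq_sum_ycoeff: "ysum f = (\<Sum>s\<in>Per. of_int (ycoeff s) * f s)"
proof -
  have "ysum f = (\<Sum>p\<in>Row. \<Sum>q\<in>Col. \<Sum>s\<in>Per. of_int (sign q * of_bool (p \<circ> q = s)) * f s)"
    unfolding ysum_def
  proof (intro sum.cong refl)
    fix p q assume "p \<in> Row" "q \<in> Col"
    then have "p \<circ> q \<in> Per" using Row_Per Col_Per by (auto intro: permutes_compose)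
    then have "(\<Sum>s\<in>Per. if p \<circ> q = s then of_int (sign q) * f s else 0) = of_int (sign q) * f (p \<circ> q)"
      by (subst sum.delta'[OF finite_Per]) auto
    moreover have "of_int (sign q * of_bool (p \<circ> q = s)) * f s = (if p \<circ> q = s then of_int (sign q) * f s else 0)" for s
      by simp
    ultimately show "of_int (sign q) * f (p \<circ> q) = (\<Sum>s\<in>Per. of_int (sign q * of_bool (p \<circ> q = s)) * f s)"
      by (simp only:)
  qed
  also have "\<dots> = (\<Sum>p\<in>Row. \<Sum>s\<in>Per. \<Sum>q\<in>Col. of_int (sign q * of_bool (p \<circ> q = s)) * f s)"
    by (rule sum.cong[OF refl], rule sum.swap)
  also have "\<dots> = (\<Sum>s\<in>Per. \<Sum>p\<in>Row. \<Sum>q\<in>Col. of_int (sign q * of_bool (p \<circ> q = s)) * f s)"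
    by (rule sum.swap)
  also have "\<dots> = (\<Sum>s\<in>Per. of_int (ycoeff s) * f s)"
    unfolding ycoeff_def ysum_def of_int_sum sum_distrib_right by simp
  finally show ?thesis .
qed

lemma ysum_delta_id: "ysum (\<lambda>s. of_bool (s = id)) = (1 :: int)"
proof -
  have *: "p \<circ> q = id \<longleftrightarrow> p = id \<and> q = id" if "p \<in> Row" "q \<in> Col" for p q
  proof
    assume pq: "p \<circ> q = id"
    have "p = p \<circ> (q \<circ> inv q)" using permgroupD[OF permgroup_Col that(2)] by simp
    also have "\<dots> = inv q" using pq by (simp add: comp_assoc[symmetric])
    finally have "p \<in> Col" using permgroupD[OF permgroup_Col that(2)] by simp
    then have "p = id" using Row_Int_Col that by blast
    then show "p = id \<and> q = id" using pq by simp
  qed simp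
  have "ysum (\<lambda>s. of_bool (s = id)) = (\<Sum>p\<in>Row. \<Sum>q\<in>Col. if p = id \<and> q = id then 1 else (0::int))"
    unfolding ysum_def by (intro sum.cong refl) (auto simp: *)
  also have "\<dots> = (\<Sum>p\<in>Row. if p = id then 1 else 0)"
    using permgroup_Col by (intro sum.cong refl) (auto simp: permgroup_def)
  also have "\<dots> = 1" using permgroup_Row by (auto simp: permgroup_def)
  finally show ?thesis .
qed

lemma ycoeff_id: "ycoeff id = 1" unfolding ycoeff_def by (rule ysum_delta_id)

lemma sum_middle_factorized:
  fixes f :: "(nat \<Rightarrow> nat) \<Rightarrow> 'b::comm_ring_1"
  assumes "p0 \<in> Row" "q0 \<in> Col"
  shows "(\<Sum>p\<in>Row. \<Sum>q\<in>Col. of_int (sign q) * f (p \<circ> (p0 \<circ> q0) \<circ> q)) = of_int (sign q0) * ysum f"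
proof -
  have ss: "sign q0 * sign q0 = (1::int)" by (simp add: sign_def)
  have "(\<Sum>q\<in>Col. of_int (sign q) * f (p \<circ> (p0 \<circ> q0) \<circ> q))
     = of_int (sign q0) * (\<Sum>q\<in>Col. of_int (sign q) * f (p \<circ> p0 \<circ> q))" for p
  proof -
    have "(\<Sum>q\<in>Col. of_int (sign q) * f (p \<circ> (p0 \<circ> q0) \<circ> q))
      = (\<Sum>q\<in>Col. of_int (sign q0 * sign (q0 \<circ> q)) * f (p \<circ> p0 \<circ> (q0 \<circ> q)))"
      using assms ss by (intro sum.cong refl) (simp add: Col_sign comp_assoc mult.assoc[symmetric] del: of_int_mult)
    also have "\<dots> = (\<Sum>q\<in>Col. of_int (sign q0 * sign q) * f (p \<circ> p0 \<circ> q))"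
      by (rule sum_permgroup_left[OF permgroup_Col assms(2)])
    finally show ?thesis by (simp add: sum_distrib_left mult.assoc)
  qed
  then have "(\<Sum>p\<in>Row. \<Sum>q\<in>Col. of_int (sign q) * f (p \<circ> (p0 \<circ> q0) \<circ> q))
    = (\<Sum>p\<in>Row. of_int (sign q0) * (\<Sum>q\<in>Col. of_int (sign q) * f (p \<circ> p0 \<circ> q)))" by simp
  also have "\<dots> = (\<Sum>p\<in>Row. of_int (sign q0) * (\<Sum>q\<in>Col. of_int (sign q) * f (p \<circ> q)))"
    by (rule sum_permgroup_right[OF permgroup_Row assms(1)])
  finally show ?thesis by (simp add: ysum_def sum_distrib_left)
qed

lemma transpose_in:
  assumes "i \<in> cells" "j \<in> cells"
  shows "row i = row j \<Longrightarrow> transpose i j \<in> Row" "col i = col j \<Longrightarrow> transpose i j \<in> Col"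
  using assms permutes_swap_id[of i cells j] by (auto simp: Row_def Col_def transpose_def)

lemma sum_sign_transpose_zero:
  fixes f :: "(nat \<Rightarrow> nat) \<Rightarrow> 'b::{idom, ring_char_0}"
  assumes ij: "i \<in> cells" "j \<in> cells" "i \<noteq> j" "col i = col j"
    and f: "\<And>q. q \<in> Col \<Longrightarrow> f (transpose i j \<circ> q) = f q"
  shows "(\<Sum>q\<in>Col. of_int (sign q) * f q) = 0"
proof -
  let ?t = "transpose i j"
  have t: "?t \<in> Col" using transpose_in(2) ij by blast
  have "(\<Sum>q\<in>Col. of_int (sign q) * f q) = (\<Sum>q\<in>Col. of_int (sign (?t \<circ> q)) * f (?t \<circ> q))"
    by (rule sum_permgroup_left[OF permgroup_Col t, symmetric])
  also have "\<dots> = (\<Sum>q\<in>Col. - (of_int (sign q) * f q))"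
    using f ij t by (intro sum.cong refl) (simp add: Col_sign sign_swap_id)
  finally have "(\<Sum>q\<in>Col. of_int (sign q) * f q) = - (\<Sum>q\<in>Col. of_int (sign q) * f q)"
    by (simp add: sum_negf)
  then have "2 * (\<Sum>q\<in>Col. of_int (sign q) * f q) = 0"
    by (metis add.right_inverse mult_2)
  then show ?thesis by simp
qed

text \<open>The combinatorial core of von Neumann's lemma, by contraposition: if no two cells of one
  row are sent by \<open>inv y\<close> into one column, then \<open>y\<close> is a row permutation
  followed on the right by a column permutation.\<close>

lemma exists_common_transposition:
  assumes y: "y \<in> Per" and no: "\<not> (\<exists>p\<in>Row. \<exists>q\<in>Col. y = p \<circ> q)"
  shows "\<exists>i\<in>cells. \<exists>j\<in>cells. i \<noteq> j \<and> row i = row j \<and> col (inv y i) = col (inv y j)"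
proof (rule ccontr)
  assume "\<not> ?thesis"
  then have inj: "i = j" if "i \<in> cells" "j \<in> cells" "row i = row j" "col (inv y i) = col (inv y j)" for i j
    using that by blast
  let ?z = "inv y"
  have yp: "y permutes cells" and z: "?z permutes cells" using y by (auto intro: permutes_inv)
  \<comment> \<open>Moves each cell within its own row to the column of its image under
    \<open>inv y\<close>. It is injective by the assumption, and what remains of
    \<open>inv y\<close> after undoing \<open>u\<close> preserves columns.\<close>
  define u where "u = (\<lambda>i. if i \<in> cells then 1 + row i * a + col (?z i) else i)"
  have ui: "u i \<in> cells" "row (u i) = row i" "col (u i) = col (?z i)" if "i \<in> cells" for i
    using cell[OF row_less[OF that] col_less, of "?z i"] that by (auto simp: u_def)
  have "inj_on u cells"
  proof (rule inj_onI)
    fix i j assume "i \<in> cells" "j \<in> cells" "u i = u j"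
    then show "i = j" using inj[of i j] ui[of i] ui[of j] by metis
  qed
  moreover from this have "u ` cells = cells" using ui(1) by (intro endo_inj_surj) blast+
  ultimately have "bij_betw u cells cells" by (simp add: bij_betw_def)
  moreover have uo: "u x = x" if "x \<notin> cells" for x using that unfolding u_def by (rule if_not_P)
  ultimately have up: "u permutes cells" by (rule bij_imp_permutes)
  have "row (u x) = row x" for x using ui(2)[of x] uo[of x] by (cases "x \<in> cells") simp_all
  then have uR: "u \<in> Row" using up by (simp add: Row_def)
  let ?w = "?z \<circ> inv u"
  have iu: "inv u permutes cells" by (rule permutes_inv[OF up])
  have "col (?w x) = col x" for x
  proof (cases "x \<in> cells")
    case True
    then have "inv u x \<in> cells" using permutes_in_image[OF iu] by blast
    then show ?thesis using ui(3)[of "inv u x"] permutes_inverses[OF up] by simp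
  next
    case False
    then show ?thesis using permutes_not_in[OF iu False] permutes_not_in[OF z False] by simp
  qed
  then have wC: "?w \<in> Col" using permutes_compose[OF iu z] by (simp add: Col_def)
  have "inv ?w = u \<circ> y"
    using permutes_inv_inv[OF yp] permutes_inv_inv[OF up] permutes_bij[OF z] permutes_bij[OF iu]
    by (simp add: o_inv_distrib)
  then have "y = inv u \<circ> inv ?w" using permutes_inv_o[OF up] by (simp add: comp_assoc[symmetric])
  then show False using no permgroupD(2)[OF permgroup_Row uR] permgroupD(2)[OF permgroup_Col wC] by blast
qed

text \<open>A row transposition passes through \<open>y\<close> as a column transposition. Inserting
  it flips the sign of each term while the sum over \<open>Row\<close> absorbs it, so the sum is its
  own negative.\<close>

lemma sum_middle_not_factorized:
  fixes f :: "(nat \<Rightarrow> nat) \<Rightarrow> 'b::{idom, ring_char_0}"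
  assumes y: "y \<in> Per" and no: "\<not> (\<exists>p\<in>Row. \<exists>q\<in>Col. y = p \<circ> q)"
  shows "(\<Sum>p\<in>Row. \<Sum>q\<in>Col. of_int (sign q) * f (p \<circ> y \<circ> q)) = 0"
proof -
  obtain i j where ij: "i \<in> cells" "j \<in> cells" "i \<noteq> j" "row i = row j" "col (inv y i) = col (inv y j)"
    using exists_common_transposition[OF assms] by blast
  have yp: "y permutes cells" using y by simp
  let ?i = "inv y i" and ?j = "inv y j"
  have ij': "?i \<in> cells" "?j \<in> cells"
    using permutes_in_image[OF permutes_inv[OF yp]] ij(1,2) by blast+
  have ne: "?i \<noteq> ?j" using ij(3) by (metis permutes_inverses(1)[OF yp])
  have comm: "transpose i j \<circ> y = y \<circ> transpose ?i ?j"
  proof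
    fix x
    have "y x = i \<longleftrightarrow> x = ?i" "y x = j \<longleftrightarrow> x = ?j" by (metis permutes_inverses[OF yp])+
    then show "(transpose i j \<circ> y) x = (y \<circ> transpose ?i ?j) x"
      using permutes_inverses(1)[OF yp] by (simp add: transpose_def)
  qed
  have "(\<Sum>q\<in>Col. of_int (sign q) * (\<Sum>p\<in>Row. f (p \<circ> y \<circ> q))) = 0"
  proof (rule sum_sign_transpose_zero[OF ij' ne ij(5)])
    fix q
    have "(\<Sum>p\<in>Row. f (p \<circ> y \<circ> (transpose ?i ?j \<circ> q))) = (\<Sum>p\<in>Row. f ((p \<circ> transpose i j) \<circ> y \<circ> q))"
      by (intro sum.cong refl arg_cong[where f = f]) (metis comm comp_assoc)
    also have "\<dots> = (\<Sum>p\<in>Row. f (p \<circ> y \<circ> q))"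
      by (rule sum_permgroup_right[OF permgroup_Row transpose_in(1)[OF ij(1,2,4)]])
    finally show "(\<Sum>p\<in>Row. f (p \<circ> y \<circ> (transpose ?i ?j \<circ> q))) = (\<Sum>p\<in>Row. f (p \<circ> y \<circ> q))" .
  qed
  then show ?thesis by (subst sum.swap) (simp add: sum_distrib_left)
qed

text \<open>Reindexing both factors by inverses turns a coefficient of the symmetrizer into a
  sandwich around \<open>y\<close>. In this form the delta function at the identity determines the
  scalar in \<open>sum_middle\<close>.\<close>

lemma ycoeff_middle:
  assumes y: "y \<in> Per"
  shows "ycoeff y = (\<Sum>p\<in>Row. \<Sum>q\<in>Col. sign q * of_bool (p \<circ> y \<circ> q = id))"
proof -
  have yp: "y permutes cells" using y by simp
  have eq: "inv p \<circ> inv q = y \<longleftrightarrow> p \<circ> y \<circ> q = id" if "p \<in> Row" "q \<in> Col" for p q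
  proof -
    note p = permgroupD[OF permgroup_Row that(1)] and q = permgroupD[OF permgroup_Col that(2)]
    show ?thesis
    proof
      assume "inv p \<circ> inv q = y"
      then have "p \<circ> y \<circ> q = (p \<circ> inv p) \<circ> (inv q \<circ> q)" by (metis comp_assoc)
      then show "p \<circ> y \<circ> q = id" using p q by simp
    next
      assume "p \<circ> y \<circ> q = id"
      then have "inv p \<circ> (p \<circ> y \<circ> q) \<circ> inv q = inv p \<circ> inv q" by simp
      then have "(inv p \<circ> p) \<circ> y \<circ> (q \<circ> inv q) = inv p \<circ> inv q" by (simp only: comp_assoc)
      then show "inv p \<circ> inv q = y" using p q by simp
    qed
  qed
  have "ycoeff y = (\<Sum>p\<in>Row. \<Sum>q\<in>Col. sign (inv q) * of_bool (p \<circ> inv q = y))"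
    unfolding ycoeff_def ysum_def of_int_eq_id id_apply
    by (rule sum.cong[OF refl], rule sum_permgroup_inv[OF permgroup_Col, symmetric])
  also have "\<dots> = (\<Sum>p\<in>Row. \<Sum>q\<in>Col. sign (inv q) * of_bool (inv p \<circ> inv q = y))"
    by (rule sum_permgroup_inv[OF permgroup_Row, symmetric])
  also have "\<dots> = (\<Sum>p\<in>Row. \<Sum>q\<in>Col. sign q * of_bool (p \<circ> y \<circ> q = id))"
    using eq permgroupD(1)[OF permgroup_Col]
    by (intro sum.cong refl) (simp add: sign_inverse permutes_imp_permutation[of cells])
  finally show ?thesis .
qed

text \<open>Von Neumann's lemma on Young symmetrizers.\<close>
lemma sum_middle:
  fixes f :: "(nat \<Rightarrow> nat) \<Rightarrow> 'b::{idom, ring_char_0}"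
  assumes y: "y \<in> Per"
  shows "(\<Sum>p\<in>Row. \<Sum>q\<in>Col. of_int (sign q) * f (p \<circ> y \<circ> q)) = of_int (ycoeff y) * ysum f"
proof (cases "\<exists>p\<in>Row. \<exists>q\<in>Col. y = p \<circ> q")
  case True
  then obtain p0 q0 where pq: "p0 \<in> Row" "q0 \<in> Col" "y = p0 \<circ> q0" by blast
  have "ycoeff y = sign q0"
    using sum_middle_factorized[OF pq(1,2), of "\<lambda>s. of_bool (s = id) :: int"] ycoeff_middle[OF y]
    by (simp add: ysum_delta_id pq(3))
  then show ?thesis using sum_middle_factorized[OF pq(1,2), of f] pq(3) by simp
next
  case False
  have "ycoeff y = 0"
    using sum_middle_not_factorized[OF y False, of "\<lambda>s. of_bool (s = id) :: int"] ycoeff_middle[OF y] by simp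
  then show ?thesis using sum_middle_not_factorized[OF y False, of f] by simp
qed

text \<open>In the product \<open>c c\<close>, with terms \<open>p (q p') q'\<close>, the inner
  factor \<open>q p'\<close> contributes the scalar \<open>ycoeff (q p')\<close> by von Neumann's
  lemma. The signed sum of these scalars is the factor in \<open>c c = kappa c\<close>.\<close>

definition kappa :: int where "kappa = (\<Sum>q\<in>Col. \<Sum>p\<in>Row. sign q * ycoeff (q \<circ> p))"

lemma ysum_ysum:
  fixes f :: "(nat \<Rightarrow> nat) \<Rightarrow> 'b::{idom, ring_char_0}"
  shows "ysum (\<lambda>s. ysum (\<lambda>t. f (s \<circ> t))) = of_int kappa * ysum f"
proof -
  let ?T = "\<lambda>p p' q q'. of_int (sign q) * (of_int (sign q') * f (p \<circ> (q \<circ> p') \<circ> q'))"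
  have "ysum (\<lambda>s. ysum (\<lambda>t. f (s \<circ> t)))
    = (\<Sum>p\<in>Row. \<Sum>q\<in>Col. \<Sum>p'\<in>Row. \<Sum>q'\<in>Col. ?T p p' q q')"
    unfolding ysum_def by (simp add: sum_distrib_left comp_assoc)
  also have "\<dots> = (\<Sum>q\<in>Col. \<Sum>p\<in>Row. \<Sum>p'\<in>Row. \<Sum>q'\<in>Col. ?T p p' q q')"
    by (rule sum.swap)
  also have "\<dots> = (\<Sum>q\<in>Col. \<Sum>p'\<in>Row. \<Sum>p\<in>Row. \<Sum>q'\<in>Col. ?T p p' q q')"
    by (rule sum.cong[OF refl], rule sum.swap)
  also have "\<dots> = (\<Sum>q\<in>Col. \<Sum>p'\<in>Row. of_int (sign q) * (of_int (ycoeff (q \<circ> p')) * ysum f))"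
    using Row_Per Col_Per
    by (intro sum.cong refl, subst sum_middle[symmetric]) (auto simp: sum_distrib_left intro: permutes_compose)
  also have "\<dots> = of_int kappa * ysum f"
    by (simp add: kappa_def sum_distrib_right mult.assoc)
  finally show ?thesis .
qed

section \<open>The sum of the conjugates of the symmetrizer\<close>

lemma ysum_sum:
  "ysum (\<lambda>t. \<Sum>i\<in>I. c i * f i t) = (\<Sum>i\<in>I. c i * ysum (f i))"
  unfolding ysum_eq_sum_ycoeff sum_distrib_left
  by (subst sum.swap) (simp add: mult_ac)

lemma ysum_scale: "ysum (\<lambda>t. c * f t) = c * ysum f"
  unfolding ysum_eq_sum_ycoeff by (simp add: sum_distrib_left mult_ac)

lemma ysum_swap: "ysum (\<lambda>s. ysum (\<lambda>t. f s t)) = ysum (\<lambda>t. ysum (\<lambda>s. f s t))"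
  unfolding ysum_eq_sum_ycoeff sum_distrib_left
  by (subst sum.swap) (simp add: mult_ac)

lemma ysum_ysum_id: "ysum (\<lambda>s. ysum (\<lambda>t. of_bool (s \<circ> t = id))) = kappa"
  using ysum_ysum[of "\<lambda>s. of_bool (s = id) :: int"] by (simp add: ysum_delta_id)

text \<open>Coefficient of \<open>s\<close> in the sum over all \<open>g\<close> of
  \<open>inv g c g\<close>, a class function that is to be compared with the character of the
  rectangle.\<close>

definition psi :: "(nat \<Rightarrow> nat) \<Rightarrow> int" where
  "psi s = (\<Sum>g\<in>Per. ycoeff (g \<circ> s \<circ> inv g))"

lemma sum_psi:
  fixes f :: "(nat \<Rightarrow> nat) \<Rightarrow> 'b::{idom, ring_char_0}"
  assumes f: "\<And>s g. s \<in> Per \<Longrightarrow> g \<in> Per \<Longrightarrow> f (g \<circ> s \<circ> inv g) = f s"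
  shows "(\<Sum>s\<in>Per. of_int (psi s) * f s) = fact (r * a) * ysum f"
proof -
  have "(\<Sum>s\<in>Per. of_int (psi s) * f s) = (\<Sum>g\<in>Per. \<Sum>s\<in>Per. of_int (ycoeff (g \<circ> s \<circ> inv g)) * f s)"
    unfolding psi_def of_int_sum sum_distrib_right by (rule sum.swap)
  also have "\<dots> = (\<Sum>g\<in>Per. \<Sum>s\<in>Per. of_int (ycoeff (g \<circ> s \<circ> inv g)) * f (g \<circ> s \<circ> inv g))"
    using f by (intro sum.cong refl) simp
  also have "\<dots> = (\<Sum>g\<in>Per. ysum f)"
    unfolding ysum_eq_sum_ycoeff by (rule sum.cong[OF refl], rule sum_permgroup_conj[OF permgroup_all])
  also have "\<dots> = fact (r * a) * ysum f"
    using card_Per by simp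
  finally show ?thesis .
qed

lemma psi_conj:
  assumes "s \<in> Per" "h \<in> Per"
  shows "psi (h \<circ> s \<circ> inv h) = psi s"
proof -
  have "psi (h \<circ> s \<circ> inv h) = (\<Sum>g\<in>Per. ycoeff ((g \<circ> h) \<circ> s \<circ> inv (g \<circ> h)))"
    unfolding psi_def
  proof (intro sum.cong refl)
    fix g assume "g \<in> Per"
    then have "inv (g \<circ> h) = inv h \<circ> inv g" using assms by (auto intro!: o_inv_distrib dest: permutes_bij)
    then show "ycoeff (g \<circ> (h \<circ> s \<circ> inv h) \<circ> inv g) = ycoeff ((g \<circ> h) \<circ> s \<circ> inv (g \<circ> h))"
      by (simp add: comp_assoc)
  qed
  also have "\<dots> = psi s"
    unfolding psi_def by (rule sum_permgroup_right[OF permgroup_all assms(2)])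
  finally show ?thesis .
qed

lemma psi_id: "psi id = fact (r * a)"
proof -
  have "ycoeff (g \<circ> id \<circ> inv g) = 1" if "g \<in> Per" for g
    using permgroupD(3)[OF permgroup_all that] ycoeff_id by simp
  then have "psi id = (\<Sum>g\<in>Per. 1)" unfolding psi_def by (rule sum.cong[OF refl])
  then show ?thesis by (simp only: sum_constant card_Per) simp
qed

text \<open>The right side is the coefficient of the identity in \<open>c t c\<close>. On the left,
  \<open>ycoeff_middle\<close> produces products \<open>p' (q t p) q'\<close>, which regroup as
  \<open>(p' q) t (p q')\<close>.\<close>

lemma sum_ycoeff_sandwich:
  assumes t: "t \<in> Per"
  shows "(\<Sum>q\<in>Col. \<Sum>p\<in>Row. sign q * ycoeff (q \<circ> t \<circ> p)) = ysum (\<lambda>s. ysum (\<lambda>u. of_bool (s \<circ> t \<circ> u = id)))"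
proof -
  let ?T = "\<lambda>p p' q q'. sign q * (sign q' * of_bool ((p' \<circ> q) \<circ> t \<circ> (p \<circ> q') = id))"
  have "(\<Sum>q\<in>Col. \<Sum>p\<in>Row. sign q * ycoeff (q \<circ> t \<circ> p))
    = (\<Sum>q\<in>Col. \<Sum>p\<in>Row. \<Sum>p'\<in>Row. \<Sum>q'\<in>Col. ?T p p' q q')"
  proof (intro sum.cong refl)
    fix p q assume "q \<in> Col" "p \<in> Row"
    then have "q \<circ> t \<circ> p \<in> Per" using t Row_Per Col_Per by (auto intro!: permutes_compose)
    then show "sign q * ycoeff (q \<circ> t \<circ> p)
      = (\<Sum>p'\<in>Row. \<Sum>q'\<in>Col. ?T p p' q q')"
      by (simp only: ycoeff_middle sum_distrib_left comp_assoc)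
  qed
  also have "\<dots> = (\<Sum>q\<in>Col. \<Sum>p'\<in>Row. \<Sum>p\<in>Row. \<Sum>q'\<in>Col. ?T p p' q q')"
    by (rule sum.cong[OF refl], rule sum.swap)
  also have "\<dots> = (\<Sum>p'\<in>Row. \<Sum>q\<in>Col. \<Sum>p\<in>Row. \<Sum>q'\<in>Col. ?T p p' q q')"
    by (rule sum.swap)
  also have "\<dots> = ysum (\<lambda>s. ysum (\<lambda>u. of_bool (s \<circ> t \<circ> u = id)))"
    by (simp only: ysum_def sum_distrib_left of_int_eq_id id_apply)
  finally show ?thesis .
qed

text \<open>The sum reduces to the coefficient of the identity in \<open>c c c\<close>, which is
  \<open>kappa^2\<close> because that coefficient in \<open>c\<close> is 1.\<close>

lemma ysum_psi: "ysum psi = kappa * kappa"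
proof -
  let ?F = "\<lambda>g. \<Sum>q\<in>Col. \<Sum>p\<in>Row. sign q * ycoeff (q \<circ> g \<circ> p)"
  \<comment> \<open>Moving \<open>inv g\<close> and the column factor \<open>q\<close> to the other
    side exposes \<open>g p'\<close> as the middle of a sandwich, and von Neumann's lemma splits the
    sum into a product of two coefficients.\<close>
  have 1: "ysum (\<lambda>s. ycoeff (g \<circ> s \<circ> inv g)) = (\<Sum>p'\<in>Row. \<Sum>q\<in>Col. sign q * (ycoeff (g \<circ> p') * ycoeff (inv q \<circ> g)))"
    if g: "g \<in> Per" for g
  proof -
    let ?T = "\<lambda>p' q' p q. sign q * (sign q' * of_bool (p \<circ> (g \<circ> p') \<circ> q' = inv q \<circ> g))"
    have key: "p \<circ> (g \<circ> (p' \<circ> q') \<circ> inv g) \<circ> q = id \<longleftrightarrow> p \<circ> (g \<circ> p') \<circ> q' = inv q \<circ> g" if q: "q \<in> Col" for p p' q' q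
    proof -
      have gg: "inv g \<circ> g = id" "g \<circ> inv g = id" using permgroupD(3,4)[OF permgroup_all g] by auto
      have qq: "inv q \<circ> q = id" "q \<circ> inv q = id" using permgroupD(3,4)[OF permgroup_Col q] by auto
      have "w \<circ> inv g \<circ> q = id \<longleftrightarrow> w = inv q \<circ> g" for w
      proof
        assume "w \<circ> inv g \<circ> q = id"
        then have "w \<circ> inv g \<circ> q \<circ> inv q \<circ> g = inv q \<circ> g" by simp
        then have "w \<circ> (inv g \<circ> (q \<circ> inv q) \<circ> g) = inv q \<circ> g" by (simp only: comp_assoc)
        then show "w = inv q \<circ> g" using gg qq by simp
      next
        assume "w = inv q \<circ> g"
        then have "w \<circ> inv g \<circ> q = inv q \<circ> (g \<circ> inv g) \<circ> q" by (simp only: comp_assoc)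
        then show "w \<circ> inv g \<circ> q = id" using gg qq by simp
      qed
      from this[of "p \<circ> (g \<circ> p') \<circ> q'"] show ?thesis by (simp only: comp_assoc)
    qed
    have "ysum (\<lambda>s. ycoeff (g \<circ> s \<circ> inv g)) = (\<Sum>p'\<in>Row. \<Sum>q'\<in>Col. \<Sum>p\<in>Row. \<Sum>q\<in>Col. ?T p' q' p q)"
      unfolding ysum_def
    proof (rule sum.cong[OF refl], rule sum.cong[OF refl])
      fix p' q' assume "p' \<in> Row" "q' \<in> Col"
      then have "g \<circ> (p' \<circ> q') \<circ> inv g \<in> Per" using g Row_Per Col_Per by (auto intro!: permutes_compose permutes_inv)
      then have "ycoeff (g \<circ> (p' \<circ> q') \<circ> inv g) = (\<Sum>p\<in>Row. \<Sum>q\<in>Col. sign q * of_bool (p \<circ> (g \<circ> p') \<circ> q' = inv q \<circ> g))"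
        by (simp only: ycoeff_middle) (rule sum.cong[OF refl], rule sum.cong[OF refl], simp only: key)
      then show "of_int (sign q') * ycoeff (g \<circ> (p' \<circ> q') \<circ> inv g) = (\<Sum>p\<in>Row. \<Sum>q\<in>Col. ?T p' q' p q)"
        by (simp only: sum_distrib_left of_int_eq_id id_apply mult.left_commute)
    qed
    also have "\<dots> = (\<Sum>p'\<in>Row. \<Sum>p\<in>Row. \<Sum>q\<in>Col. \<Sum>q'\<in>Col. ?T p' q' p q)"
      by (rule sum.cong[OF refl], subst sum.swap, rule sum.cong[OF refl], rule sum.swap)
    also have "\<dots> = (\<Sum>p'\<in>Row. \<Sum>q\<in>Col. \<Sum>p\<in>Row. \<Sum>q'\<in>Col. ?T p' q' p q)"
      by (rule sum.cong[OF refl], rule sum.swap)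
    also have "\<dots> = (\<Sum>p'\<in>Row. \<Sum>q\<in>Col. sign q * (ycoeff (g \<circ> p') * ycoeff (inv q \<circ> g)))"
    proof (rule sum.cong[OF refl], rule sum.cong[OF refl])
      fix p' q assume "p' \<in> Row" "q \<in> Col"
      then have "g \<circ> p' \<in> Per" using g Row_Per by (auto intro!: permutes_compose)
      from sum_middle[OF this, of "\<lambda>s. of_bool (s = inv q \<circ> g) :: int"]
      show "(\<Sum>p\<in>Row. \<Sum>q'\<in>Col. ?T p' q' p q) = sign q * (ycoeff (g \<circ> p') * ycoeff (inv q \<circ> g))"
        by (simp add: ycoeff_def[of "inv q \<circ> g"] flip: sum_distrib_left)
    qed
    finally show ?thesis .
  qed
  let ?G = "\<lambda>g p q. sign q * (ycoeff (g \<circ> p) * ycoeff (inv q \<circ> g))"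
  have "ysum psi = (\<Sum>g\<in>Per. ysum (\<lambda>s. ycoeff (g \<circ> s \<circ> inv g)))"
    unfolding psi_def using ysum_sum[where I = Per and c = "\<lambda>_. 1" and f = "\<lambda>g s. ycoeff (g \<circ> s \<circ> inv g)"] by simp
  also have "\<dots> = (\<Sum>g\<in>Per. \<Sum>p\<in>Row. \<Sum>q\<in>Col. ?G g p q)"
    using 1 by (rule sum.cong[OF refl])
  also have "\<dots> = (\<Sum>q\<in>Col. \<Sum>p\<in>Row. \<Sum>g\<in>Per. ?G g p q)"
    by (subst sum.swap, subst sum.swap[of _ Row Col], rule sum.cong[OF refl], rule sum.swap)
  \<comment> \<open>Substituting \<open>q g\<close> for \<open>g\<close> cancels
    \<open>inv q\<close> in the second coefficient, and the remaining factor becomes the sandwich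
    \<open>q g p\<close>.\<close>
  also have "\<dots> = (\<Sum>q\<in>Col. \<Sum>p\<in>Row. \<Sum>g\<in>Per. ycoeff g * (sign q * ycoeff (q \<circ> g \<circ> p)))"
  proof (rule sum.cong[OF refl], rule sum.cong[OF refl])
    fix q p assume q: "q \<in> Col"
    have "(\<Sum>g\<in>Per. ?G g p q) = (\<Sum>g\<in>Per. ?G (q \<circ> g) p q)"
      using Col_Per[OF q] by (rule sum_permgroup_left[OF permgroup_all, symmetric])
    also have "\<dots> = (\<Sum>g\<in>Per. ycoeff g * (sign q * ycoeff (q \<circ> g \<circ> p)))"
      using permgroupD(4)[OF permgroup_Col q] by (simp add: comp_assoc[symmetric] mult_ac)
    finally show "(\<Sum>g\<in>Per. ?G g p q) = (\<Sum>g\<in>Per. ycoeff g * (sign q * ycoeff (q \<circ> g \<circ> p)))" .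
  qed
  also have "\<dots> = (\<Sum>q\<in>Col. \<Sum>g\<in>Per. \<Sum>p\<in>Row. ycoeff g * (sign q * ycoeff (q \<circ> g \<circ> p)))"
    by (rule sum.cong[OF refl], rule sum.swap)
  also have "\<dots> = (\<Sum>g\<in>Per. \<Sum>q\<in>Col. \<Sum>p\<in>Row. ycoeff g * (sign q * ycoeff (q \<circ> g \<circ> p)))"
    by (rule sum.swap)
  also have "\<dots> = ysum ?F"
    by (simp only: ysum_eq_sum_ycoeff sum_distrib_left of_int_eq_id id_apply)
  also have "\<dots> = ysum (\<lambda>t. ysum (\<lambda>s. ysum (\<lambda>u. of_bool (s \<circ> t \<circ> u = id))))"
    by (rule ysum_cong) (rule sum_ycoeff_sandwich)
  also have "\<dots> = ysum (\<lambda>s. ysum (\<lambda>t. ysum (\<lambda>u. of_bool ((s \<circ> t) \<circ> u = id))))"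
    by (rule ysum_swap)
  also have "\<dots> = of_int kappa * ysum (\<lambda>w. ysum (\<lambda>u. of_bool (w \<circ> u = id)))"
    by (rule ysum_ysum)
  finally show ?thesis by (simp add: ysum_ysum_id)
qed

section \<open>The value of the rectangular character on the symmetrizer\<close>

lemma card_row: "i < r \<Longrightarrow> card {x\<in>cells. row x = i} = a"
proof -
  assume i: "i < r"
  have "bij_betw (\<lambda>j. 1 + i * a + j) {..<a} {x\<in>cells. row x = i}"
  proof (rule bij_betwI[where g = col])
    fix x assume "x \<in> {x\<in>cells. row x = i}"
    then have x: "x \<in> cells" "row x = i" by blast+
    note c = cell[OF i col_less, of x]
    show "1 + i * a + col x = x" by (rule cell_eqI[OF c(1) x(1) _ c(3)]) (simp only: c(2) x(2))
  next
    fix j assume "j \<in> {..<a}"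
    then show "col (1 + i * a + j) = j" using cell(3)[OF i] by blast
  next
    show "(\<lambda>j. 1 + i * a + j) \<in> {..<a} \<rightarrow> {x\<in>cells. row x = i}" using cell(1,2)[OF i] by blast
    show "col \<in> {x\<in>cells. row x = i} \<rightarrow> {..<a}" using col_less by blast
  qed
  then show ?thesis by (metis bij_betw_same_card card_lessThan)
qed

lemma row_coloring:
  assumes y: "y \<in> Per"
  shows "restrict (row \<circ> y) cells \<in> colorings (r * a) r (\<lambda>_. int a)"
proof -
  have yp: "y permutes cells" using y by simp
  have "restrict (row \<circ> y) cells \<in> cells \<rightarrow>\<^sub>E {0..<r}"
    using permutes_in_image[OF yp] row_less by (simp add: PiE_iff)
  moreover have "{x\<in>cells. restrict (row \<circ> y) cells x = i} = {x\<in>cells. row (y x) = i}" for i by auto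
  ultimately show ?thesis
    unfolding colorings_def using card_fibre_comp_permutes[OF yp, of row] card_row by simp
qed

text \<open>The colouring by the rows of \<open>y\<close> determines the coset of \<open>y\<close>
  under left multiplication by \<open>Row\<close>, and conversely.\<close>

lemma card_row_colorings_fibre:
  assumes f: "f \<in> colorings (r * a) r (\<lambda>_. int a)"
  shows "card {y\<in>Per. restrict (row \<circ> y) cells = f} = card Row"
proof -
  have fib: "card {x\<in>cells. f x = i} = card {x\<in>cells. row x = i}" if "i \<in> {0..<r}" for i
    using f that card_row[of i] by (simp add: colorings_def)
  have fr: "f x \<in> {0..<r}" "row x \<in> {0..<r}" if "x \<in> cells" for x
    using f that row_less by (auto simp: colorings_def PiE_iff)
  obtain y0 where y0: "y0 permutes cells" "\<And>x. x \<in> cells \<Longrightarrow> f x = row (y0 x)"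
    using permutes_transports_coloring[OF _ fr fib] by blast
  have fext: "f x = undefined" if "x \<notin> cells" for x using f that by (simp add: colorings_def PiE_iff extensional_def)
  have eqf: "restrict (row \<circ> y) cells = f \<longleftrightarrow> (\<forall>x\<in>cells. row (y x) = f x)" for y
    using fext by (auto simp: fun_eq_iff restrict_def)
  have iy: "inv y0 permutes cells" by (rule permutes_inv[OF y0(1)])
  have "bij_betw (\<lambda>p. p \<circ> y0) Row {y\<in>Per. restrict (row \<circ> y) cells = f}"
  proof (rule bij_betwI[where g = "\<lambda>y. y \<circ> inv y0"])
    show "(\<lambda>p. p \<circ> y0) \<in> Row \<rightarrow> {y\<in>Per. restrict (row \<circ> y) cells = f}"
      unfolding eqf using y0 by (auto simp: Row_def intro: permutes_compose)
    show "(\<lambda>y. y \<circ> inv y0) \<in> {y\<in>Per. restrict (row \<circ> y) cells = f} \<rightarrow> Row"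
    proof
      fix y assume y: "y \<in> {y\<in>Per. restrict (row \<circ> y) cells = f}"
      then have yp: "y permutes cells" and yf: "\<forall>x\<in>cells. row (y x) = f x" unfolding eqf by auto
      have "row (y (inv y0 x)) = row x" for x
      proof (cases "x \<in> cells")
        case True
        then have "inv y0 x \<in> cells" using permutes_in_image[OF iy] by blast
        then show ?thesis using yf y0(2) permutes_inverses(1)[OF y0(1)] by simp
      next
        case False
        then show ?thesis using permutes_not_in[OF iy False] permutes_not_in[OF yp False] by simp
      qed
      then show "y \<circ> inv y0 \<in> Row" using permutes_compose[OF iy yp] by (simp add: Row_def)
    qed
  qed (use permutes_inv_o[OF y0(1)] in \<open>simp_all add: comp_assoc\<close>)
  then show ?thesis by (rule bij_betw_same_card[symmetric])
qed

text \<open>The permutation character is the one induced from the trivial character of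
  \<open>Row\<close>. A coset is fixed by \<open>s\<close> when \<open>p y s = y\<close> has a
  solution in \<open>Row\<close>; the solution \<open>y inv s inv y\<close> is unique, so counting
  solutions over all \<open>y\<close> counts each fixed coset \<open>card Row\<close> times.\<close>

lemma card_Row_times_young_perm_char:
  assumes s: "s \<in> Per"
  shows "int (card Row) * young_perm_char (r * a) r (\<lambda>_. int a) s = (\<Sum>y\<in>Per. \<Sum>p\<in>Row. of_bool (p \<circ> y \<circ> s = y))"
proof -
  have sp: "s permutes cells" using s by simp
  let ?C = "colorings (r * a) r (\<lambda>_. int a)"
  let ?fix = "\<lambda>y. \<forall>x\<in>cells. row (y (s x)) = row (y x)"
  have sx: "s x \<in> cells \<longleftrightarrow> x \<in> cells" for x by (rule permutes_in_image[OF sp])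
  have one: "(\<Sum>p\<in>Row. of_bool (p \<circ> y \<circ> s = y)) = (of_bool (?fix y) :: int)" if y: "y \<in> Per" for y
  proof -
    have yp: "y permutes cells" using y by simp
    let ?p = "y \<circ> inv s \<circ> inv y"
    have isp: "inv s permutes cells" and iy: "inv y permutes cells"
      using permutes_inv sp yp by blast+
    have pp: "?p permutes cells" using isp iy yp by (intro permutes_compose)
    have iff: "p \<circ> y \<circ> s = y \<longleftrightarrow> p = ?p" for p
    proof
      assume "p \<circ> y \<circ> s = y"
      then have "p \<circ> y \<circ> s \<circ> inv s \<circ> inv y = ?p" by simp
      then have "p \<circ> (y \<circ> (s \<circ> inv s) \<circ> inv y) = ?p" by (simp only: comp_assoc)
      then show "p = ?p" using permutes_inv_o[OF sp] permutes_inv_o[OF yp] by simp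
    next
      assume "p = ?p"
      then have "p \<circ> y \<circ> s = y \<circ> inv s \<circ> (inv y \<circ> y) \<circ> s" by (simp only: comp_assoc)
      also have "\<dots> = y \<circ> (inv s \<circ> s)" using permutes_inv_o[OF yp] by (simp add: comp_assoc)
      finally show "p \<circ> y \<circ> s = y" using permutes_inv_o[OF sp] by simp
    qed
    have "?p \<in> Row \<longleftrightarrow> ?fix y"
    proof
      assume "?p \<in> Row"
      then have *: "row (?p z) = row z" for z by (simp add: Row_def)
      show "?fix y"
      proof
        fix x
        show "row (y (s x)) = row (y x)"
          using *[of "y (s x)"] permutes_inverses[OF yp] permutes_inverses[OF sp] by simp
      qed
    next
      assume fx: "?fix y"
      have "row (?p z) = row z" for z
      proof (cases "z \<in> cells")
        case True
        then have "inv s (inv y z) \<in> cells" using permutes_in_image[OF isp] permutes_in_image[OF iy] by blast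
        from bspec[OF fx this] have "row (y (inv s (inv y z))) = row (y (s (inv s (inv y z))))" by (rule sym)
        then show ?thesis using permutes_inverses(1)[OF yp] permutes_inverses(1)[OF sp] by simp
      next
        case False
        then show ?thesis using permutes_not_in[OF pp False] by simp
      qed
      then show "?p \<in> Row" using pp by (simp add: Row_def)
    qed
    moreover have "(\<Sum>p\<in>Row. of_bool (p \<circ> y \<circ> s = y)) = (of_bool (?p \<in> Row) :: int)"
      unfolding iff of_bool_def by (subst sum.delta) auto
    ultimately show ?thesis by simp
  qed
  have "(\<Sum>y\<in>Per. \<Sum>p\<in>Row. of_bool (p \<circ> y \<circ> s = y)) = (\<Sum>y\<in>Per. of_bool (?fix y) :: int)"
    using one by (rule sum.cong[OF refl])
  also have "\<dots> = (\<Sum>y\<in>Per. of_bool (\<forall>x\<in>cells. restrict (row \<circ> y) cells (s x) = restrict (row \<circ> y) cells x))"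
    using sx by (intro sum.cong refl arg_cong[where f = of_bool]) simp
  also have "\<dots> = (\<Sum>f\<in>?C. \<Sum>y | y \<in> Per \<and> restrict (row \<circ> y) cells = f.
        of_bool (\<forall>x\<in>cells. restrict (row \<circ> y) cells (s x) = restrict (row \<circ> y) cells x))"
    using row_coloring by (intro sum.group[symmetric] finite_Per finite_colorings) blast
  also have "\<dots> = (\<Sum>f\<in>?C. int (card Row) * of_bool (\<forall>x\<in>cells. f (s x) = f x))"
  proof (rule sum.cong[OF refl])
    fix f assume f: "f \<in> ?C"
    have "(\<Sum>y | y \<in> Per \<and> restrict (row \<circ> y) cells = f.
        of_bool (\<forall>x\<in>cells. restrict (row \<circ> y) cells (s x) = restrict (row \<circ> y) cells x))
      = (\<Sum>y | y \<in> Per \<and> restrict (row \<circ> y) cells = f. of_bool (\<forall>x\<in>cells. f (s x) = f x) :: int)"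
      by (rule sum.cong) auto
    then show "(\<Sum>y | y \<in> Per \<and> restrict (row \<circ> y) cells = f.
        of_bool (\<forall>x\<in>cells. restrict (row \<circ> y) cells (s x) = restrict (row \<circ> y) cells x))
      = int (card Row) * of_bool (\<forall>x\<in>cells. f (s x) = f x)"
      unfolding sum_constant card_row_colorings_fibre[OF f] by simp
  qed
  finally show ?thesis unfolding young_perm_char_eq_sum sum_distrib_left by simp
qed

text \<open>Von Neumann's lemma with middle factor \<open>y p'\<close> turns the count of solutions
  into a sum of products of two coefficients of \<open>c\<close>. This sum is the coefficient of the
  identity in \<open>p c c\<close>, summed over \<open>p\<close> in \<open>Row\<close>. Each
  \<open>p\<close> is absorbed by \<open>c\<close>, and the factor \<open>card Row\<close>
  cancels.\<close>

lemma ysum_young_perm_char_rows: "ysum (young_perm_char (r * a) r (\<lambda>_. int a)) = kappa"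
proof -
  let ?h = "young_perm_char (r * a) r (\<lambda>_. int a)"
  have "int (card Row) * ysum ?h = ysum (\<lambda>s. \<Sum>y\<in>Per. \<Sum>p\<in>Row. of_bool (p \<circ> y \<circ> s = y))"
    unfolding ysum_scale[symmetric] by (rule ysum_cong) (rule card_Row_times_young_perm_char)
  also have "\<dots> = (\<Sum>y\<in>Per. ysum (\<lambda>s. \<Sum>p\<in>Row. of_bool (p \<circ> y \<circ> s = y)))"
    using ysum_sum[where I = Per and c = "\<lambda>_. 1" and f = "\<lambda>y s. \<Sum>p\<in>Row. of_bool (p \<circ> y \<circ> s = y)"] by simp
  also have "\<dots> = (\<Sum>y\<in>Per. \<Sum>p'\<in>Row. ycoeff (y \<circ> p') * ycoeff y)"
  proof (rule sum.cong[OF refl])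
    fix y assume y: "y \<in> Per"
    have "ysum (\<lambda>s. \<Sum>p\<in>Row. of_bool (p \<circ> y \<circ> s = y))
      = (\<Sum>p'\<in>Row. \<Sum>q\<in>Col. \<Sum>p\<in>Row. sign q * of_bool (p \<circ> (y \<circ> p') \<circ> q = y))"
      by (simp only: ysum_def sum_distrib_left comp_assoc of_int_eq_id id_apply)
    also have "\<dots> = (\<Sum>p'\<in>Row. \<Sum>p\<in>Row. \<Sum>q\<in>Col. sign q * of_bool (p \<circ> (y \<circ> p') \<circ> q = y))"
      by (rule sum.cong[OF refl], rule sum.swap)
    also have "\<dots> = (\<Sum>p'\<in>Row. ycoeff (y \<circ> p') * ycoeff y)"
    proof (rule sum.cong[OF refl])
      fix p' assume "p' \<in> Row"
      then have "y \<circ> p' \<in> Per" using y Row_Per by (auto intro!: permutes_compose)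
      from sum_middle[OF this, of "\<lambda>s. of_bool (s = y) :: int"]
      show "(\<Sum>p\<in>Row. \<Sum>q\<in>Col. sign q * of_bool (p \<circ> (y \<circ> p') \<circ> q = y)) = ycoeff (y \<circ> p') * ycoeff y"
        by (simp add: ycoeff_def[of y])
    qed
    finally show "ysum (\<lambda>s. \<Sum>p\<in>Row. of_bool (p \<circ> y \<circ> s = y)) = (\<Sum>p'\<in>Row. ycoeff (y \<circ> p') * ycoeff y)" .
  qed
  also have "\<dots> = ysum (\<lambda>y. \<Sum>p'\<in>Row. ycoeff (y \<circ> p'))"
    by (simp add: ysum_eq_sum_ycoeff sum_distrib_left mult_ac)
  also have "\<dots> = ysum (\<lambda>y. \<Sum>p\<in>Row. ysum (\<lambda>u. of_bool (p \<circ> y \<circ> u = id)))"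
  proof (rule ysum_cong)
    fix y assume y: "y \<in> Per"
    have "ycoeff (y \<circ> p') = (\<Sum>p\<in>Row. \<Sum>q\<in>Col. sign q * of_bool (p \<circ> y \<circ> (p' \<circ> q) = id))" if "p' \<in> Row" for p'
    proof -
      have "y \<circ> p' \<in> Per" using y that Row_Per by (auto intro!: permutes_compose)
      then show ?thesis by (simp add: ycoeff_middle comp_assoc)
    qed
    then have "(\<Sum>p'\<in>Row. ycoeff (y \<circ> p')) = (\<Sum>p'\<in>Row. \<Sum>p\<in>Row. \<Sum>q\<in>Col. sign q * of_bool (p \<circ> y \<circ> (p' \<circ> q) = id))"
      by simp
    also have "\<dots> = (\<Sum>p\<in>Row. \<Sum>p'\<in>Row. \<Sum>q\<in>Col. sign q * of_bool (p \<circ> y \<circ> (p' \<circ> q) = id))"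
      by (rule sum.swap)
    finally show "(\<Sum>p'\<in>Row. ycoeff (y \<circ> p')) = (\<Sum>p\<in>Row. ysum (\<lambda>u. of_bool (p \<circ> y \<circ> u = id)))"
      by (simp add: ysum_def)
  qed
  also have "\<dots> = (\<Sum>p\<in>Row. ysum (\<lambda>y. ysum (\<lambda>u. of_bool (p \<circ> y \<circ> u = id))))"
    using ysum_sum[where I = Row and c = "\<lambda>_. 1" and f = "\<lambda>p y. ysum (\<lambda>u. of_bool (p \<circ> y \<circ> u = id))"] by simp
  also have "\<dots> = (\<Sum>p\<in>Row. ysum (\<lambda>y. ysum (\<lambda>u. of_bool (y \<circ> u = id))))"
  proof (rule sum.cong[OF refl])
    fix p assume p: "p \<in> Row"
    have "(\<Sum>p1\<in>Row. \<Sum>q\<in>Col. of_int (sign q) * ysum (\<lambda>u. of_bool (p \<circ> p1 \<circ> q \<circ> u = id)))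
       = (\<Sum>p1\<in>Row. \<Sum>q\<in>Col. of_int (sign q) * ysum (\<lambda>u. of_bool (p1 \<circ> q \<circ> u = id)))"
      by (rule sum_permgroup_left[OF permgroup_Row p])
    then show "ysum (\<lambda>y. ysum (\<lambda>u. of_bool (p \<circ> y \<circ> u = id))) = ysum (\<lambda>y. ysum (\<lambda>u. of_bool (y \<circ> u = id)))"
      unfolding ysum_def[of "\<lambda>y. ysum (\<lambda>u. of_bool (p \<circ> y \<circ> u = id))"] ysum_def[of "\<lambda>y. ysum (\<lambda>u. of_bool (y \<circ> u = id))"]
      by (simp only: comp_assoc)
  qed
  also have "\<dots> = int (card Row) * kappa" by (simp add: ysum_ysum_id)
  finally show ?thesis using permgroup_Row by (auto simp: permgroup_def)
qed

text \<open>A colour used more than \<open>a\<close> times occurs twice in some column, by the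
  pigeonhole principle. The transposition of these two cells fixes the colouring and cancels the
  signed column sum.\<close>

lemma ysum_young_perm_char_wide:
  assumes i: "i < m" "al i > int a"
  shows "ysum (young_perm_char (r * a) m al) = 0"
proof -
  let ?C = "colorings (r * a) m al"
  have zero: "(\<Sum>q\<in>Col. of_int (sign q) * of_bool (\<forall>x\<in>cells. f ((p \<circ> q) x) = f x)) = (0::int)"
    if f: "f \<in> ?C" and p: "p \<in> Row" for f p
  proof -
    have pp: "p permutes cells" using p by (simp add: Row_def)
    let ?A = "{x\<in>cells. f (p x) = i}"
    have "int (card ?A) = al i"
      using card_fibre_comp_permutes[OF pp, of f i] f i by (simp add: colorings_def)
    then have "card ?A > card {..<a}" using i by simp
    moreover have "col ` ?A \<subseteq> {..<a}" using col_less by auto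
    ultimately have "\<not> inj_on col ?A" using card_inj_on_le[of col ?A "{..<a}"] by auto
    then obtain x y where xy: "x \<in> ?A" "y \<in> ?A" "x \<noteq> y" "col x = col y" by (auto simp: inj_on_def)
    have "f (p (transpose x y z)) = f (p z)" for z using xy by (auto simp: transpose_def)
    then show ?thesis using xy by (intro sum_sign_transpose_zero[of x y]) auto
  qed
  have "ysum (young_perm_char (r * a) m al)
     = (\<Sum>p\<in>Row. \<Sum>q\<in>Col. \<Sum>f\<in>?C. of_int (sign q) * of_bool (\<forall>x\<in>cells. f ((p \<circ> q) x) = f x))"
    unfolding ysum_def young_perm_char_eq_sum sum_distrib_left ..
  also have "\<dots> = (\<Sum>p\<in>Row. \<Sum>f\<in>?C. \<Sum>q\<in>Col. of_int (sign q) * of_bool (\<forall>x\<in>cells. f ((p \<circ> q) x) = f x))"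
    by (rule sum.cong[OF refl], rule sum.swap)
  also have "\<dots> = 0" by (rule sum.neutral, rule ballI, rule sum.neutral, rule ballI) (rule zero)
  finally show ?thesis .
qed

abbreviation chi :: "(nat \<Rightarrow> nat) \<Rightarrow> int" where "chi \<equiv> irr_char (replicate r a)"

text \<open>In the Jacobi--Trudi sum any permutation other than the identity has some
  \<open>p i > i\<close>, which gives a fibre size larger than \<open>a\<close>; only the diagonal
  term survives.\<close>

lemma ysum_chi: "ysum chi = kappa"
proof -
  let ?rect = "\<lambda>i. int a - int i"
  have "ysum chi = (\<Sum>p | p permutes {0..<r}. sign p * ysum (young_perm_char (r * a) r (\<lambda>i. ?rect i + int (p i))))"
    unfolding ysum_sum[symmetric]
    by (rule arg_cong[where f = ysum], rule ext) (simp only: irr_char_replicate altsum_def)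
  also have "\<dots> = (\<Sum>p | p permutes {0..<r}. if p = id then kappa else 0)"
  proof (intro sum.cong refl)
    fix p assume "p \<in> {p. p permutes {0..<r}}"
    then have p: "p permutes {0..<r}" by (rule CollectD)
    show "sign p * ysum (young_perm_char (r * a) r (\<lambda>i. ?rect i + int (p i))) = (if p = id then kappa else 0)"
    proof (cases "p = id")
      case True
      then show ?thesis using ysum_young_perm_char_rows by simp
    next
      case False
      then obtain i where "i < r" "p i > i" using permutes_le_imp_id[OF p] by (meson not_le)
      then show ?thesis using False ysum_young_perm_char_wide[of i r] by simp
    qed
  qed
  also have "\<dots> = kappa" by (simp add: finite_permutations permutes_id)
  finally show ?thesis .
qed

lemma chi_conj: "s \<in> Per \<Longrightarrow> g \<in> Per \<Longrightarrow> chi (g \<circ> s \<circ> inv g) = chi s"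
  by (rule irr_char_conj) (auto simp: sum_list_replicate)

lemma sum_chi_squared: "(\<Sum>s\<in>Per. chi s * chi s) = fact (r * a)"
  unfolding irr_char_replicate
  by (subst rectangle_orthogonality[OF pos]) auto

text \<open>The virtual character \<open>chi\<close> has norm one and pairs with the class function \<open>psi\<close> of norm
  \<open>kappa\<close> to \<open>kappa\<close>, which is the equality case of Cauchy--Schwarz.\<close>
lemma psi_eq_kappa_chi:
  assumes "s \<in> Per"
  shows "psi s = kappa * chi s"
proof -
  have 1: "(\<Sum>s\<in>Per. psi s * psi s) = fact (r * a) * (kappa * kappa)"
    using sum_psi[of psi] psi_conj ysum_psi by simp
  have 2: "(\<Sum>s\<in>Per. psi s * chi s) = fact (r * a) * kappa"
    using sum_psi[of chi] chi_conj ysum_chi by simp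
  have "(\<Sum>s\<in>Per. (psi s - kappa * chi s)\<^sup>2)
    = (\<Sum>s\<in>Per. psi s * psi s) - 2 * kappa * (\<Sum>s\<in>Per. psi s * chi s) + kappa * kappa * (\<Sum>s\<in>Per. chi s * chi s)"
    by (simp add: sum_distrib_left sum_subtractf[symmetric] sum.distrib[symmetric] power2_eq_square algebra_simps)
  also have "\<dots> = 0" unfolding 1 2 sum_chi_squared by (simp add: algebra_simps)
  finally have "\<forall>s\<in>Per. (psi s - kappa * chi s)\<^sup>2 = 0"
    by (subst (asm) sum_nonneg_eq_0_iff[OF finite_Per]) auto
  then show ?thesis using assms by auto
qed

lemma kappa_nonzero: "kappa \<noteq> 0"
proof
  assume "kappa = 0"
  moreover have "id \<in> Per" by (simp add: permutes_id)
  ultimately have "psi id = 0" using psi_eq_kappa_chi[of id] by (simp only: mult_zero_left)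
  then show False unfolding psi_id by simp
qed

end

section \<open>Traces on quotient spaces\<close>

context vector_space
begin

definition adapted_basis :: "'b set \<Rightarrow> 'b set \<Rightarrow> 'b set \<Rightarrow> 'b set \<Rightarrow> bool" where
  "adapted_basis V W Bw Bv \<longleftrightarrow> finite (Bw \<union> Bv) \<and> Bw \<inter> Bv = {} \<and> independent (Bw \<union> Bv)
     \<and> span Bw = W \<and> span (Bw \<union> Bv) = V"

definition quot_endo :: "'b set \<Rightarrow> 'b set \<Rightarrow> ('b \<Rightarrow> 'b) \<Rightarrow> bool" where
  "quot_endo V W T \<longleftrightarrow> (\<forall>x y. T (x + y) = T x + T y) \<and> (\<forall>c x. T (c *s x) = c *s T x) \<and> T ` V \<subseteq> V \<and> T ` W \<subseteq> W"

definition diag_sum :: "'b set \<Rightarrow> 'b set \<Rightarrow> ('b \<Rightarrow> 'b) \<Rightarrow> 'a" where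
  "diag_sum Bw Bv T = (\<Sum>b\<in>Bv. representation (Bw \<union> Bv) (T b) b)"

lemma functional_sum:
  assumes V: "subspace V" "A \<subseteq> V" "finite A"
    and add: "\<And>x y. x \<in> V \<Longrightarrow> y \<in> V \<Longrightarrow> f (x + y) = f x + f y"
    and sc: "\<And>c x. x \<in> V \<Longrightarrow> f (c *s x) = c * (f x :: 'a)"
  shows "f (\<Sum>b\<in>A. c b *s b) = (\<Sum>b\<in>A. c b * f b)"
  using V(3,2)
proof (induction A rule: finite_induct)
  case empty
  show ?case using sc[of 0 0] subspace_0[OF V(1)] by simp
next
  case (insert b A)
  have "(\<Sum>b\<in>A. c b *s b) \<in> V" using V(1) insert by (intro subspace_sum subspace_scale) auto
  then show ?case using insert add[of "c b *s b"] sc V(1) by (simp add: subspace_scale)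
qed

lemma functional_expand:
  assumes B: "adapted_basis V W Bw Bv" and v: "v \<in> V"
    and add: "\<And>x y. x \<in> V \<Longrightarrow> y \<in> V \<Longrightarrow> f (x + y) = f x + f y"
    and sc: "\<And>c x. x \<in> V \<Longrightarrow> f (c *s x) = c * (f x :: 'a)"
    and W: "\<And>x. x \<in> W \<Longrightarrow> f x = 0"
  shows "f v = (\<Sum>b\<in>Bv. representation (Bw \<union> Bv) v b * f b)"
proof -
  let ?B = "Bw \<union> Bv" and ?R = "representation (Bw \<union> Bv)"
  have fin: "finite ?B" and ind: "independent ?B" and V: "V = span ?B" and Ws: "span Bw = W" and dis: "Bw \<inter> Bv = {}"
    using B by (auto simp: adapted_basis_def)
  have "(\<Sum>b\<in>?B. ?R v b *s b) = v"
    using v V ind fin by (intro sum_representation_eq) auto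
  then have "f v = f (\<Sum>b\<in>?B. ?R v b *s b)" by simp
  also have "\<dots> = (\<Sum>b\<in>?B. ?R v b * f b)"
    by (rule functional_sum[OF _ _ fin add sc]) (auto simp: V span_base)
  also have "\<dots> = (\<Sum>b\<in>Bw. ?R v b * f b) + (\<Sum>b\<in>Bv. ?R v b * f b)"
    using fin dis by (intro sum.union_disjoint) auto
  also have "(\<Sum>b\<in>Bw. ?R v b * f b) = 0"
    using W Ws span_base by (intro sum.neutral) auto
  finally show ?thesis by simp
qed

lemma representation_quot:
  assumes B: "adapted_basis V W Bw Bv" and b: "b \<in> Bv"
  shows "x \<in> V \<Longrightarrow> y \<in> V \<Longrightarrow> representation (Bw \<union> Bv) (x + y) b = representation (Bw \<union> Bv) x b + representation (Bw \<union> Bv) y b"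
    and "x \<in> V \<Longrightarrow> representation (Bw \<union> Bv) (c *s x) b = c * representation (Bw \<union> Bv) x b"
    and "w \<in> W \<Longrightarrow> representation (Bw \<union> Bv) w b = 0"
proof -
  have ind: "independent (Bw \<union> Bv)" and V: "V = span (Bw \<union> Bv)" and Ws: "span Bw = W" and dis: "Bw \<inter> Bv = {}"
    using B by (auto simp: adapted_basis_def)
  show "x \<in> V \<Longrightarrow> y \<in> V \<Longrightarrow> representation (Bw \<union> Bv) (x + y) b = representation (Bw \<union> Bv) x b + representation (Bw \<union> Bv) y b"
    using representation_add[OF ind, of y x] V by (simp add: add.commute)
  show "x \<in> V \<Longrightarrow> representation (Bw \<union> Bv) (c *s x) b = c * representation (Bw \<union> Bv) x b"
    using representation_scale[OF ind] V by simp
  assume "w \<in> W"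
  then have "representation (Bw \<union> Bv) w = representation Bw w"
    using Ws by (intro representation_extend[OF ind]) auto
  then show "representation (Bw \<union> Bv) w b = 0"
    using representation_ne_zero[of Bw w b] b dis by auto
qed

text \<open>Coordinates along the complement vanish on \<open>W\<close>, so they are functionals on
  the quotient. The two coordinate systems on \<open>V\<close> modulo \<open>W\<close> are related
  by mutually inverse matrices, which cancel in the trace.\<close>

lemma diag_sum_unique:
  assumes B: "adapted_basis V W Bw Bv" and B': "adapted_basis V W Cw Cv" and T: "quot_endo V W T"
  shows "diag_sum Bw Bv T = diag_sum Cw Cv T"
proof -
  let ?R = "representation (Bw \<union> Bv)" and ?S = "representation (Cw \<union> Cv)"
  have Tadd: "T (x + y) = T x + T y" and Tsc: "T (c *s x) = c *s T x" and TV: "x \<in> V \<Longrightarrow> T x \<in> V" and TW: "x \<in> W \<Longrightarrow> T x \<in> W" for x y c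
    using T by (auto simp: quot_endo_def)
  have BV: "Bv \<subseteq> V" "Cv \<subseteq> V" using B B' span_base by (auto simp: adapted_basis_def)
  note R = representation_quot[OF B] and S = representation_quot[OF B']
  have 1: "?R (T b) b = (\<Sum>c\<in>Cv. \<Sum>d\<in>Cv. ?S b c * (?S (T c) d * ?R d b))" if b: "b \<in> Bv" for b
  proof -
    have "?R (T b) b = (\<Sum>c\<in>Cv. ?S b c * ?R (T c) b)"
      using b BV by (intro functional_expand[OF B']) (auto simp: Tadd Tsc R[OF b] TV TW)
    also have "\<dots> = (\<Sum>c\<in>Cv. ?S b c * (\<Sum>d\<in>Cv. ?S (T c) d * ?R d b))"
    proof (intro sum.cong refl arg_cong2[where f = "(*)"])
      fix c assume "c \<in> Cv"
      then show "?R (T c) b = (\<Sum>d\<in>Cv. ?S (T c) d * ?R d b)"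
        using BV TV by (intro functional_expand[OF B']) (auto simp: R[OF b])
    qed
    finally show ?thesis by (simp add: sum_distrib_left)
  qed
  have ind: "independent (Cw \<union> Cv)" and fin: "finite Cv" using B' by (auto simp: adapted_basis_def)
  \<comment> \<open>The change-of-basis matrices are inverse to each other modulo \<open>W\<close>:
    the functional \<open>?S _ c\<close> is expanded at \<open>d\<close> in the first basis.\<close>
  have 2: "(\<Sum>b\<in>Bv. ?R d b * ?S b c) = (if d = c then 1 else 0)" if "c \<in> Cv" "d \<in> Cv" for c d
  proof -
    have "?S d c = (\<Sum>b\<in>Bv. ?R d b * ?S b c)"
      using that BV by (intro functional_expand[OF B]) (auto simp: S[OF that(1)])
    moreover have "?S d c = (if c = d then 1 else 0)"
      using representation_basis[OF ind, of d] that by simp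
    ultimately show ?thesis by auto
  qed
  have "diag_sum Bw Bv T = (\<Sum>b\<in>Bv. \<Sum>c\<in>Cv. \<Sum>d\<in>Cv. ?S b c * (?S (T c) d * ?R d b))"
    unfolding diag_sum_def using 1 by simp
  also have "\<dots> = (\<Sum>c\<in>Cv. \<Sum>b\<in>Bv. \<Sum>d\<in>Cv. ?S b c * (?S (T c) d * ?R d b))" by (rule sum.swap)
  also have "\<dots> = (\<Sum>c\<in>Cv. \<Sum>d\<in>Cv. \<Sum>b\<in>Bv. ?S b c * (?S (T c) d * ?R d b))" by (rule sum.cong[OF refl], rule sum.swap)
  also have "\<dots> = (\<Sum>c\<in>Cv. \<Sum>d\<in>Cv. ?S (T c) d * (\<Sum>b\<in>Bv. ?R d b * ?S b c))"
    by (simp add: sum_distrib_left mult_ac)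
  also have "\<dots> = (\<Sum>c\<in>Cv. \<Sum>d\<in>Cv. if d = c then ?S (T c) d else 0)"
    by (intro sum.cong refl) (simp add: 2)
  also have "\<dots> = diag_sum Cw Cv T"
    unfolding diag_sum_def using fin by (intro sum.cong refl) simp
  finally show ?thesis .
qed

text \<open>The choice in \<open>quot_trace\<close> is harmless because all admissible bases give
  the same value and at least one exists.\<close>

lemma quot_trace_eq_diag_sum:
  assumes B: "adapted_basis V W Bw Bv" and T: "quot_endo V W T"
  shows "quot_trace scale V W T = diag_sum Bw Bv T"
proof -
  let ?P = "\<lambda>t. \<exists>bw bv. distinct (bw @ bv) \<and> \<not> dependent (set (bw @ bv)) \<and>
        span (set bw) = W \<and> span (set (bw @ bv)) = V \<and>
        t = (\<Sum>b\<leftarrow>bv. representation (set (bw @ bv)) (T b) b)"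
  have eq: "t = diag_sum Bw Bv T" if t: "?P t" for t
  proof -
    obtain bw bv where b: "distinct (bw @ bv)" "independent (set (bw @ bv))" "span (set bw) = W"
      "span (set (bw @ bv)) = V" "t = (\<Sum>b\<leftarrow>bv. representation (set (bw @ bv)) (T b) b)" using t by blast
    have a: "adapted_basis V W (set bw) (set bv)" using b by (auto simp: adapted_basis_def)
    have "t = diag_sum (set bw) (set bv) T"
      using b by (simp add: diag_sum_def sum_list_distinct_conv_sum_set)
    then show ?thesis using diag_sum_unique[OF a B T] by simp
  qed
  obtain bw where bw: "set bw = Bw" "distinct bw" using finite_distinct_list[of Bw] B by (auto simp: adapted_basis_def)
  obtain bv where bv: "set bv = Bv" "distinct bv" using finite_distinct_list[of Bv] B by (auto simp: adapted_basis_def)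
  have "?P (diag_sum Bw Bv T)"
    using B bw bv by (intro exI[of _ bw] exI[of _ bv]) (auto simp: adapted_basis_def diag_sum_def sum_list_distinct_conv_sum_set)
  then show ?thesis unfolding quot_trace_def by (rule eq[OF someI])
qed

lemma finite_in_span:
  assumes "finite S" "V = span S" "independent B" "B \<subseteq> V"
  shows "finite B"
  using independent_span_bound[of S B] assms by auto

lemma adapted_basis_chain:
  assumes S: "finite S" "V = span S" and W: "subspace W" "W \<subseteq> U" and U: "subspace U" "U \<subseteq> V"
  obtains Bw B1 B2 where "adapted_basis V W Bw (B1 \<union> B2)" "adapted_basis U W Bw B1" "B1 \<inter> B2 = {}"
proof -
  obtain Bw where Bw: "Bw \<subseteq> W" "independent Bw" "W \<subseteq> span Bw" "card Bw = dim W" by (rule basis_exists)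
  have "Bw \<subseteq> U" using Bw(1) W(2) by blast
  from maximal_independent_subset_extend[OF this Bw(2)]
  obtain C1 where C1: "Bw \<subseteq> C1" "C1 \<subseteq> U" "independent C1" "U \<subseteq> span C1" .
  have "C1 \<subseteq> V" using C1(2) U(2) by blast
  from maximal_independent_subset_extend[OF this C1(3)]
  obtain C2 where C2: "C1 \<subseteq> C2" "C2 \<subseteq> V" "independent C2" "V \<subseteq> span C2" .
  have fin: "finite C2" by (rule finite_in_span[OF S C2(3,2)])
  have subV: "subspace V" using S by simp
  have sp: "span Bw = W" "span C1 = U" "span C2 = V"
    using Bw(1,3) C1(2,4) C2(2,4) W(1) U(1) subV span_minimal by blast+
  have e: "Bw \<union> (C1 - Bw) = C1" "Bw \<union> ((C1 - Bw) \<union> (C2 - C1)) = C2" using C1(1) C2(1) by auto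
  have "finite C1" using C2(1) fin by (rule finite_subset)
  then have 1: "adapted_basis U W Bw (C1 - Bw)"
    unfolding adapted_basis_def e using C1(3) sp by blast
  have 2: "adapted_basis V W Bw ((C1 - Bw) \<union> (C2 - C1))"
    unfolding adapted_basis_def e using C1(1) C2(3) sp fin by blast
  show thesis by (rule that[OF 2 1]) blast
qed

lemma adapted_basis_exists:
  assumes "finite S" "V = span S" "subspace W" "W \<subseteq> V"
  obtains Bw Bv where "adapted_basis V W Bw Bv"
  using adapted_basis_chain[OF assms(1,2,3) order_refl assms(3,4)] by metis

lemma quot_endo_sum:
  assumes V: "subspace V" "subspace W" and T: "\<And>i. i \<in> I \<Longrightarrow> quot_endo V W (T i)"
  shows "quot_endo V W (\<lambda>v. \<Sum>i\<in>I. c i *s T i v)"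
  unfolding quot_endo_def
proof (intro conjI allI image_subsetI)
  show "(\<Sum>i\<in>I. c i *s T i (x + y)) = (\<Sum>i\<in>I. c i *s T i x) + (\<Sum>i\<in>I. c i *s T i y)" for x y
    using T by (simp add: quot_endo_def sum.distrib[symmetric] scale_right_distrib)
  show "(\<Sum>i\<in>I. c i *s T i (k *s x)) = k *s (\<Sum>i\<in>I. c i *s T i x)" for k x
    using T by (simp add: quot_endo_def scale_sum_right mult.commute)
  show "(\<Sum>i\<in>I. c i *s T i x) \<in> V" if "x \<in> V" for x
    using T that V by (intro subspace_sum subspace_scale) (simp_all add: quot_endo_def image_subset_iff)
  show "(\<Sum>i\<in>I. c i *s T i x) \<in> W" if "x \<in> W" for x
    using T that V by (intro subspace_sum subspace_scale) (simp_all add: quot_endo_def image_subset_iff)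
qed

lemma quot_trace_sum:
  assumes S: "finite S" "V = span S" and W: "subspace W" "W \<subseteq> V"
    and I: "finite I" and T: "\<And>i. i \<in> I \<Longrightarrow> quot_endo V W (T i)"
  shows "quot_trace scale V W (\<lambda>v. \<Sum>i\<in>I. c i *s T i v) = (\<Sum>i\<in>I. c i * quot_trace scale V W (T i))"
proof -
  obtain Bw Bv where B: "adapted_basis V W Bw Bv" using adapted_basis_exists[OF S W] .
  have V: "subspace V" using S by simp
  have ind: "independent (Bw \<union> Bv)" and sp: "span (Bw \<union> Bv) = V" using B by (auto simp: adapted_basis_def)
  have BV: "Bv \<subseteq> V" using sp span_base by blast
  have TV: "T i b \<in> span (Bw \<union> Bv)" if "i \<in> I" "b \<in> Bv" for i b
  proof -
    have "b \<in> V" using BV that(2) by blast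
    then show ?thesis using T[OF that(1)] by (simp add: quot_endo_def image_subset_iff sp)
  qed
  have "quot_trace scale V W (\<lambda>v. \<Sum>i\<in>I. c i *s T i v) = diag_sum Bw Bv (\<lambda>v. \<Sum>i\<in>I. c i *s T i v)"
    by (rule quot_trace_eq_diag_sum[OF B quot_endo_sum[OF V W(1) T]])
  also have "\<dots> = (\<Sum>b\<in>Bv. \<Sum>i\<in>I. c i * representation (Bw \<union> Bv) (T i b) b)"
    unfolding diag_sum_def
  proof (intro sum.cong refl)
    fix b assume b: "b \<in> Bv"
    have "representation (Bw \<union> Bv) (\<Sum>i\<in>I. c i *s T i b) b = (\<Sum>i\<in>I. representation (Bw \<union> Bv) (c i *s T i b) b)"
      using representation_sum[OF ind, of I "\<lambda>i. c i *s T i b"] TV b by (simp add: span_scale)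
    then show "representation (Bw \<union> Bv) (\<Sum>i\<in>I. c i *s T i b) b = (\<Sum>i\<in>I. c i * representation (Bw \<union> Bv) (T i b) b)"
      using representation_scale[OF ind] TV b by simp
  qed
  also have "\<dots> = (\<Sum>i\<in>I. c i * diag_sum Bw Bv (T i))"
    unfolding diag_sum_def sum_distrib_left by (rule sum.swap)
  also have "\<dots> = (\<Sum>i\<in>I. c i * quot_trace scale V W (T i))"
    using quot_trace_eq_diag_sum[OF B T] by simp
  finally show ?thesis .
qed

lemma quot_trace_eq_0:
  assumes S: "finite S" "V = span S" and W: "subspace W" "W \<subseteq> V"
    and T: "quot_endo V W T" and TW: "T ` V \<subseteq> W"
  shows "quot_trace scale V W T = 0"
proof -
  obtain Bw Bv where B: "adapted_basis V W Bw Bv" using adapted_basis_exists[OF S W] .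
  have "Bv \<subseteq> V" using B span_base by (auto simp: adapted_basis_def)
  then have "diag_sum Bw Bv T = 0"
    unfolding diag_sum_def using TW representation_quot(3)[OF B] by (intro sum.neutral) blast
  then show ?thesis using quot_trace_eq_diag_sum[OF B T] by simp
qed

text \<open>A multiple of an idempotent has trace a nonzero multiple of its rank.\<close>
lemma quasi_idempotent_quot_trace_0:
  assumes S: "finite S" "V = span S" and W: "subspace W" "W \<subseteq> V"
    and T: "quot_endo V W T" and idem: "\<And>v. v \<in> V \<Longrightarrow> T (T v) = k *s T v" and k: "k \<noteq> 0"
    and char0: "\<And>n. of_nat n = (0::'a) \<Longrightarrow> n = 0" and tr: "quot_trace scale V W T = 0"
  shows "T ` V \<subseteq> W"
proof -
  have Tadd: "T (x + y) = T x + T y" and Tsc: "T (c *s x) = c *s T x" and TV: "x \<in> V \<Longrightarrow> T x \<in> V" and TW: "x \<in> W \<Longrightarrow> T x \<in> W" for x y c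
    using T by (auto simp: quot_endo_def)
  have V: "subspace V" using S by simp
  \<comment> \<open>The preimage of the image of \<open>T\<close> on the quotient. \<open>T\<close>
    maps \<open>V\<close> into \<open>U\<close> and acts on \<open>U\<close> modulo \<open>W\<close>
    as the scalar \<open>k\<close>, so in a basis adapted to \<open>W\<close>, \<open>U\<close>,
    \<open>V\<close> the trace is \<open>k\<close> times the dimension of \<open>U\<close> modulo
    \<open>W\<close>.\<close>
  define U where "U = {w + T v | w v. w \<in> W \<and> v \<in> V}"
  have T0: "T 0 = 0" using Tsc[of 0 0] by simp
  have WU: "W \<subseteq> U"
  proof
    fix w assume "w \<in> W"
    then show "w \<in> U" unfolding U_def using subspace_0[OF V] T0
      by (intro CollectI exI[of _ w] exI[of _ 0]) simp
  qed
  have TU: "T v \<in> U" if "v \<in> V" for v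
    unfolding U_def using that subspace_0[OF W(1)] by (intro CollectI exI[of _ 0] exI[of _ v]) simp
  have UV: "U \<subseteq> V" using W(2) TV V by (auto simp: U_def intro!: subspace_add)
  have "subspace U" unfolding subspace_def
  proof (intro conjI ballI allI)
    show "0 \<in> U" using WU subspace_0[OF W(1)] by blast
    fix x assume "x \<in> U"
    then obtain w v where x: "x = w + T v" "w \<in> W" "v \<in> V" by (auto simp: U_def)
    show "c *s x \<in> U" for c
      unfolding U_def using x W(1) V
      by (intro CollectI exI[of _ "c *s w"] exI[of _ "c *s v"]) (simp add: Tsc scale_right_distrib subspace_scale)
    fix y assume "y \<in> U"
    then obtain w' v' where y: "y = w' + T v'" "w' \<in> W" "v' \<in> V" by (auto simp: U_def)
    show "x + y \<in> U"
      unfolding U_def using x y W(1) V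
      by (intro CollectI exI[of _ "w + w'"] exI[of _ "v + v'"]) (simp add: Tadd algebra_simps subspace_add)
  qed
  from adapted_basis_chain[OF S W(1) WU this UV]
  obtain Bw B1 B2 where B: "adapted_basis V W Bw (B1 \<union> B2)" and B1: "adapted_basis U W Bw B1" and dis: "B1 \<inter> B2 = {}" .
  let ?R = "representation (Bw \<union> (B1 \<union> B2))"
  have ind: "independent (Bw \<union> (B1 \<union> B2))" and fin: "finite (Bw \<union> (B1 \<union> B2))" and disw: "Bw \<inter> (B1 \<union> B2) = {}"
    and Vsp: "V = span (Bw \<union> (B1 \<union> B2))"
    using B by (auto simp: adapted_basis_def)
  have Usp: "U = span (Bw \<union> B1)" using B1 by (simp add: adapted_basis_def)
  have d1: "?R (T b) b = k" if b: "b \<in> B1" for b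
  proof -
    have bU: "b \<in> U" using b Usp span_base by blast
    then obtain w v where x: "b = w + T v" "w \<in> W" "v \<in> V" by (auto simp: U_def)
    have "T b = T w + k *s T v" using x idem Tadd by simp
    also have "\<dots> = k *s b + (T w - k *s w)" using x by (simp add: scale_right_distrib)
    finally have Tb: "T b = k *s b + (T w - k *s w)" .
    have inW: "T w - k *s w \<in> W" using x TW W(1) by (simp add: subspace_diff subspace_scale)
    have bv: "b \<in> B1 \<union> B2" and bV: "b \<in> V" using b bU UV by auto
    have "?R (T b) b = k * ?R b b + 0"
      unfolding Tb using representation_quot[OF B bv] bV inW W(2) V by (simp add: subspace_scale subset_iff)
    then show ?thesis using representation_basis[OF ind, of b] b by simp
  qed
  have d2: "?R (T b) b = 0" if b: "b \<in> B2" for b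
  proof -
    have "b \<in> V" unfolding Vsp using b by (intro span_base) blast
    then have "T b \<in> span (Bw \<union> B1)" using TU Usp by blast
    then have "?R (T b) = representation (Bw \<union> B1) (T b)"
      by (intro representation_extend[OF ind]) auto
    then show ?thesis using representation_ne_zero[of "Bw \<union> B1" "T b" b] b disw dis by auto
  qed
  have "diag_sum Bw (B1 \<union> B2) T = (\<Sum>b\<in>B1. ?R (T b) b) + (\<Sum>b\<in>B2. ?R (T b) b)"
    unfolding diag_sum_def using fin dis by (intro sum.union_disjoint) auto
  also have "\<dots> = of_nat (card B1) * k" using d1 d2 by simp
  finally have "of_nat (card B1) * k = 0" using quot_trace_eq_diag_sum[OF B T] tr by simp
  then have "card B1 = 0" using k char0 by simp
  then have "B1 = {}" using fin by simp
  then have "U = W" using B1 by (auto simp: adapted_basis_def)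
  then show ?thesis using TU by blast
qed

end

section \<open>Multilinear polynomials and words\<close>

lemma lookup_poly_scale [simp]: "Poly_Mapping.lookup (poly_scale c p) w = c * Poly_Mapping.lookup p w"
  by (simp add: poly_scale_def Poly_Mapping.map.rep_eq when_def)

lemma vector_space_poly_scale: "vector_space (poly_scale :: 'f::field \<Rightarrow> 'f ncpoly \<Rightarrow> _)"
  by unfold_locales (auto intro!: poly_mapping_eqI simp: lookup_add algebra_simps)

interpretation nc: vector_space "poly_scale :: 'f::field \<Rightarrow> 'f ncpoly \<Rightarrow> _"
  by (rule vector_space_poly_scale)

lemma poly_scale_single [simp]: "poly_scale c (Poly_Mapping.single w b) = Poly_Mapping.single w (c * b)"
  by (rule poly_mapping_eqI) (auto simp: lookup_single when_def)

lemma poly_eq_sum_single: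
  fixes p :: "'b \<Rightarrow>\<^sub>0 'c::comm_monoid_add"
  assumes "finite A" "Poly_Mapping.keys p \<subseteq> A"
  shows "p = (\<Sum>w\<in>A. Poly_Mapping.single w (Poly_Mapping.lookup p w))"
proof (rule poly_mapping_eqI)
  fix k
  have "(\<Sum>w\<in>A. if w = k then Poly_Mapping.lookup p w else 0) = Poly_Mapping.lookup p k"
    using assms by (auto simp: in_keys_iff)
  then show "Poly_Mapping.lookup p k = Poly_Mapping.lookup (\<Sum>w\<in>A. Poly_Mapping.single w (Poly_Mapping.lookup p w)) k"
    by (simp add: lookup_sum lookup_single when_def)
qed

definition rename :: "(kind \<Rightarrow> nat \<Rightarrow> nat) \<Rightarrow> var list \<Rightarrow> var list" where
  "rename g = map (\<lambda>(k, j). (k, g k j))"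

lemma act_poly_eq_sum:
  assumes "finite A" "Poly_Mapping.keys p \<subseteq> A"
  shows "act_poly g p = (\<Sum>w\<in>A. Poly_Mapping.single (rename g w) (Poly_Mapping.lookup p w))"
  unfolding act_poly_def rename_def using assms
  by (intro sum.mono_neutral_left) (auto simp: in_keys_iff)

lemma act_poly_add: "act_poly g (p + q) = act_poly g p + act_poly g (q :: 'f::field ncpoly)"
proof -
  let ?A = "Poly_Mapping.keys p \<union> Poly_Mapping.keys q"
  have "Poly_Mapping.keys (p + q) \<subseteq> ?A" by (rule keys_add)
  then show ?thesis
    by (simp add: act_poly_eq_sum[of ?A] lookup_add single_add sum.distrib)
qed

lemma act_poly_scale: "act_poly g (poly_scale c p) = poly_scale c (act_poly g p)"
proof -
  have "Poly_Mapping.keys (poly_scale c p) \<subseteq> Poly_Mapping.keys p" by (auto simp: in_keys_iff)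
  then show ?thesis
    by (simp add: act_poly_eq_sum[of "Poly_Mapping.keys p"] nc.scale_sum_right)
qed

lemma act_poly_single [simp]: "act_poly g (Poly_Mapping.single w c) = Poly_Mapping.single (rename g w) c"
  by (subst act_poly_eq_sum[of "{w}"]) auto

lemma act_poly_sum: "act_poly g (\<Sum>i\<in>I. f i) = (\<Sum>i\<in>I. act_poly g (f i :: 'f::field ncpoly))"
proof (induction I rule: infinite_finite_induct)
  case (insert x F)
  then show ?case by (simp add: act_poly_add)
qed (simp_all add: act_poly_def)

lemma rename_rename: "rename g (rename h w) = rename (\<lambda>k. g k \<circ> h k) w"
  by (auto simp: rename_def)

lemma act_poly_act_poly: "act_poly g (act_poly h p) = act_poly (\<lambda>k. g k \<circ> h k) (p :: 'f::field ncpoly)"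
proof -
  have "act_poly g (act_poly h p) = act_poly g (\<Sum>w\<in>Poly_Mapping.keys p. Poly_Mapping.single (rename h w) (Poly_Mapping.lookup p w))"
    by (simp add: act_poly_eq_sum[of "Poly_Mapping.keys p" p h])
  also have "\<dots> = act_poly (\<lambda>k. g k \<circ> h k) p"
    by (simp add: act_poly_sum act_poly_eq_sum[of "Poly_Mapping.keys p" p "\<lambda>k. g k \<circ> h k"] rename_rename)
  finally show ?thesis .
qed

lemma finite_ml_words: "finite (ml_words n)"
proof -
  let ?A = "{(k, j). 1 \<le> j \<and> j \<le> n k}"
  have "?A = (SIGMA k:UNIV. {1..n k})" by auto
  then have A: "finite ?A" by (simp add: finite_SigmaI)
  have "ml_words n \<subseteq> {w. set w \<subseteq> ?A \<and> length w \<le> card ?A}"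
    by (auto simp: ml_words_def) (metis (no_types, lifting) distinct_card le_refl)
  then show ?thesis by (rule finite_subset) (rule finite_lists_length_le[OF A])
qed

lemma rename_ml_words:
  assumes g: "g \<in> group_G n" and w: "w \<in> ml_words n"
  shows "rename g w \<in> ml_words n"
proof -
  have gp: "g k permutes {1..n k}" for k using g by (simp add: group_G_def)
  let ?h = "\<lambda>(k, j). (k, g k j)"
  have inj: "inj_on ?h S" for S using permutes_inj[OF gp] by (auto simp: inj_on_def dest: injD)
  have "?h ` {(k, j). 1 \<le> j \<and> j \<le> n k} = {(k, j). 1 \<le> j \<and> j \<le> n k}"
  proof (intro equalityI subsetI)
    fix x assume "x \<in> ?h ` {(k, j). 1 \<le> j \<and> j \<le> n k}"
    then obtain k j where "x = (k, g k j)" "j \<in> {1..n k}" by auto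
    then show "x \<in> {(k, j). 1 \<le> j \<and> j \<le> n k}" using permutes_in_image[OF gp[of k], of j] by auto
  next
    fix x assume "x \<in> {(k, j). 1 \<le> j \<and> j \<le> n k}"
    then obtain k j where x: "x = (k, j)" "j \<in> {1..n k}" by auto
    then have "inv (g k) j \<in> {1..n k}" using permutes_in_image[OF permutes_inv[OF gp[of k]], of j] by blast
    then show "x \<in> ?h ` {(k, j). 1 \<le> j \<and> j \<le> n k}"
      using x permutes_inverses(1)[OF gp] by (intro image_eqI[of _ _ "(k, inv (g k) j)"]) auto
  qed
  then show ?thesis using w inj unfolding ml_words_def rename_def by (simp add: distinct_map)
qed

lemma P_space_eq_span: "P_space n = nc.span ((\<lambda>w. Poly_Mapping.single w (1 :: 'f::field)) ` ml_words n)"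
proof (intro equalityI subsetI)
  fix p :: "'f ncpoly" assume "p \<in> P_space n"
  then have "p = (\<Sum>w\<in>ml_words n. Poly_Mapping.single w (Poly_Mapping.lookup p w))"
    using finite_ml_words by (intro poly_eq_sum_single) (auto simp: P_space_def)
  also have "\<dots> = (\<Sum>w\<in>ml_words n. poly_scale (Poly_Mapping.lookup p w) (Poly_Mapping.single w 1))" by simp
  also have "\<dots> \<in> nc.span ((\<lambda>w. Poly_Mapping.single w 1) ` ml_words n)"
    by (intro nc.span_sum nc.span_scale nc.span_base imageI)
  finally show "p \<in> nc.span ((\<lambda>w. Poly_Mapping.single w 1) ` ml_words n)" .
next
  fix p :: "'f ncpoly" assume "p \<in> nc.span ((\<lambda>w. Poly_Mapping.single w 1) ` ml_words n)"
  then show "p \<in> P_space n"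
  proof (induction rule: nc.span_induct_alt)
    case base
    show ?case by (simp add: P_space_def)
  next
    case (step c x y)
    have "Poly_Mapping.keys (poly_scale c x + y) \<subseteq> Poly_Mapping.keys x \<union> Poly_Mapping.keys y"
      using keys_add[of "poly_scale c x" y] by (auto simp: in_keys_iff)
    then show ?case using step by (auto simp: P_space_def split: if_splits)
  qed
qed

lemma act_poly_P_space:
  assumes "g \<in> group_G n" "p \<in> P_space n"
  shows "act_poly g (p :: 'f::field ncpoly) \<in> P_space n"
proof -
  have "Poly_Mapping.keys (act_poly g p) \<subseteq> rename g ` ml_words n"
    unfolding act_poly_eq_sum[OF finite_ml_words assms(2)[unfolded P_space_def mem_Collect_eq]]
    by (rule order.trans[OF keys_sum]) (auto split: if_splits)
  then show ?thesis using rename_ml_words[OF assms(1)] by (auto simp: P_space_def)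
qed

text \<open>Interleaves blocks with \<open>N\<close> marked letters, each block \<open>X j\<close>
  standing before its letter \<open>y j\<close>. Indices start at 1, and the trailing block
  \<open>X (N + 1)\<close> is appended separately, as in \<open>amitsur_word\<close>.\<close>

definition slots :: "nat \<Rightarrow> (nat \<Rightarrow> 'a list) \<Rightarrow> (nat \<Rightarrow> 'a) \<Rightarrow> 'a list" where
  "slots N X y = concat (map (\<lambda>j. X j @ [y j]) [1..<N + 1])"

lemma slots_0 [simp]: "slots 0 X y = []" by (simp add: slots_def)

lemma slots_Suc [simp]: "slots (Suc N) X y = slots N X y @ X (Suc N) @ [y (Suc N)]"
  by (simp add: slots_def)

lemma slots_cong:
  "(\<And>j. 1 \<le> j \<Longrightarrow> j \<le> N \<Longrightarrow> X j = X' j) \<Longrightarrow> (\<And>j. 1 \<le> j \<Longrightarrow> j \<le> N \<Longrightarrow> y j = y' j) \<Longrightarrow> slots N X y = slots N X' y'"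
  by (induction N) auto

lemma map_slots: "map f (slots N X y) = slots N (\<lambda>j. map f (X j)) (\<lambda>j. f (y j))"
  by (induction N) auto

lemma rename_slots: "rename g (slots N X y) = slots N (\<lambda>j. rename g (X j)) (\<lambda>j. (\<lambda>(k, j). (k, g k j)) (y j))"
  unfolding rename_def by (rule map_slots)

lemma set_slots: "set (slots N X y) = (\<Union>j\<in>{1..N}. set (X j)) \<union> y ` {1..N}"
  by (induction N) (auto simp: atLeastAtMostSuc_conv)

lemma exists_slots:
  "\<exists>u. w = slots (length (filter Q w)) u (\<lambda>j. filter Q w ! (j - 1)) @ u (length (filter Q w) + 1)
     \<and> (\<forall>j. \<forall>v\<in>set (u j). v \<in> set w \<and> \<not> Q v)"
proof (induction w rule: rev_induct)
  case Nil
  show ?case by (intro exI[of _ "\<lambda>_. []"]) simp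
next
  case (snoc v w)
  then obtain u where u: "w = slots (length (filter Q w)) u (\<lambda>j. filter Q w ! (j - 1)) @ u (length (filter Q w) + 1)"
    "\<forall>j. \<forall>v\<in>set (u j). v \<in> set w \<and> \<not> Q v" by blast
  let ?N = "length (filter Q w)"
  show ?case
  proof (cases "Q v")
    case True
    \<comment> \<open>The former trailing block \<open>u (?N + 1)\<close> now precedes the new
      marked letter, so the trailing block has index \<open>?N + 2\<close> and is empty.\<close>
    let ?u = "u(?N + 2 := [])"
    have "slots ?N ?u (\<lambda>j. (filter Q w @ [v]) ! (j - 1)) = slots ?N u (\<lambda>j. filter Q w ! (j - 1))"
      by (intro slots_cong) (auto simp: nth_append)
    then have 1: "w @ [v] = slots (Suc ?N) ?u (\<lambda>j. (filter Q w @ [v]) ! (j - 1)) @ ?u (Suc ?N + 1)"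
      using u(1) by (simp del: fun_upd_apply add: fun_upd_same fun_upd_other)
    have F: "filter Q (w @ [v]) = filter Q w @ [v]" "length (filter Q w @ [v]) = Suc ?N" using True by simp_all
    have 2: "\<forall>j. \<forall>x\<in>set (?u j). x \<in> set (w @ [v]) \<and> \<not> Q x" using u(2) by auto
    show ?thesis unfolding F by (rule exI[of _ ?u], rule conjI, rule 1, rule 2)
  next
    case False
    let ?u = "u(?N + 1 := u (?N + 1) @ [v])"
    have "slots ?N ?u (\<lambda>j. filter Q w ! (j - 1)) = slots ?N u (\<lambda>j. filter Q w ! (j - 1))"
      by (intro slots_cong) auto
    then have 1: "w @ [v] = slots ?N ?u (\<lambda>j. filter Q w ! (j - 1)) @ ?u (?N + 1)"
      using u(1) by (simp del: fun_upd_apply add: fun_upd_same fun_upd_other)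
    have F: "filter Q (w @ [v]) = filter Q w" using False by simp
    have 2: "\<forall>j. \<forall>x\<in>set (?u j). x \<in> set (w @ [v]) \<and> \<not> Q x" using u(2) False by auto
    show ?thesis unfolding F by (rule exI[of _ ?u], rule conjI, rule 1, rule 2)
  qed
qed

section \<open>Products of words and substitution of blocks\<close>

lemma wprod_Cons: "w \<noteq> [] \<Longrightarrow> wprod (a # w) = a * wprod w"
  by (cases w) auto

lemma wprod_append: "u \<noteq> [] \<Longrightarrow> v \<noteq> [] \<Longrightarrow> wprod (u @ v) = wprod u * wprod v"
  by (induction u rule: wprod.induct) (auto simp: wprod_Cons mult.assoc)

text \<open>The empty word has product 0 rather than 1, so equality of products alone is not
  preserved by concatenation; emptiness is recorded as well.\<close>

definition wprod_eqv :: "'a::ring list \<Rightarrow> 'a list \<Rightarrow> bool" where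
  "wprod_eqv u v \<longleftrightarrow> (u = [] \<longleftrightarrow> v = []) \<and> wprod u = wprod v"

lemma wprod_eqv_append: "wprod_eqv u u' \<Longrightarrow> wprod_eqv v v' \<Longrightarrow> wprod_eqv (u @ v) (u' @ v')"
  unfolding wprod_eqv_def by (cases "u = []"; cases "v = []") (auto simp: wprod_append)

lemma wprod_eqv_slots:
  assumes "\<And>j. 1 \<le> j \<Longrightarrow> j \<le> N + 1 \<Longrightarrow> wprod_eqv (X j) (X' j)"
  shows "wprod_eqv (slots N X y @ X (N + 1)) (slots N X' y @ X' (N + 1))"
proof -
  have "wprod_eqv (slots M X y) (slots M X' y)" if "M \<le> N" for M
    using that
  proof (induction M)
    case (Suc M)
    then show ?case using assms[of "Suc M"]
      unfolding slots_Suc by (intro wprod_eqv_append) (auto simp: wprod_eqv_def)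
  qed (simp add: wprod_eqv_def)
  then show ?thesis using assms[of "N + 1"] by (intro wprod_eqv_append) auto
qed

lemma wprod_sum_middle:
  assumes "finite I"
  shows "wprod (u @ [\<Sum>i\<in>I. f i] @ v) = (\<Sum>i\<in>I. wprod (u @ [f i] @ (v :: 'a::ring list)))"
proof -
  have 1: "wprod ([z] @ v) = (if v = [] then z else z * wprod v)" for z :: 'a
    by (simp add: wprod_Cons)
  have 2: "wprod (u @ [z] @ v) = (if u = [] then wprod ([z] @ v) else wprod u * wprod ([z] @ v))" for z :: 'a
    by (simp add: wprod_append)
  show ?thesis unfolding 2 1 by (auto simp: sum_distrib_left sum_distrib_right)
qed

text \<open>The context \<open>a\<close>, \<open>b\<close> is the same for all contents
  \<open>x\<close> of the block, which makes additivity in a single block accessible.\<close>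

lemma slots_split:
  assumes "1 \<le> i" "i \<le> N + 1"
  shows "\<exists>a b. \<forall>x. slots N (X(i := x)) y @ (X(i := x)) (N + 1) = a @ x @ b"
proof -
  have *: "\<exists>a b. \<forall>x. slots M (X(i := x)) y = a @ x @ b" if "i \<le> M" for M
    using that
  proof (induction M)
    case (Suc M)
    show ?case
    proof (cases "i = Suc M")
      case True
      have "slots M (X(i := x)) y = slots M X y" for x using True by (intro slots_cong) auto
      then show ?thesis using True by (intro exI[of _ "slots M X y"] exI[of _ "[y (Suc M)]"]) (simp del: fun_upd_apply add: fun_upd_same fun_upd_other)
    next
      case False
      then have "i \<le> M" using Suc.prems by simp
      from Suc.IH[OF this] obtain a b where "\<forall>x. slots M (X(i := x)) y = a @ x @ b" by blast
      then show ?thesis using False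
        by (intro exI[of _ a] exI[of _ "b @ X (Suc M) @ [y (Suc M)]"]) (simp del: fun_upd_apply add: fun_upd_same fun_upd_other)
    qed
  qed (use assms in simp)
  show ?thesis
  proof (cases "i = N + 1")
    case True
    have "slots N (X(i := x)) y = slots N X y" for x using True by (intro slots_cong) auto
    then show ?thesis using True by (intro exI[of _ "slots N X y"] exI[of _ "[]"]) (simp del: fun_upd_apply add: fun_upd_same fun_upd_other)
  next
    case False
    then have "i \<le> N" using assms by simp
    from *[OF this] obtain a b where "\<forall>x. slots N (X(i := x)) y = a @ x @ b" by blast
    then show ?thesis using False by (intro exI[of _ a] exI[of _ "b @ X (N + 1)"]) (simp del: fun_upd_apply add: fun_upd_same fun_upd_other)
  qed
qed

section \<open>Amitsur words and the action of permutations of one kind\<close>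

lemma amitsur_word_eq_slots:
  "amitsur_word d l k c s = slots (kk d l k) (xvar d l c) (\<lambda>j. (k, s j)) @ xvar d l c (kk d l k + 1)"
  by (simp add: amitsur_word_def slots_def)

text \<open>The variables in the blocks have indices above \<open>kk d l k'\<close> and distinct
  offsets, so they meet neither each other nor the alternated variables, whose indices are at most
  \<open>kk d l k\<close>.\<close>

lemma distinct_amitsur_word: "distinct (amitsur_word d l k c id)"
proof -
  let ?K = "kk d l k"
  have x: "set (xvar d l c j) \<subseteq> {(k', kk d l k' + j) |k'. True}" "distinct (xvar d l c j)" for j
    by (auto simp: xvar_def split: option.splits)
  have "distinct (slots N (xvar d l c) (\<lambda>j. (k, id j)))" if "N \<le> ?K" for N
    using that
  proof (induction N)
    case (Suc N)
    have "set (slots N (xvar d l c) (\<lambda>j. (k, id j))) \<subseteq> {(k', kk d l k' + j) |k' j. 1 \<le> j \<and> j \<le> N} \<union> {(k, j) |j. j \<le> N}"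
      unfolding set_slots using x(1) by fastforce
    then show ?case using Suc x(1)[of "Suc N"] x(2) by fastforce
  qed simp
  moreover have "set (slots ?K (xvar d l c) (\<lambda>j. (k, id j))) \<subseteq> {(k', kk d l k' + j) |k' j. 1 \<le> j \<and> j \<le> ?K} \<union> {(k, j) |j. j \<le> ?K}"
    unfolding set_slots using x(1) by fastforce
  ultimately show ?thesis unfolding amitsur_word_eq_slots using x(1)[of "?K + 1"] x(2) by fastforce
qed

definition at_kind :: "kind \<Rightarrow> (nat \<Rightarrow> nat) \<Rightarrow> kind \<Rightarrow> nat \<Rightarrow> nat" where
  "at_kind k s = (\<lambda>k'. if k' = k then s else id)"

lemma at_kind_comp: "(\<lambda>k'. at_kind k s k' \<circ> at_kind k t k') = at_kind k (s \<circ> t)"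
  by (auto simp: at_kind_def)

lemma at_kind_group: "s permutes {1..K} \<Longrightarrow> K \<le> n k \<Longrightarrow> at_kind k s \<in> group_G n"
  by (auto simp: at_kind_def group_G_def permutes_id intro: permutes_subset)

lemma rename_xvar:
  assumes "s permutes {1..kk d l k}" "1 \<le> j"
  shows "rename (at_kind k s) (xvar d l c j) = xvar d l c j"
proof -
  have "s (kk d l k + j) = kk d l k + j" using assms by (intro permutes_not_in[OF assms(1)]) auto
  then show ?thesis by (auto simp: rename_def xvar_def at_kind_def split: option.splits)
qed

lemma amitsur_word_rename:
  assumes "s permutes {1..kk d l k}"
  shows "amitsur_word d l k c s = rename (at_kind k s) (amitsur_word d l k c id)"
proof -
  have "rename (at_kind k s) (slots (kk d l k) (xvar d l c) (\<lambda>j. (k, id j)))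
     = slots (kk d l k) (xvar d l c) (\<lambda>j. (k, s j))"
    unfolding rename_slots using rename_xvar[OF assms] by (intro slots_cong) (auto simp: at_kind_def)
  moreover have "rename g (u @ v) = rename g u @ rename g v" for g u v by (simp add: rename_def)
  ultimately show ?thesis unfolding amitsur_word_eq_slots using rename_xvar[OF assms] by simp
qed

section \<open>The cocharacter and the Amitsur polynomials\<close>

lemma finite_multipartitions: "finite (multipartitions n)"
proof -
  have *: "{lam. is_partition lam N} \<subseteq> {xs. set xs \<subseteq> {0..N} \<and> length xs \<le> N}" for N
  proof safe
    fix xs x assume xs: "is_partition xs N"
    show "x \<in> {0..N}" if "x \<in> set xs" using member_le_sum_list[OF that] xs by (auto simp: is_partition_def)
    have "length xs \<le> sum_list xs" if "\<forall>x\<in>set xs. 0 < x" for xs :: "nat list"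
      using that by (induction xs) auto
    then show "length xs \<le> N" using xs by (auto simp: is_partition_def)
  qed
  have "finite {lam. is_partition lam N}" for N
    by (rule finite_subset[OF * finite_lists_length_le]) simp
  then have "finite (PiE UNIV (\<lambda>k. {lam. is_partition lam (n k)}))" by (intro finite_PiE) auto
  moreover have "multipartitions n = PiE UNIV (\<lambda>k. {lam. is_partition lam (n k)})"
    by (auto simp: multipartitions_def PiE_iff)
  ultimately show ?thesis by simp
qed

text \<open>The factor that a product character contributes on the three kinds where
  \<open>at_kind\<close> acts trivially. It is positive, hence does not affect the sign of a summand
  of the trace.\<close>

definition other_degrees :: "kind \<Rightarrow> (kind \<Rightarrow> nat list) \<Rightarrow> int" where
  "other_degrees k lam = (\<Prod>k'\<in>UNIV - {k}. irr_char (lam k') id)"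

lemma other_degrees_pos: "lam \<in> multipartitions n \<Longrightarrow> 0 < other_degrees k lam"
  unfolding other_degrees_def multipartitions_def by (intro prod_pos) (auto intro: irr_char_id_pos)

lemma prod_irr_char_at_kind:
  "(\<Prod>k'\<in>UNIV. irr_char (lam k') (at_kind k s k')) = irr_char (lam k) s * other_degrees k lam"
proof -
  have "(\<Prod>k'\<in>UNIV. irr_char (lam k') (at_kind k s k'))
    = irr_char (lam k) s * (\<Prod>k'\<in>UNIV - {k}. irr_char (lam k') (at_kind k s k'))"
    by (subst prod.remove[of _ k]) (auto simp: at_kind_def)
  also have "(\<Prod>k'\<in>UNIV - {k}. irr_char (lam k') (at_kind k s k')) = other_degrees k lam"
    unfolding other_degrees_def by (intro prod.cong) (auto simp: at_kind_def)
  finally show ?thesis .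
qed

lemma sum_kind: "(\<Sum>k\<in>UNIV. f k) = f Y0 + f Z0 + f Y1 + (f Z1 :: 'b::comm_monoid_add)"
  by (simp add: UNIV_kind add.assoc)

text \<open>Collects what superinvolutions and graded involutions share, so that both cases are
  treated at once.\<close>

locale sharp_superalgebra =
  fixes scale :: "'f::field_char_0 \<Rightarrow> 'a::ring \<Rightarrow> 'a" and A0 A1 :: "'a set" and sharp :: "'a \<Rightarrow> 'a"
  assumes superalgebra: "is_superalgebra scale A0 A1"
    and involutive: "graded_linear_involutive scale A0 A1 sharp"
begin

sublocale M: module scale
  using superalgebra by (simp add: is_superalgebra_def)

abbreviation "ev \<equiv> eval_poly scale"
abbreviation "kspace \<equiv> kind_space A0 A1 sharp"
abbreviation "sid \<equiv> is_sid scale A0 A1 sharp"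

lemma eval_eq_sum:
  assumes "finite A" "Poly_Mapping.keys p \<subseteq> A"
  shows "ev phi p = (\<Sum>w\<in>A. scale (Poly_Mapping.lookup p w) (wprod (map phi w)))"
  unfolding eval_poly_def using assms
  by (intro sum.mono_neutral_left) (auto simp: in_keys_iff)

lemma eval_add: "ev phi (p + q) = ev phi p + ev phi q"
proof -
  let ?A = "Poly_Mapping.keys p \<union> Poly_Mapping.keys q"
  have "Poly_Mapping.keys (p + q) \<subseteq> ?A" by (rule keys_add)
  then show ?thesis
    by (simp add: eval_eq_sum[of ?A] lookup_add M.scale_left_distrib sum.distrib)
qed

lemma eval_zero: "ev phi 0 = 0" by (simp add: eval_poly_def)

lemma eval_sum: "ev phi (\<Sum>i\<in>I. f i) = (\<Sum>i\<in>I. ev phi (f i))"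
  by (induction I rule: infinite_finite_induct) (simp_all add: eval_add eval_zero)

lemma eval_single: "ev phi (Poly_Mapping.single w c) = scale c (wprod (map phi w))"
  by (subst eval_eq_sum[of "{w}"]) auto

lemma eval_scale: "ev phi (poly_scale c p) = scale c (ev phi p)"
proof -
  have "Poly_Mapping.keys (poly_scale c p) \<subseteq> Poly_Mapping.keys p" by (auto simp: in_keys_iff)
  then show ?thesis
    by (simp add: eval_eq_sum[of "Poly_Mapping.keys p"] M.scale_sum_right)
qed

lemma eval_act: "ev phi (act_poly g p) = ev (phi \<circ> (\<lambda>(k, j). (k, g k j))) p"
  by (simp add: act_poly_eq_sum[of "Poly_Mapping.keys p"] eval_eq_sum[of "Poly_Mapping.keys p" p]
      eval_sum eval_single rename_def)

lemma sharp_add: "sharp (x + y) = sharp x + sharp y"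
  and sharp_scale: "sharp (scale c x) = scale c (sharp x)"
  and sharp_sharp: "sharp (sharp x) = x"
  and sharp_even: "x \<in> A0 \<Longrightarrow> sharp x \<in> A0"
  and sharp_odd: "x \<in> A1 \<Longrightarrow> sharp x \<in> A1"
  using involutive by (simp_all add: graded_linear_involutive_def image_subset_iff)

lemma kspace_zero: "0 \<in> kspace k"
proof -
  have "0 \<in> A0" "0 \<in> A1" using superalgebra M.subspace_0 by (auto simp: is_superalgebra_def)
  moreover have "sharp 0 = 0" using sharp_add[of 0 0] by simp
  ultimately show ?thesis by (cases k) (auto simp: kind_space_def)
qed

text \<open>Each homogeneous component splits into its halves \<open>(x + sharp x) / 2\<close> and
  \<open>(x - sharp x) / 2\<close>, one symmetric and one skew.\<close>

lemma kspace_decomposition: "\<exists>f. (\<forall>k. f k \<in> kspace k) \<and> z = (\<Sum>k\<in>UNIV. f k)"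
proof -
  obtain a0 a1 where a: "a0 \<in> A0" "a1 \<in> A1" "z = a0 + a1"
    using superalgebra unfolding is_superalgebra_def by meson
  have sub: "M.subspace A0" "M.subspace A1" using superalgebra by (auto simp: is_superalgebra_def)
  have neg: "sharp (- x) = - sharp x" for x using sharp_scale[of "-1" x] by simp
  define pl mi where "pl = (\<lambda>x. scale (1/2) (x + sharp x))" and "mi = (\<lambda>x. scale (1/2) (x - sharp x))"
  have pm: "pl x + mi x = x" for x
  proof -
    have "pl x + mi x = scale (1/2) ((x + sharp x) + (x - sharp x))"
      by (simp only: pl_def mi_def M.scale_right_distrib)
    also have "(x + sharp x) + (x - sharp x) = scale 1 x + scale 1 x" by simp
    also have "\<dots> = scale 2 x" by (simp only: M.scale_left_distrib[symmetric] one_add_one)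
    finally show ?thesis by simp
  qed
  have spl: "sharp (pl x) = pl x" for x by (simp add: pl_def sharp_scale sharp_add sharp_sharp add.commute)
  have smi: "sharp (mi x) = - mi x" for x
  proof -
    have "sharp (mi x) = scale (1/2) (sharp x - x)"
      using sharp_add[of x "- sharp x"] by (simp add: mi_def sharp_scale neg sharp_sharp)
    then show ?thesis by (simp add: mi_def M.scale_minus_right[symmetric])
  qed
  have in0: "pl a0 \<in> A0" "mi a0 \<in> A0" "pl a1 \<in> A1" "mi a1 \<in> A1"
    unfolding pl_def mi_def using a sub by (auto intro!: sharp_even sharp_odd intro!: M.subspace_scale M.subspace_add M.subspace_diff)
  define f where "f = (\<lambda>k. case k of Y0 \<Rightarrow> pl a0 | Z0 \<Rightarrow> mi a0 | Y1 \<Rightarrow> pl a1 | Z1 \<Rightarrow> mi a1)"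
  have "f k \<in> kspace k" for k using in0 spl smi by (cases k) (auto simp: f_def kind_space_def)
  moreover have "z = (\<Sum>k\<in>UNIV. f k)"
    using pm[of a0] pm[of a1] a(3) by (simp add: sum_kind f_def add.assoc)
  ultimately show ?thesis by blast
qed

definition ids :: "(kind \<Rightarrow> nat) \<Rightarrow> 'f ncpoly set" where
  "ids n = {p \<in> P_space n. sid p}"

lemma subspace_P_space: "nc.subspace (P_space n :: 'f ncpoly set)"
  unfolding P_space_eq_span by simp

lemma subspace_ids: "nc.subspace (ids n)"
  unfolding nc.subspace_def
proof (intro conjI ballI allI)
  show "0 \<in> ids n" using nc.subspace_0[OF subspace_P_space] by (simp add: ids_def is_sid_def eval_zero)
  show "x + y \<in> ids n" if "x \<in> ids n" "y \<in> ids n" for x y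
    using nc.subspace_add[OF subspace_P_space] that by (auto simp: ids_def is_sid_def eval_add)
  show "poly_scale c x \<in> ids n" if "x \<in> ids n" for c x
    using nc.subspace_scale[OF subspace_P_space] that by (auto simp: ids_def is_sid_def eval_scale)
qed

lemma sid_act: "sid p \<Longrightarrow> sid (act_poly g p)"
  unfolding is_sid_def eval_act by auto

lemma quot_endo_act:
  assumes "g \<in> group_G n"
  shows "nc.quot_endo (P_space n) (ids n) (act_poly g)"
  unfolding nc.quot_endo_def ids_def
  using act_poly_add act_poly_scale act_poly_P_space[OF assms] sid_act by blast

text \<open>The action of the group algebra element \<open>sum x(s) s\<close> on the variables of
  kind \<open>k\<close> with indices up to \<open>K\<close>; all other variables are fixed.\<close>

definition lincomb :: "kind \<Rightarrow> nat \<Rightarrow> ((nat \<Rightarrow> nat) \<Rightarrow> int) \<Rightarrow> 'f ncpoly \<Rightarrow> 'f ncpoly" where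
  "lincomb k K x v = (\<Sum>s | s permutes {1..K}. poly_scale (of_int (x s)) (act_poly (at_kind k s) v))"

lemma quot_endo_lincomb:
  "K \<le> n k \<Longrightarrow> nc.quot_endo (P_space n) (ids n) (lincomb k K x)"
  unfolding lincomb_def
  using at_kind_group by (intro nc.quot_endo_sum subspace_P_space subspace_ids quot_endo_act) auto

lemma P_space_span:
  "finite ((\<lambda>w. Poly_Mapping.single w (1 :: 'f)) ` ml_words n)"
  "P_space n = nc.span ((\<lambda>w. Poly_Mapping.single w (1 :: 'f)) ` ml_words n)"
  using finite_ml_words P_space_eq_span by auto

lemma ids_subset: "ids n \<subseteq> P_space n" by (auto simp: ids_def)

lemma quot_trace_lincomb:
  assumes dec: "cochar_decomp scale A0 A1 sharp m" and K: "K \<le> n k"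
  shows "quot_trace poly_scale (P_space n) (ids n) (lincomb k K x)
    = of_int (\<Sum>lam\<in>multipartitions n. int (m lam) *
        ((\<Sum>s | s permutes {1..K}. x s * irr_char (lam k) s) * other_degrees k lam))"
proof -
  have grp: "at_kind k s \<in> group_G n" if "s permutes {1..K}" for s
    using at_kind_group[of s K n k] K that by blast
  have "quot_trace poly_scale (P_space n) (ids n) (lincomb k K x)
     = (\<Sum>s | s permutes {1..K}. of_int (x s) * cochar scale A0 A1 sharp n (at_kind k s))"
    unfolding lincomb_def cochar_def ids_def[symmetric]
    using grp
    by (intro nc.quot_trace_sum[OF P_space_span subspace_ids ids_subset] quot_endo_act finite_permutations) auto
  also have "\<dots> = (\<Sum>s | s permutes {1..K}. \<Sum>lam\<in>multipartitions n.
        of_int (int (m lam) * (x s * irr_char (lam k) s * other_degrees k lam)))"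
  proof (intro sum.cong refl)
    fix s assume "s \<in> {s. s permutes {1..K}}"
    then have "at_kind k s \<in> group_G n" using grp by simp
    then have "cochar scale A0 A1 sharp n (at_kind k s)
      = (\<Sum>lam\<in>multipartitions n. of_nat (m lam) * of_int (irr_char (lam k) s * other_degrees k lam))"
      using dec unfolding cochar_decomp_def by (simp only: prod_irr_char_at_kind[symmetric])
    then show "of_int (x s) * cochar scale A0 A1 sharp n (at_kind k s) = (\<Sum>lam\<in>multipartitions n.
        of_int (int (m lam) * (x s * irr_char (lam k) s * other_degrees k lam)))"
      by (simp add: sum_distrib_left mult_ac)
  qed
  also have "\<dots> = of_int (\<Sum>lam\<in>multipartitions n. \<Sum>s | s permutes {1..K}.
        int (m lam) * (x s * irr_char (lam k) s * other_degrees k lam))"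
    unfolding of_int_sum by (rule sum.swap)
  also have "\<dots> = of_int (\<Sum>lam\<in>multipartitions n. int (m lam) *
        ((\<Sum>s | s permutes {1..K}. x s * irr_char (lam k) s) * other_degrees k lam))"
    by (simp only: sum_distrib_left sum_distrib_right)
  finally show ?thesis .
qed

section \<open>Amitsur identities evaluated on arbitrary blocks\<close>

lemma amitsur_poly_eq_lincomb:
  "amitsur_poly d l k c = lincomb k (kk d l k) (irr_char (replicate (d k + 1) (l k + 1)))
     (Poly_Mapping.single (amitsur_word d l k c id) 1)"
  unfolding amitsur_poly_def lincomb_def
proof (intro sum.cong refl)
  fix s assume "s \<in> {s. s permutes {1..kk d l k}}"
  then have "amitsur_word d l k c s = rename (at_kind k s) (amitsur_word d l k c id)"
    by (intro amitsur_word_rename) simp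
  then show "Poly_Mapping.single (amitsur_word d l k c s) (of_int (irr_char (replicate (d k + 1) (l k + 1)) s))
    = poly_scale (of_int (irr_char (replicate (d k + 1) (l k + 1)) s))
        (act_poly (at_kind k s) (Poly_Mapping.single (amitsur_word d l k c id) 1))"
    by (simp only: act_poly_single poly_scale_single mult_1_right)
qed

lemma eval_lincomb_single:
  "ev phi (lincomb k K x (Poly_Mapping.single w 1))
    = (\<Sum>s | s permutes {1..K}. scale (of_int (x s)) (wprod (map phi (rename (at_kind k s) w))))"
  by (simp add: lincomb_def eval_sum eval_scale eval_single)

text \<open>The blocks are arbitrary lists of ring elements. An Amitsur identity directly yields
  only blocks that are empty or a single element of some \<open>kspace k'\<close>; the next three
  lemmas remove this restriction.\<close>

abbreviation amitsur_value :: "(kind \<Rightarrow> nat) \<Rightarrow> (kind \<Rightarrow> nat) \<Rightarrow> kind \<Rightarrow> (nat \<Rightarrow> 'a list) \<Rightarrow> (nat \<Rightarrow> 'a) \<Rightarrow> 'a" where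
  "amitsur_value d l k X y \<equiv> \<Sum>s | s permutes {1..kk d l k}.
     scale (of_int (irr_char (replicate (d k + 1) (l k + 1)) s))
       (wprod (slots (kk d l k) X (\<lambda>j. y (s j)) @ X (kk d l k + 1)))"

lemma amitsur_values_graded:
  assumes sat: "satisfies_amitsur scale A0 A1 sharp d l"
    and y: "\<And>i. y i \<in> kspace k" and X: "\<And>j. X j = [] \<or> (\<exists>k' z. z \<in> kspace k' \<and> X j = [z])"
  shows "amitsur_value d l k X y = 0"
proof -
  let ?K = "kk d l k"
  have "\<exists>cj. (X j = [] \<and> cj = None) \<or> (\<exists>k' z. cj = Some k' \<and> z \<in> kspace k' \<and> X j = [z])" for j
    using X[of j] by blast
  then obtain c where c: "\<And>j. (X j = [] \<and> c j = None) \<or> (\<exists>k' z. c j = Some k' \<and> z \<in> kspace k' \<and> X j = [z])"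
    by metis
  \<comment> \<open>Inverts the index shift of \<open>xvar\<close>. Truncated subtraction sends
    small indices of other kinds to block 0, which occurs in no word; the hypothesis on
    \<open>X\<close> includes \<open>j = 0\<close> so that the value assigned there still lies in
    the right space.\<close>
  define phi where "phi = (\<lambda>(k', i). if k' = k \<and> i \<le> ?K then y i
      else if c (i - kk d l k') = Some k' then hd (X (i - kk d l k')) else 0)"
  have phi: "phi (k', i) \<in> kspace k'" for k' i
    using y kspace_zero c[of "i - kk d l k'"] by (auto simp: phi_def)
  have x: "map phi (xvar d l c j) = X j" if "1 \<le> j" for j
    using c[of j] that by (auto simp: xvar_def phi_def)
  have "sid (amitsur_poly d l k c)" using sat by (simp add: satisfies_amitsur_def)
  then have "ev phi (amitsur_poly d l k c) = 0" using phi by (simp add: is_sid_def)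
  moreover have "map phi (rename (at_kind k s) (amitsur_word d l k c id)) = slots ?K X (\<lambda>j. y (s j)) @ X (?K + 1)"
    if "s permutes {1..?K}" for s
  proof -
    have "s j \<le> ?K" if "1 \<le> j" "j \<le> ?K" for j
      using permutes_in_image[OF \<open>s permutes _\<close>, of j] that by simp
    then have "map phi (slots ?K (xvar d l c) (\<lambda>j. (k, s j))) = slots ?K X (\<lambda>j. y (s j))"
      unfolding map_slots using x by (intro slots_cong) (auto simp: phi_def)
    moreover have "rename (at_kind k s) (amitsur_word d l k c id)
       = slots ?K (xvar d l c) (\<lambda>j. (k, s j)) @ xvar d l c (?K + 1)"
      by (rule trans[OF amitsur_word_rename[OF that, symmetric] amitsur_word_eq_slots])
    ultimately show ?thesis using x[of "?K + 1"] by simp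
  qed
  ultimately show ?thesis unfolding amitsur_poly_eq_lincomb eval_lincomb_single by simp
qed

text \<open>The number \<open>J\<close> bounds the blocks that may still be inhomogeneous. Block
  \<open>J\<close> is replaced by its four symmetric and skew graded components, and additivity in
  that block reduces the bound by one.\<close>

lemma amitsur_values_singletons:
  assumes sat: "satisfies_amitsur scale A0 A1 sharp d l"
    and y: "\<And>i. y i \<in> kspace k" and X: "\<And>j. X j = [] \<or> (\<exists>z. X j = [z])"
    and J: "\<And>j. j = 0 \<or> J < j \<Longrightarrow> X j = [] \<or> (\<exists>k' z. z \<in> kspace k' \<and> X j = [z])"
    and JK: "J \<le> kk d l k + 1"
  shows "amitsur_value d l k X y = 0"
  using X J JK
proof (induction J arbitrary: X)
  case 0
  show ?case
  proof (rule amitsur_values_graded[OF sat y])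
    show "X j = [] \<or> (\<exists>k' z. z \<in> kspace k' \<and> X j = [z])" for j using 0(2)[of j] by blast
  qed
next
  case (Suc J)
  let ?K = "kk d l k" and ?chi = "irr_char (replicate (d k + 1) (l k + 1))"
  show ?case
  proof (cases "X (Suc J) = []")
    case True
    show ?thesis
    proof (rule Suc.IH[OF Suc.prems(1)])
      show "X j = [] \<or> (\<exists>k' z. z \<in> kspace k' \<and> X j = [z])" if "j = 0 \<or> J < j" for j
        using Suc.prems(2)[of j] that True by (cases "j = Suc J") auto
      show "J \<le> ?K + 1" using Suc.prems(3) by simp
    qed
  next
    case False
    then obtain z where z: "X (Suc J) = [z]" using Suc.prems(1) by blast
    obtain f where f: "\<And>k. f k \<in> kspace k" "z = (\<Sum>k\<in>UNIV. f k)" using kspace_decomposition by blast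
    have upd: "X = X(Suc J := [z])" using z by auto
    have "wprod (slots ?K X (\<lambda>j. y (s j)) @ X (?K + 1))
        = (\<Sum>k'\<in>UNIV. wprod (slots ?K (X(Suc J := [f k'])) (\<lambda>j. y (s j)) @ (X(Suc J := [f k'])) (?K + 1)))" for s
    proof -
      obtain a b where ab: "\<And>x. slots ?K (X(Suc J := x)) (\<lambda>j. y (s j)) @ (X(Suc J := x)) (?K + 1) = a @ x @ b"
        using slots_split[of "Suc J" ?K X "\<lambda>j. y (s j)"] Suc.prems(3) by auto
      have "slots ?K X (\<lambda>j. y (s j)) @ X (?K + 1) = a @ [\<Sum>k\<in>UNIV. f k] @ b"
        using ab[of "[z]"] by (simp only: upd[symmetric] f(2)[symmetric])
      then show ?thesis unfolding ab by (simp only: wprod_sum_middle finite)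
    qed
    then have "amitsur_value d l k X y = (\<Sum>k'\<in>UNIV. amitsur_value d l k (X(Suc J := [f k'])) y)"
      by (subst sum.swap) (simp only: M.scale_sum_right)
    also have "\<dots> = 0"
    proof (rule sum.neutral, rule ballI, rule Suc.IH)
      fix k'
      show "(X(Suc J := [f k'])) j = [] \<or> (\<exists>z. (X(Suc J := [f k'])) j = [z])" for j
        using Suc.prems(1)[of j] by auto
      show "(X(Suc J := [f k'])) j = [] \<or> (\<exists>k'' z. z \<in> kspace k'' \<and> (X(Suc J := [f k'])) j = [z])"
        if "j = 0 \<or> J < j" for j
        using Suc.prems(2)[of j] that f(1)[of k'] by (cases "j = Suc J") auto
      show "J \<le> ?K + 1" using Suc.prems(3) by simp
    qed
    finally show ?thesis .
  qed
qed

text \<open>A nonempty block enters only through its product, so it may be collapsed to a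
  one-element block.\<close>

lemma amitsur_values:
  assumes sat: "satisfies_amitsur scale A0 A1 sharp d l" and y: "\<And>i. y i \<in> kspace k"
  shows "amitsur_value d l k X y = 0"
proof -
  let ?K = "kk d l k"
  define X' where "X' = (\<lambda>j. if 1 \<le> j \<and> j \<le> ?K + 1 \<and> X j \<noteq> [] then [wprod (X j)] else [])"
  have "wprod_eqv (slots ?K X (\<lambda>j. y (s j)) @ X (?K + 1)) (slots ?K X' (\<lambda>j. y (s j)) @ X' (?K + 1))" for s
    by (rule wprod_eqv_slots) (auto simp: X'_def wprod_eqv_def)
  then have "wprod (slots ?K X (\<lambda>j. y (s j)) @ X (?K + 1)) = wprod (slots ?K X' (\<lambda>j. y (s j)) @ X' (?K + 1))" for s
    by (simp add: wprod_eqv_def)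
  moreover have "amitsur_value d l k X' y = 0"
    by (rule amitsur_values_singletons[OF sat y, where J = "?K + 1"]) (auto simp: X'_def)
  ultimately show ?thesis by simp
qed

text \<open>In an arbitrary word the alternated variables occur in some order \<open>t\<close>. As
  \<open>chi\<close> is a class function, this order can be moved into the substituted elements,
  which leaves an \<open>amitsur_value\<close>.\<close>

lemma lincomb_single_sid:
  assumes sat: "satisfies_amitsur scale A0 A1 sharp d l" and K: "kk d l k \<le> n k" and w: "w \<in> ml_words n"
  shows "sid (lincomb k (kk d l k) (irr_char (replicate (d k + 1) (l k + 1))) (Poly_Mapping.single w 1))"
  unfolding is_sid_def
proof (intro allI impI)
  let ?K = "kk d l k" and ?chi = "irr_char (replicate (d k + 1) (l k + 1))"
  fix phi :: "var \<Rightarrow> 'a" assume phi: "\<forall>k j. phi (k, j) \<in> kspace k"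
  let ?Q = "\<lambda>(k', j). k' = k \<and> j \<le> ?K"
  let ?ys = "filter ?Q w"
  have setys: "set ?ys = (\<lambda>j. (k, j)) ` {1..?K}"
    using w K by (auto simp: ml_words_def)
  have dys: "distinct ?ys" using w by (simp add: ml_words_def)
  have len: "length ?ys = ?K"
    using distinct_card[OF dys] unfolding setys by (simp add: card_image inj_on_def)
  obtain u where u: "w = slots ?K u (\<lambda>j. ?ys ! (j - 1)) @ u (?K + 1)" "\<And>j v. v \<in> set (u j) \<Longrightarrow> \<not> ?Q v"
    using exists_slots[of w ?Q] unfolding len by blast
  \<comment> \<open>Index of the \<open>j\<close>-th alternated variable in the word; outside
    \<open>{1..?K}\<close> it is the identity, which makes \<open>t\<close> a permutation of that
    interval.\<close>
  define t where "t = (\<lambda>j. if j \<in> {1..?K} then snd (?ys ! (j - 1)) else j)"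
  have yj: "?ys ! (j - 1) \<in> set ?ys" if "j \<in> {1..?K}" for j
    using that len by (intro nth_mem) auto
  have yt: "?ys ! (j - 1) = (k, t j)" "t j \<in> {1..?K}" if "j \<in> {1..?K}" for j
    using yj[OF that] that unfolding setys by (auto simp: t_def)
  have "inj_on t {1..?K}"
  proof (rule inj_onI)
    fix i j assume ij: "i \<in> {1..?K}" "j \<in> {1..?K}" "t i = t j"
    then have "?ys ! (i - 1) = ?ys ! (j - 1)" using yt by simp
    then have "i - 1 = j - 1" using nth_eq_iff_index_eq[OF dys] ij len by auto
    then show "i = j" using ij by auto
  qed
  moreover from this have "t ` {1..?K} = {1..?K}" using yt by (intro endo_inj_surj) auto
  ultimately have "bij_betw t {1..?K} {1..?K}" by (simp add: bij_betw_def)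
  then have t: "t permutes {1..?K}" by (rule bij_imp_permutes) (simp only: t_def if_False)
  have val: "map phi (rename (at_kind k s) w) = slots ?K (\<lambda>j. map phi (u j)) (\<lambda>j. phi (k, s (t j))) @ map phi (u (?K + 1))"
    if s: "s permutes {1..?K}" for s
  proof -
    have ru: "rename (at_kind k s) (u j) = u j" for j
      unfolding rename_def
    proof (rule map_idI)
      fix x assume "x \<in> set (u j)"
      then have "\<not> ?Q x" by (rule u(2))
      moreover obtain k' i where "x = (k', i)" by (cases x)
      ultimately show "(case x of (k', i) \<Rightarrow> (k', at_kind k s k' i)) = x"
        using permutes_not_in[OF s, of i] by (auto simp: at_kind_def)
    qed
    have "rename (at_kind k s) w = slots ?K u (\<lambda>j. (k, s (t j))) @ u (?K + 1)"
    proof -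
      have "rename (at_kind k s) (slots ?K u (\<lambda>j. ?ys ! (j - 1))) = slots ?K u (\<lambda>j. (k, s (t j)))"
        unfolding rename_slots ru using yt(1) by (intro slots_cong) (auto simp: at_kind_def)
      moreover have "rename g (a @ b) = rename g a @ rename g b" for g a b by (simp add: rename_def)
      ultimately show ?thesis using arg_cong[OF u(1), of "rename (at_kind k s)"] ru by simp
    qed
    then show ?thesis by (simp add: map_slots)
  qed
  have conj: "?chi (t \<circ> s \<circ> inv t) = ?chi s" if "s permutes {1..?K}" for s
  proof -
    have "sum_list (replicate (d k + 1) (l k + 1)) = ?K" by (simp add: sum_list_replicate kk_def)
    then show ?thesis using irr_char_conj[of s "replicate (d k + 1) (l k + 1)" t] that t by (simp only:)
  qed
  let ?F = "\<lambda>s. scale (of_int (?chi s)) (wprod (slots ?K (\<lambda>j. map phi (u j)) (\<lambda>j. phi (k, s (t j))) @ map phi (u (?K + 1))))"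
  have "ev phi (lincomb k ?K ?chi (Poly_Mapping.single w 1)) = (\<Sum>s | s permutes {1..?K}. ?F s)"
    unfolding eval_lincomb_single using val by (intro sum.cong refl) simp
  \<comment> \<open>Replacing \<open>s\<close> by its conjugate under \<open>t\<close> turns
    \<open>s (t j)\<close> into \<open>t (s j)\<close>, so \<open>t\<close> now only relabels the
    substituted elements.\<close>
  also have "\<dots> = (\<Sum>s | s permutes {1..?K}. ?F (t \<circ> s \<circ> inv t))"
    using t by (intro sum_permgroup_conj[OF permgroup_all, symmetric]) simp
  also have "\<dots> = (\<Sum>s | s permutes {1..?K}. scale (of_int (?chi s))
      (wprod (slots ?K (\<lambda>j. map phi (u j)) (\<lambda>j. phi (k, t (s j))) @ map phi (u (?K + 1)))))"
    using conj permutes_inverses(2)[OF t] by (intro sum.cong refl) simp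
  also have "\<dots> = 0"
    using amitsur_values[OF sat, of "\<lambda>i. phi (k, t i)" k "\<lambda>j. map phi (u j)"] phi by simp
  finally show "ev phi (lincomb k ?K ?chi (Poly_Mapping.single w 1)) = 0" .
qed

lemma lincomb_in_ids_of_single:
  assumes K: "K \<le> n k" and single: "\<And>w. w \<in> ml_words n \<Longrightarrow> sid (lincomb k K x (Poly_Mapping.single w 1))"
  shows "lincomb k K x ` P_space n \<subseteq> ids n"
proof -
  have L: "lincomb k K x (u + v) = lincomb k K x u + lincomb k K x v"
    "lincomb k K x (poly_scale c v) = poly_scale c (lincomb k K x v)"
    "v \<in> P_space n \<Longrightarrow> lincomb k K x v \<in> P_space n" for u v c
    using quot_endo_lincomb[of K n k, OF K] by (auto simp: nc.quot_endo_def image_subset_iff)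
  have z: "lincomb k K x 0 = 0" using L(2)[of 0 0] by simp
  have "lincomb k K x v \<in> ids n" if "v \<in> nc.span ((\<lambda>w. Poly_Mapping.single w (1 :: 'f)) ` ml_words n)" for v
    using that
  proof (induction rule: nc.span_induct_alt)
    case base
    show ?case using z nc.subspace_0[OF subspace_ids] by simp
  next
    case (step c p q)
    then obtain w where w: "p = Poly_Mapping.single w 1" "w \<in> ml_words n" by blast
    have "p \<in> P_space n" using w by (simp add: P_space_def)
    then have "lincomb k K x p \<in> ids n" using w single L(3) by (simp add: ids_def)
    then show ?case using step(2) subspace_ids
      unfolding L by (intro nc.subspace_add nc.subspace_scale) auto
  qed
  then show ?thesis unfolding P_space_eq_span by blast
qed

section \<open>Passing between identities and multiplicities through traces\<close>

lemma multiplicity_zero: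
  assumes dec: "cochar_decomp scale A0 A1 sharp m" and sat: "satisfies_amitsur scale A0 A1 sharp d l"
    and lam: "lam \<in> multipartitions n" and H: "\<not> in_H d l lam"
  shows "m lam = 0"
proof -
  obtain k where k: "\<not> in_hook (d k) (l k) (lam k)" using H by (auto simp: in_H_def)
  let ?K = "(d k + 1) * (l k + 1)" and ?chi = "irr_char (replicate (d k + 1) (l k + 1))"
  have kk: "kk d l k = ?K" by (simp add: kk_def)
  let ?c = "\<lambda>mu. \<Sum>s | s permutes {1..?K}. ?chi s * irr_char mu s"
  have part: "is_partition (mu k) (n k)" if "mu \<in> multipartitions n" for mu
    using that by (simp add: multipartitions_def)
  note R = irr_char_rectangle_restriction[of _ "n k" "d k" "l k"]
  have K: "?K \<le> n k" by (rule R(4)[OF part[OF lam] k])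
  have "lincomb k ?K ?chi ` P_space n \<subseteq> ids n"
    using lincomb_single_sid[OF sat, of k n] K unfolding kk by (intro lincomb_in_ids_of_single) auto
  then have "quot_trace poly_scale (P_space n) (ids n) (lincomb k ?K ?chi) = 0"
    by (intro nc.quot_trace_eq_0[OF P_space_span subspace_ids ids_subset] quot_endo_lincomb K)
  then have "(\<Sum>mu\<in>multipartitions n. int (m mu) * (?c (mu k) * other_degrees k mu)) = 0"
    unfolding quot_trace_lincomb[where n = n and k = k, OF dec K] by (simp only: of_int_eq_0_iff)
  moreover have "0 \<le> int (m mu) * (?c (mu k) * other_degrees k mu)" if "mu \<in> multipartitions n" for mu
    using R(1)[OF part[OF that] K] other_degrees_pos[OF that, of k] by (intro mult_nonneg_nonneg) auto
  ultimately have "int (m lam) * (?c (lam k) * other_degrees k lam) = 0"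
    using lam by (subst (asm) sum_nonneg_eq_0_iff[OF finite_multipartitions]) auto
  moreover have "0 < ?c (lam k)" by (rule R(2)[OF part[OF lam] K k])
  ultimately show ?thesis using other_degrees_pos[OF lam, of k] by simp
qed

text \<open>The symmetrizer has trace zero on the quotient and is quasi-idempotent with nonzero
  factor, so it maps into the identities. Since the identities are stable under renaming, so do its
  conjugates, whose sum is \<open>kappa\<close> times the action of \<open>chi\<close>.\<close>

lemma rectangle_lincomb_in_ids:
  fixes d l :: "kind \<Rightarrow> nat" and k :: kind
  defines "K \<equiv> (d k + 1) * (l k + 1)"
  assumes dec: "cochar_decomp scale A0 A1 sharp m" and K: "K \<le> n k"
    and m: "\<And>lam. lam \<in> multipartitions n \<Longrightarrow> \<not> in_H d l lam \<Longrightarrow> m lam = 0" and v: "v \<in> P_space n"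
  shows "lincomb k K (irr_char (replicate (d k + 1) (l k + 1))) v \<in> ids n"
proof -
  interpret R: rectangle "d k + 1" "l k + 1" by unfold_locales auto
  let ?Y = "lincomb k K R.ycoeff" and ?T = "\<lambda>s. act_poly (at_kind k s)"
  have Per: "R.Per = {s. s permutes {1..K}}" by (simp only: K_def)
  have fin: "finite {s. s permutes {1..K}}" by (rule finite_permutations) simp
  have kap: "(of_int R.kappa :: 'f) \<noteq> 0" using R.kappa_nonzero by simp
  have TT: "?T s (?T t p) = ?T (s \<circ> t) (p :: 'f ncpoly)" for s t p
    by (simp only: act_poly_act_poly at_kind_comp)
  \<comment> \<open>Read coefficient by coefficient, compositions of group algebra actions become
    scalar double sums, so that \<open>ysum_ysum\<close> yields the quasi-idempotency.\<close>
  have lk: "Poly_Mapping.lookup (?Y p) u = R.ysum (\<lambda>s. Poly_Mapping.lookup (?T s p) u)" for p u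
    unfolding R.ysum_eq_sum_ycoeff Per by (simp add: lincomb_def lookup_sum)
  have TY: "?T s (?Y p) = (\<Sum>t | t permutes {1..K}. poly_scale (of_int (R.ycoeff t)) (?T (s \<circ> t) p))" for s p
    by (simp add: lincomb_def act_poly_sum act_poly_scale TT)
  have idem: "?Y (?Y p) = poly_scale (of_int R.kappa) (?Y p)" for p
  proof (rule poly_mapping_eqI)
    fix u
    have "Poly_Mapping.lookup (?T s (?Y p)) u = R.ysum (\<lambda>t. Poly_Mapping.lookup (?T (s \<circ> t) p) u)" for s
      unfolding TY R.ysum_eq_sum_ycoeff Per by (simp add: lookup_sum)
    then have "Poly_Mapping.lookup (?Y (?Y p)) u = R.ysum (\<lambda>s. R.ysum (\<lambda>t. Poly_Mapping.lookup (?T (s \<circ> t) p) u))"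
      unfolding lk[of "?Y p"] by simp
    also have "\<dots> = of_int R.kappa * Poly_Mapping.lookup (?Y p) u"
      unfolding lk[of p] by (rule R.ysum_ysum)
    finally show "Poly_Mapping.lookup (?Y (?Y p)) u = Poly_Mapping.lookup (poly_scale (of_int R.kappa) (?Y p)) u"
      by simp
  qed
  \<comment> \<open>Inside the hook, \<open>irr_char (lam k)\<close> is a class function; its value
    on the symmetrizer is therefore, up to a factorial, its pairing with
    \<open>psi = kappa chi\<close>. The pairing with \<open>chi\<close> vanishes there.\<close>
  have zero: "int (m lam) * ((\<Sum>s | s permutes {1..K}. R.ycoeff s * irr_char (lam k) s) * other_degrees k lam) = 0"
    if lam: "lam \<in> multipartitions n" for lam
  proof (cases "in_hook (d k) (l k) (lam k)")
    case False
    then have "m lam = 0" using m[OF lam] by (auto simp: in_H_def)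
    then show ?thesis by simp
  next
    case True
    have part: "is_partition (lam k) (n k)" using lam by (simp add: multipartitions_def)
    have sl: "sum_list (lam k) = n k" using part by (simp add: is_partition_def)
    have cls: "irr_char (lam k) (g \<circ> s \<circ> inv g) = irr_char (lam k) s" if "s \<in> R.Per" "g \<in> R.Per" for s g
    proof -
      have "h permutes {1..sum_list (lam k)}" if "h \<in> R.Per" for h
        using that K unfolding Per sl by (auto intro: permutes_subset)
      then show ?thesis using that by (intro irr_char_conj) blast+
    qed
    have "fact ((d k + 1) * (l k + 1)) * R.ysum (irr_char (lam k)) = (\<Sum>s\<in>R.Per. R.psi s * irr_char (lam k) s)"
      using R.sum_psi[of "irr_char (lam k)"] cls by (simp only: of_int_eq_id id_apply)
    also have "\<dots> = R.kappa * (\<Sum>s\<in>R.Per. R.chi s * irr_char (lam k) s)"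
      unfolding sum_distrib_left by (intro sum.cong refl) (simp only: R.psi_eq_kappa_chi mult.assoc)
    also have "(\<Sum>s\<in>R.Per. R.chi s * irr_char (lam k) s) = 0"
      using irr_char_rectangle_restriction(3)[OF part _ True] K by (simp only: K_def)
    finally have "R.ysum (irr_char (lam k)) = 0"
      by (simp only: mult_zero_right mult_eq_0_iff fact_nonzero simp_thms)
    then have "(\<Sum>s | s permutes {1..K}. R.ycoeff s * irr_char (lam k) s) = 0"
      unfolding R.ysum_eq_sum_ycoeff Per by (simp only: of_int_eq_id id_apply)
    then show ?thesis by simp
  qed
  have "quot_trace poly_scale (P_space n) (ids n) ?Y = 0"
    unfolding quot_trace_lincomb[where n = n and k = k, OF dec K]
    using zero by (subst sum.neutral) auto
  then have Y: "?Y ` P_space n \<subseteq> ids n"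
    using idem kap
    by (intro nc.quasi_idempotent_quot_trace_0[OF P_space_span subspace_ids ids_subset quot_endo_lincomb[of K n k, OF K]]) auto
  \<comment> \<open>Conjugation by \<open>g\<close> changes the coefficients to
    \<open>ycoeff (g \<circ> s \<circ> inv g)\<close>, and summing these over \<open>g\<close> gives
    \<open>psi s\<close>.\<close>
  have inner: "?T (inv g) (?Y (?T g v)) = (\<Sum>s\<in>R.Per. poly_scale (of_int (R.ycoeff (g \<circ> s \<circ> inv g))) (?T s v))"
    if g: "g \<in> R.Per" for g
  proof -
    note gi = permgroupD(3,4)[OF permgroup_all g]
    have c: "inv g \<circ> (g \<circ> s \<circ> inv g) \<circ> g = s" for s
    proof -
      have "inv g \<circ> (g \<circ> s \<circ> inv g) \<circ> g = (inv g \<circ> g) \<circ> s \<circ> (inv g \<circ> g)" by (simp only: comp_assoc)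
      then show ?thesis using gi by simp
    qed
    have "?T (inv g) (?Y (?T g v)) = (\<Sum>s\<in>R.Per. poly_scale (of_int (R.ycoeff s)) (?T (inv g \<circ> s \<circ> g) v))"
      unfolding TY TT Per by simp
    also have "\<dots> = (\<Sum>s\<in>R.Per. poly_scale (of_int (R.ycoeff (g \<circ> s \<circ> inv g))) (?T (inv g \<circ> (g \<circ> s \<circ> inv g) \<circ> g) v))"
      by (rule sum_permgroup_conj[OF permgroup_all g, symmetric])
    finally show ?thesis unfolding c .
  qed
  have "poly_scale (of_int R.kappa) (lincomb k K R.chi v) = (\<Sum>s\<in>R.Per. poly_scale (of_int (R.psi s)) (?T s v))"
    unfolding lincomb_def Per[symmetric] nc.scale_sum_right
    by (intro sum.cong refl) (simp only: R.psi_eq_kappa_chi nc.scale_scale of_int_mult)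
  also have "\<dots> = (\<Sum>s\<in>R.Per. \<Sum>g\<in>R.Per. poly_scale (of_int (R.ycoeff (g \<circ> s \<circ> inv g))) (?T s v))"
    unfolding R.psi_def of_int_sum nc.scale_sum_left ..
  also have "\<dots> = (\<Sum>g\<in>R.Per. ?T (inv g) (?Y (?T g v)))"
    using inner by (subst sum.swap) simp
  also have "\<dots> \<in> ids n"
  proof (rule nc.subspace_sum[OF subspace_ids])
    fix g assume g: "g \<in> R.Per"
    then have G: "at_kind k g \<in> group_G n" "at_kind k (inv g) \<in> group_G n"
      using K unfolding Per by (auto intro!: at_kind_group[where K = K] permutes_inv)
    have "?Y (?T g v) \<in> ids n" using Y act_poly_P_space[OF G(1) v] by blast
    then show "?T (inv g) (?Y (?T g v)) \<in> ids n"
      using quot_endo_act[OF G(2)] by (simp add: nc.quot_endo_def image_subset_iff)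
  qed
  finally have "poly_scale (of_int R.kappa) (lincomb k K R.chi v) \<in> ids n" .
  then have "poly_scale (inverse (of_int R.kappa)) (poly_scale (of_int R.kappa) (lincomb k K R.chi v)) \<in> ids n"
    by (rule nc.subspace_scale[OF subspace_ids])
  then show ?thesis using kap by simp
qed

text \<open>The words of an Amitsur polynomial use arbitrary index sets, so they are relabelled injectively
  to words over initial segments, fixing the alternated variables.\<close>
lemma amitsur_sid:
  assumes dec: "cochar_decomp scale A0 A1 sharp m"
    and m: "\<And>n lam. lam \<in> multipartitions n \<Longrightarrow> \<not> in_H d l lam \<Longrightarrow> m lam = 0"
  shows "sid (amitsur_poly d l k c)"
  unfolding is_sid_def
proof (intro allI impI)
  let ?K = "kk d l k" and ?chi = "irr_char (replicate (d k + 1) (l k + 1))"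
  fix phi :: "var \<Rightarrow> 'a" assume phi: "\<forall>k j. phi (k, j) \<in> kspace k"
  define W where "W = amitsur_word d l k c id"
  define J where "J = (\<lambda>k'. {j. (k', j) \<in> set W})"
  define n where "n = (\<lambda>k'. card (J k'))"
  have finJ: "finite (J k')" for k'
    by (rule finite_subset[of _ "snd ` set W"]) (auto simp: J_def image_iff Bex_def)
  have spec: "{1..?K} \<subseteq> J k"
    unfolding J_def W_def amitsur_word_eq_slots by (auto simp: set_slots)
  have pos: "1 \<le> j" if "j \<in> J k'" for k' j
    using that unfolding J_def W_def amitsur_word_eq_slots
    by (auto simp: set_slots xvar_def kk_def split: option.splits if_splits)
  have Kn: "?K \<le> n k" using card_mono[OF finJ spec] by (simp add: n_def)
  \<comment> \<open>The relabelling must be the identity on \<open>{1..?K}\<close> for kind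
    \<open>k\<close>, since otherwise it would not commute with the alternation.\<close>
  have "\<exists>r. bij_betw r (J k') {1..n k'} \<and> (k' = k \<longrightarrow> (\<forall>i\<in>{1..?K}. r i = i))" for k'
  proof (cases "k' = k")
    case False
    have "\<exists>h. bij_betw h (J k') {1..n k'}"
      by (rule finite_same_card_bij) (simp_all add: finJ n_def)
    then show ?thesis using False by simp
  next
    case True
    have "card (J k - {1..?K}) = card ({1..n k} - {1..?K})"
      using finJ spec Kn by (simp add: card_Diff_subset n_def)
    then obtain h where h: "bij_betw h (J k - {1..?K}) ({1..n k} - {1..?K})"
      using finite_same_card_bij[of "J k - {1..?K}" "{1..n k} - {1..?K}"] finJ[of k] by blast
    let ?r = "\<lambda>i. if i \<in> {1..?K} then i else h i"
    have "bij_betw ?r ({1..?K} \<union> (J k - {1..?K})) ({1..?K} \<union> ({1..n k} - {1..?K}))"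
    proof (rule bij_betw_combine)
      show "bij_betw ?r {1..?K} {1..?K}" by (auto simp: bij_betw_def inj_on_def)
      show "bij_betw ?r (J k - {1..?K}) ({1..n k} - {1..?K})"
        using h by (rule bij_betw_cong[THEN iffD1, rotated]) auto
    qed auto
    moreover have "{1..?K} \<union> (J k - {1..?K}) = J k" "{1..?K} \<union> ({1..n k} - {1..?K}) = {1..n k}"
      using spec Kn by auto
    ultimately show ?thesis using True by (intro exI[of _ ?r]) simp
  qed
  then obtain r where r: "\<And>k'. bij_betw (r k') (J k') {1..n k'}" "\<And>i. i \<in> {1..?K} \<Longrightarrow> r k i = i"
    by metis
  have rJ: "r k' j \<in> {1..n k'}" "inv_into (J k') (r k') (r k' j) = j" if "j \<in> J k'" for k' j
    using that r(1)[of k'] by (auto simp: bij_betw_def)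
  let ?w = "rename r W"
  have w: "?w \<in> ml_words n"
  proof -
    have "inj_on (\<lambda>(k', j). (k', r k' j)) (set W)"
    proof (rule inj_onI)
      fix x y assume xy: "x \<in> set W" "y \<in> set W" "(\<lambda>(k', j). (k', r k' j)) x = (\<lambda>(k', j). (k', r k' j)) y"
      obtain k' i where x: "x = (k', i)" by (cases x)
      with xy obtain j where y: "y = (k', j)" "r k' i = r k' j" by (cases y) auto
      have ij: "i \<in> J k'" "j \<in> J k'" using xy x y by (auto simp: J_def)
      have "i = j" by (rule inj_onD[OF bij_betw_imp_inj_on[OF r(1)[of k']] y(2) ij])
      then show "x = y" using x y by simp
    qed
    then have "distinct ?w" using distinct_amitsur_word[of d l k c] by (simp add: rename_def distinct_map W_def)
    moreover have "set ?w = {(k', j). 1 \<le> j \<and> j \<le> n k'}"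
    proof (intro equalityI subsetI)
      fix x assume "x \<in> set ?w"
      then obtain k' j where "x = (k', r k' j)" "j \<in> J k'" by (auto simp: rename_def J_def)
      then show "x \<in> {(k', j). 1 \<le> j \<and> j \<le> n k'}" using rJ(1) by auto
    next
      fix x assume "x \<in> {(k', j). 1 \<le> j \<and> j \<le> n k'}"
      then obtain k' j where x: "x = (k', j)" "j \<in> {1..n k'}" by auto
      from x(2) have "j \<in> r k' ` J k'" unfolding bij_betw_imp_surj_on[OF r(1)] .
      then obtain i where "i \<in> J k'" "j = r k' i" by blast
      then have "(k', i) \<in> set W" "x = (\<lambda>(k', j). (k', r k' j)) (k', i)" using x by (auto simp: J_def)
      then show "x \<in> set ?w" unfolding rename_def set_map by (rule rev_image_eqI)
    qed
    ultimately show ?thesis by (simp add: ml_words_def)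
  qed
  \<comment> \<open>The substitution transported along the relabelling. Indices outside the initial
    segments receive 0, which belongs to every \<open>kspace k'\<close>.\<close>
  define psi where "psi = (\<lambda>(k', j). if j \<in> {1..n k'} then phi (k', inv_into (J k') (r k') j) else 0)"
  have "psi (k', j) \<in> kspace k'" for k' j using phi kspace_zero by (simp add: psi_def)
  moreover have "lincomb k ?K ?chi (Poly_Mapping.single ?w 1) \<in> ids n"
  proof -
    have kk: "kk d l k = (d k + 1) * (l k + 1)" by (simp add: kk_def)
    have "Poly_Mapping.single ?w (1 :: 'f) \<in> P_space n" using w by (simp add: P_space_def)
    then show ?thesis
      unfolding kk using Kn[unfolded kk] by (intro rectangle_lincomb_in_ids[OF dec _ m])
  qed
  ultimately have "ev psi (lincomb k ?K ?chi (Poly_Mapping.single ?w 1)) = 0"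
    by (simp add: ids_def is_sid_def)
  moreover have "map psi (rename (at_kind k s) ?w) = map phi (rename (at_kind k s) W)" if s: "s permutes {1..?K}" for s
    unfolding rename_def map_map
  proof (rule map_cong[OF refl])
    fix x assume xW: "x \<in> set W"
    obtain k' j where xe: "x = (k', j)" by (rule prod.exhaust)
    have x: "x = (k', j)" "j \<in> J k'" using xe xW by (simp_all add: J_def)
    have "psi (k', at_kind k s k' (r k' j)) = phi (k', at_kind k s k' j)"
    proof (cases "k' = k \<and> j \<in> {1..?K}")
      case True
      then have sj: "s j \<in> {1..?K}" using permutes_in_image[OF s] by blast
      then have "s j \<in> J k" "r k (s j) = s j" using spec r(2) by auto
      then show ?thesis using True r(2)[of j] rJ[of "s j" k] by (simp add: at_kind_def psi_def)
    next
      case False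
      \<comment> \<open>Since \<open>r k\<close> is injective on \<open>J k\<close> and fixes
        \<open>{1..?K}\<close>, no other index is sent into that interval; hence \<open>s\<close>
        moves neither the old nor the new label.\<close>
      have "r k j \<notin> {1..?K}" if "k' = k"
      proof
        assume "r k j \<in> {1..?K}"
        then have "r k (r k j) = r k j" "r k j \<in> J k" using r(2) spec by auto
        then have "r k j = j" using rJ(2)[of j k] rJ(2)[of "r k j" k] x that by metis
        then show False using \<open>r k j \<in> {1..?K}\<close> False that by simp
      qed
      then have "at_kind k s k' (r k' j) = r k' j" "at_kind k s k' j = j"
        using permutes_not_in[OF s] False by (auto simp: at_kind_def)
      then show ?thesis using rJ[OF x(2)] by (simp add: psi_def)
    qed
    then show "(psi \<circ> ((\<lambda>(k', j). (k', at_kind k s k' j)) \<circ> (\<lambda>(k', j). (k', r k' j)))) x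
      = (phi \<circ> (\<lambda>(k', j). (k', at_kind k s k' j))) x" using x by simp
  qed
  ultimately show "ev phi (amitsur_poly d l k c) = 0"
    unfolding amitsur_poly_eq_lincomb eval_lincomb_single W_def[symmetric] by simp
qed

end

theorem theorem7p2:
  fixes scale :: "'f::field_char_0 \<Rightarrow> 'a::ring \<Rightarrow> 'a"
    and A0 A1 :: "'a set" and sharp :: "'a \<Rightarrow> 'a"
    and m :: "(kind \<Rightarrow> nat list) \<Rightarrow> nat"
    and d l :: "kind \<Rightarrow> nat"
  assumes "is_superalgebra scale A0 A1"
    and "is_superinvolution scale A0 A1 sharp \<or> is_graded_involution scale A0 A1 sharp"
    and "cochar_decomp scale A0 A1 sharp m"
    and "is_PI scale"
  shows "satisfies_amitsur scale A0 A1 sharp d l \<longleftrightarrow>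
    (\<forall>n. \<forall>lam\<in>multipartitions n. \<not> in_H d l lam \<longrightarrow> m lam = 0)"
proof -
  interpret sharp_superalgebra scale A0 A1 sharp
    using assms(1,2) by unfold_locales (auto simp: is_superinvolution_def is_graded_involution_def)
  show ?thesis
  proof
    assume "satisfies_amitsur scale A0 A1 sharp d l"
    then show "\<forall>n. \<forall>lam\<in>multipartitions n. \<not> in_H d l lam \<longrightarrow> m lam = 0"
      using multiplicity_zero[OF assms(3)] by blast
  next
    assume "\<forall>n. \<forall>lam\<in>multipartitions n. \<not> in_H d l lam \<longrightarrow> m lam = 0"
    then show "satisfies_amitsur scale A0 A1 sharp d l"
      unfolding satisfies_amitsur_def by (intro allI amitsur_sid[OF assms(3)]) blast
  qed
qed

end
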